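(* Let $Q$ be a finite-dimensional smooth manifold, let $k\geq 1$ be an integer, and let $R_d$ be a discretization map on $Q$. Then the lift to the higher-order tangent bundle $$R_d^{(k)} = T^{(k)}R_d\circ \Phi^{(k)}\colon T(T^{(k)}Q)\to T^{(k)}Q\times T^{(k)}Q$$ (defined on the open neighborhood of the zero section of $T(T^{(k)}Q)$ induced by the domain of $R_d$) is a discretization map on the manifold $T^{(k)}Q$.
   Context: **Discretization map.** Let $M$ be a smooth manifold. A smooth map $R_d\colon U\subset TM\to M\times M$, $R_d(q,v)=(R^1(q,v),R^2(q,v))$, where $U$ is an open neighborhood of the zero section of $TM$, is a discretization map on $M$ if (1) $R_d(q,0)=(q,q)$ for all $q\in M$; and (2) for every $q\in M$, the linear map $T_{0_q}R^2_q-T_{0_q}R^1_q\colon T_{0_q}T_qM\simeq T_qM\to T_qM$ is the identity of $T_qM$, where $R^a_q$ ($a=1,2$) is the restriction of $R^a$ to (the part in $U$ of) $T_qM$. A discretization map is often written as $R_d\colon TM\to M\times M$, although it need only be defined on such a $U$. **Higher-order tangent bundle.** For a smooth manifold $M$, two smooth curves $c_1,c_2$ in $M$ defined around $0\in\mathbb{R}$ are $\sim_k$-related if $c_1(0)=c_2(0)$ and, in local coordinates, their derivatives at $0$ up to order $k$ agree. The class of $c$ is its $k$-jet $j_0^{(k)}c$, and the smooth manifold of all such $k$-jets is $T^{(k)}M$ (so $T^{(1)}M=TM$). For a smooth map $F\colon M\to N$, $T^{(k)}F\colon T^{(k)}M\to T^{(k)}N$ is defined by $T^{(k)}F(j_0^{(k)}c)=j_0^{(k)}(F\circ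 c)$. One identifies $T^{(k)}(M\times N)$ with $T^{(k)}M\times T^{(k)}N$. **Canonical identification.** $\Phi^{(k)}\colon T(T^{(k)}Q)\to T^{(k)}(TQ)$ is the canonical diffeomorphism given as follows: every $X\in T(T^{(k)}Q)$ can be written as $X=\left.\frac{d}{dt}\right|_{t=0}j_0^{(k)}(s\mapsto c(t,s))$ for some smooth map $(t,s)\mapsto c(t,s)\in Q$ defined near $(0,0)\in\mathbb{R}^2$, and then $\Phi^{(k)}(X)=j_0^{(k)}\left(s\mapsto \left.\frac{\partial}{\partial t}\right|_{t=0}c(t,s)\right)$. (It is well defined.) **Lift.** If $R_d\colon U\subset TQ\to Q\times Q$ is a discretization map, then $T^{(k)}R_d\colon T^{(k)}U\to T^{(k)}(Q\times Q)\cong T^{(k)}Q\times T^{(k)}Q$, with $T^{(k)}U$ open in $T^{(k)}(TQ)$, and $R_d^{(k)}:=T^{(k)}R_d\circ\Phi^{(k)}$ is defined on the open set $(\Phi^{(k)})^{-1}(T^{(k)}U)\subset T(T^{(k)}Q)$. *)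

theory Defs
  imports "HOL-Analysis.Analysis"
begin

text \<open>Smooth maps between normed spaces. The definition is meant for open \<open>S\<close> and finite-dimensional
  domains, where differentiability of all iterated directional derivatives is the same as being
  \<open>C\<^sup>\<infinity>\<close>.\<close>

primrec Ck_on :: "nat \<Rightarrow> 'x::real_normed_vector set \<Rightarrow> ('x \<Rightarrow> 'y::real_normed_vector) \<Rightarrow> bool" where
  "Ck_on 0 S f \<longleftrightarrow> continuous_on S f"
| "Ck_on (Suc n) S f \<longleftrightarrow>
     (\<forall>x\<in>S. f differentiable (at x)) \<and> (\<forall>v. Ck_on n S (\<lambda>x. frechet_derivative f (at x) v))"

definition smooth_on :: "'x::real_normed_vector set \<Rightarrow> ('x \<Rightarrow> 'y::real_normed_vector) \<Rightarrow> bool" where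
  "smooth_on S f \<longleftrightarrow> (\<forall>n. Ck_on n S f)"

text \<open>A manifold is given by an atlas: a set of charts \<open>(D, \<phi>)\<close>, where only the values of \<open>\<phi>\<close> on \<open>D\<close>
  matter. The points and the topology are determined by the atlas: \<open>W\<close> is open iff its image in
  every chart is open. The atlas need not be maximal.\<close>

type_synonym ('a, 'e) atlas = "('a set \<times> ('a \<Rightarrow> 'e)) set"

definition carrier :: "('a, 'e) atlas \<Rightarrow> 'a set" where
  "carrier A = (\<Union>(D, \<phi>)\<in>A. D)"

definition man_open :: "('a, 'e::real_normed_vector) atlas \<Rightarrow> 'a set \<Rightarrow> bool" where
  "man_open A W \<longleftrightarrow> W \<subseteq> carrier A \<and> (\<forall>(D, \<phi>)\<in>A. open (\<phi> ` (W \<inter> D)))"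

definition man_top :: "('a, 'e::real_normed_vector) atlas \<Rightarrow> 'a topology" where
  "man_top A = topology (man_open A)"

text \<open>Finite-dimensionality is an explicit condition rather than the class \<open>euclidean_space\<close>,
  since that class has no zero-dimensional instances.\<close>

definition smooth_manifold :: "('a, 'e::real_normed_vector) atlas \<Rightarrow> bool" where
  "smooth_manifold A \<longleftrightarrow>
     (\<exists>B::'e set. finite B \<and> span B = UNIV) \<and>
     (\<forall>(D, \<phi>)\<in>A. inj_on \<phi> D \<and> open (\<phi> ` D)) \<and>
     (\<forall>(D, \<phi>)\<in>A. \<forall>(E, \<psi>)\<in>A.
        open (\<phi> ` (D \<inter> E)) \<and> smooth_on (\<phi> ` (D \<inter> E)) (\<psi> \<circ> inv_into D \<phi>)) \<and>
     Hausdorff_space (man_top A) \<and> second_countable (man_top A)"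

lemma openin_man_top:
  assumes "\<forall>(D, \<phi>)\<in>A. inj_on \<phi> D"
  shows "openin (man_top A) = man_open A"
proof -
  have int: "man_open A (S \<inter> T)" if S: "man_open A S" and T: "man_open A T" for S T
    unfolding man_open_def
  proof (intro conjI ballI, goal_cases)
    case 1
    show ?case using S by (auto simp: man_open_def)
  next
    case (2 c)
    obtain D \<phi> where c: "c = (D, \<phi>)" by fastforce
    have inj: "inj_on \<phi> D" using assms 2 c by auto
    have "\<phi> ` (S \<inter> T \<inter> D) = \<phi> ` ((S \<inter> D) \<inter> (T \<inter> D))"
      by (rule arg_cong[where f = "image \<phi>"]) blast
    also have "\<dots> = \<phi> ` (S \<inter> D) \<inter> \<phi> ` (T \<inter> D)"
      by (rule inj_on_image_Int[OF inj]) auto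
    finally show ?case using S T 2 c by (auto simp: man_open_def)
  qed
  have Un: "man_open A (\<Union>K)" if K: "\<forall>S\<in>K. man_open A S" for K
    unfolding man_open_def
  proof (intro conjI ballI, goal_cases)
    case 1
    show ?case using K by (auto simp: man_open_def)
  next
    case (2 c)
    obtain D \<phi> where c: "c = (D, \<phi>)" by fastforce
    have "\<phi> ` (\<Union>K \<inter> D) = (\<Union>S\<in>K. \<phi> ` (S \<inter> D))" by auto
    moreover have "open (\<phi> ` (S \<inter> D))" if "S \<in> K" for S
      using K that 2 c by (auto simp: man_open_def)
    ultimately show ?case using c by auto
  qed
  have "istopology (man_open A)"
    unfolding istopology_def using int Un by blast
  then show ?thesis
    by (simp add: man_top_def topology_inverse')
qed

definition eucl_atlas :: "('x, 'x) atlas" where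
  "eucl_atlas = {(UNIV, id)}"

definition prod_atlas :: "('a, 'e) atlas \<Rightarrow> ('b, 'f) atlas \<Rightarrow> ('a \<times> 'b, 'e \<times> 'f) atlas" where
  "prod_atlas A B = {(D \<times> E, map_prod \<phi> \<psi>) |D \<phi> E \<psi>. (D, \<phi>) \<in> A \<and> (E, \<psi>) \<in> B}"

text \<open>Smoothness on an open subset \<open>U\<close>; continuity is implied by the requirement that \<open>W\<close> is open and
  mapped into a single chart.\<close>

definition smooth_map_on ::
  "('a, 'e::real_normed_vector) atlas \<Rightarrow> ('b, 'f::real_normed_vector) atlas \<Rightarrow> 'a set \<Rightarrow> ('a \<Rightarrow> 'b) \<Rightarrow> bool"
where
  "smooth_map_on A B U F \<longleftrightarrow>
     (\<forall>p\<in>U. \<exists>(D, \<phi>)\<in>A. \<exists>(E, \<psi>)\<in>B. \<exists>W. man_open A W \<and> p \<in> W \<and> W \<subseteq> U \<inter> D \<and> F ` W \<subseteq> E \<and>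
        smooth_on (\<phi> ` W) (\<psi> \<circ> F \<circ> inv_into D \<phi>))"

definition smooth_near :: "'x::real_normed_vector \<Rightarrow> ('a, 'e::real_normed_vector) atlas \<Rightarrow> ('x \<Rightarrow> 'a) \<Rightarrow> bool"
where
  "smooth_near x A c \<longleftrightarrow> (\<exists>W. open W \<and> x \<in> W \<and> smooth_map_on eucl_atlas A W c)"

definition nth_vderiv :: "nat \<Rightarrow> (real \<Rightarrow> 'x::real_normed_vector) \<Rightarrow> real \<Rightarrow> 'x" where
  "nth_vderiv i f = ((\<lambda>g t. vector_derivative g (at t)) ^^ i) f"

text \<open>Jets are equivalence classes of curves. A curve defined around \<open>0\<close> is represented by arbitrary
  total extensions; since only the germ at \<open>0\<close> enters the equivalence relation, the extension is
  immaterial.\<close>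

type_synonym 'a jet = "(real \<Rightarrow> 'a) set"

definition jet :: "('a, 'e::real_normed_vector) atlas \<Rightarrow> nat \<Rightarrow> (real \<Rightarrow> 'a) \<Rightarrow> 'a jet" where
  "jet A k c = {c'. smooth_near 0 A c' \<and> c' 0 = c 0 \<and>
     (\<forall>(D, \<phi>)\<in>A. c 0 \<in> D \<longrightarrow> (\<forall>i\<le>k. nth_vderiv i (\<phi> \<circ> c') 0 = nth_vderiv i (\<phi> \<circ> c) 0))}"

definition jet_rep :: "'a jet \<Rightarrow> real \<Rightarrow> 'a" where
  "jet_rep z = (SOME c. c \<in> z)"

definition jet_base :: "'a jet \<Rightarrow> 'a" where
  "jet_base z = jet_rep z 0"

text \<open>For open \<open>U\<close> this is \<open>T\<^sup>(\<^sup>k\<^sup>) U\<close>, regarded as a subset of \<open>T\<^sup>(\<^sup>k\<^sup>) M\<close>.\<close>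

definition jets_over :: "('a, 'e::real_normed_vector) atlas \<Rightarrow> nat \<Rightarrow> 'a set \<Rightarrow> 'a jet set" where
  "jets_over A k U = {jet A k c |c. smooth_near 0 A c \<and> c 0 \<in> U}"

definition jet_map :: "('b, 'f::real_normed_vector) atlas \<Rightarrow> nat \<Rightarrow> ('a \<Rightarrow> 'b) \<Rightarrow> 'a jet \<Rightarrow> 'b jet" where
  "jet_map B k F z = jet B k (F \<circ> jet_rep z)"

text \<open>The induced chart of \<open>T\<^sup>(\<^sup>k\<^sup>) M\<close> sends a jet to its derivatives of order \<open>0, \<dots>, k\<close>. These are
  stored in \<open>'e ^ 'k\<close> with \<open>CARD('k) = k + 1\<close>; the element \<open>i\<close> of the linearly ordered index type
  stands for the order \<open>card {..<i}\<close>.\<close>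

definition jet_coord :: "('a \<Rightarrow> 'e::real_normed_vector) \<Rightarrow> nat \<Rightarrow> 'a jet \<Rightarrow> 'e" where
  "jet_coord \<phi> i z = nth_vderiv i (\<phi> \<circ> jet_rep z) 0"

definition jet_chart :: "('a \<Rightarrow> 'e::real_normed_vector) \<Rightarrow> 'a jet \<Rightarrow> 'e ^ 'k::{finite, linorder}" where
  "jet_chart \<phi> z = (\<chi> i. jet_coord \<phi> (card {..<i}) z)"

definition jet_atlas ::
  "nat \<Rightarrow> ('a, 'e::real_normed_vector) atlas \<Rightarrow> ('a jet, 'e ^ 'k::{finite, linorder}) atlas"
where
  "jet_atlas k A = {(jets_over A k D, jet_chart \<phi>) |D \<phi>. (D, \<phi>) \<in> A}"

text \<open>The tangent bundle is \<open>T\<^sup>(\<^sup>1\<^sup>) M\<close>.\<close>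

definition tangent_atlas :: "('a, 'e::real_normed_vector) atlas \<Rightarrow> ('a jet, 'e ^ 2) atlas" where
  "tangent_atlas A = jet_atlas 1 A"

definition tangent_space :: "('a, 'e::real_normed_vector) atlas \<Rightarrow> 'a \<Rightarrow> 'a jet set" where
  "tangent_space A q = jets_over A 1 {q}"

definition zero_vector :: "('a, 'e::real_normed_vector) atlas \<Rightarrow> 'a \<Rightarrow> 'a jet" where
  "zero_vector A q = jet A 1 (\<lambda>t. q)"

definition tangent_scale :: "('a, 'e::real_normed_vector) atlas \<Rightarrow> real \<Rightarrow> 'a jet \<Rightarrow> 'a jet" where
  "tangent_scale A r X = (THE Z. Z \<in> tangent_space A (jet_base X) \<and>
     (\<forall>(D, \<phi>)\<in>A. jet_base X \<in> D \<longrightarrow> jet_coord \<phi> 1 Z = r *\<^sub>R jet_coord \<phi> 1 X))"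

text \<open>Only meaningful for tangent vectors \<open>X\<close>, \<open>Y\<close> at the same point.\<close>

definition tangent_diff :: "('a, 'e::real_normed_vector) atlas \<Rightarrow> 'a jet \<Rightarrow> 'a jet \<Rightarrow> 'a jet" where
  "tangent_diff A X Y = (THE Z. Z \<in> tangent_space A (jet_base X) \<and>
     (\<forall>(D, \<phi>)\<in>A. jet_base X \<in> D \<longrightarrow> jet_coord \<phi> 1 Z = jet_coord \<phi> 1 X - jet_coord \<phi> 1 Y))"

text \<open>The identification of \<open>T\<^sub>qM\<close> with \<open>T(T\<^sub>qM)\<close> at \<open>0\<^sub>q\<close>, followed by the inclusion into \<open>T(TM)\<close>:
  \<open>v\<close> is sent to the velocity at \<open>t = 0\<close> of \<open>t \<mapsto> t v\<close>. Composing with the tangent map of \<open>R\<^sup>a\<close> gives the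
  tangent map at \<open>0\<^sub>q\<close> of the restriction of \<open>R\<^sup>a\<close> to \<open>T\<^sub>qM\<close>.\<close>

definition vertical_lift :: "('a, 'e::real_normed_vector) atlas \<Rightarrow> 'a jet \<Rightarrow> 'a jet jet" where
  "vertical_lift A v = jet (tangent_atlas A) 1 (\<lambda>t. tangent_scale A t v)"

definition discretization_map ::
  "('a, 'e::real_normed_vector) atlas \<Rightarrow> 'a jet set \<Rightarrow> ('a jet \<Rightarrow> 'a \<times> 'a) \<Rightarrow> bool"
where
  "discretization_map A U R \<longleftrightarrow>
     man_open (tangent_atlas A) U \<and>
     smooth_map_on (tangent_atlas A) (prod_atlas A A) U R \<and>
     (\<forall>q\<in>carrier A. zero_vector A q \<in> U \<and> R (zero_vector A q) = (q, q)) \<and>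
     (\<forall>q\<in>carrier A. \<forall>v\<in>tangent_space A q.
        tangent_diff A (jet_map A 1 (snd \<circ> R) (vertical_lift A v))
                       (jet_map A 1 (fst \<circ> R) (vertical_lift A v)) = v)"

text \<open>The canonical identification \<open>\<Phi>\<^sup>(\<^sup>k\<^sup>)\<close> from \<open>T(T\<^sup>(\<^sup>k\<^sup>) Q)\<close> to \<open>T\<^sup>(\<^sup>k\<^sup>)(TQ)\<close>. The type argument only selects the
  model space of \<open>T\<^sup>(\<^sup>k\<^sup>) Q\<close>.\<close>

definition canon_Phi ::
  "'k::{finite, linorder} itself \<Rightarrow> nat \<Rightarrow> ('a, 'e::real_normed_vector) atlas \<Rightarrow> 'a jet jet \<Rightarrow> 'a jet jet"
where
  "canon_Phi K k Q X =
     (let c = (SOME c :: real \<times> real \<Rightarrow> 'a. smooth_near 0 Q c \<and>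
                 X = jet (jet_atlas k Q :: ('a jet, 'e ^ 'k::{finite, linorder}) atlas) 1 (\<lambda>t. jet Q k (\<lambda>s. c (t, s))))
      in jet (tangent_atlas Q) k (\<lambda>s. jet Q 1 (\<lambda>t. c (t, s))))"

text \<open>The identification of \<open>T\<^sup>(\<^sup>k\<^sup>)(M \<times> N)\<close> with \<open>T\<^sup>(\<^sup>k\<^sup>) M \<times> T\<^sup>(\<^sup>k\<^sup>) N\<close>.\<close>

definition jet_split ::
  "('a, 'e::real_normed_vector) atlas \<Rightarrow> ('b, 'f::real_normed_vector) atlas \<Rightarrow> nat \<Rightarrow>
   ('a \<times> 'b) jet \<Rightarrow> 'a jet \<times> 'b jet"
where
  "jet_split A B k z = (jet_map A k fst z, jet_map B k snd z)"

definition lift_domain ::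
  "'k::{finite, linorder} itself \<Rightarrow> nat \<Rightarrow> ('a, 'e::real_normed_vector) atlas \<Rightarrow> 'a jet set \<Rightarrow> 'a jet jet set"
where
  "lift_domain K k Q U =
     {X \<in> carrier (tangent_atlas (jet_atlas k Q :: ('a jet, 'e ^ 'k::{finite, linorder}) atlas)).
        canon_Phi K k Q X \<in> jets_over (tangent_atlas Q) k U}"

definition lift_map ::
  "'k::{finite, linorder} itself \<Rightarrow> nat \<Rightarrow> ('a, 'e::real_normed_vector) atlas \<Rightarrow>
   ('a jet \<Rightarrow> 'a \<times> 'a) \<Rightarrow> 'a jet jet \<Rightarrow> 'a jet \<times> 'a jet"
where
  "lift_map K k Q R = jet_split Q Q k \<circ> jet_map (prod_atlas Q Q) k R \<circ> canon_Phi K k Q"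

end

theory Submission
  imports Defs
begin

text \<open>A smooth map from \<open>X\<close> into the jet manifold \<open>T\<^sup>(\<^sup>k\<^sup>) Q\<close> is locally the same thing as a smooth family
  \<open>c : X \<times> \<real> \<rightarrow> Q\<close> of curves, via \<open>x \<mapsto> j\<^sub>0\<^sup>(\<^sup>k\<^sup>) (c (x, \<cdot>))\<close>. In terms of families, \<open>\<Phi>\<^sup>(\<^sup>k\<^sup>)\<close> merely exchanges
  the two parameters of \<open>c (t, s)\<close> (it is well defined because mixed derivatives commute), and the lift
  sends the class of \<open>c\<close> to the \<open>k\<close>-jets of \<open>s \<mapsto> R (velocity of c (\<cdot>, s) at t = 0)\<close>. Openness of the
  domain, smoothness and the value on the zero section follow at once. For the derivative condition
  scale the velocity by \<open>r\<close>: differentiating in \<open>r\<close> and then taking \<open>s\<close>-derivatives reduces it, at each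
  \<open>s\<close>, to the derivative condition for \<open>R\<close>.\<close>


section \<open>Calculus of smooth maps\<close>

text \<open>Two choice operators shape the argument: a jet is accessed only through an arbitrary
  representative (\<open>jet_rep\<close>), and \<open>canon_Phi\<close> picks an arbitrary family.
  Each operation is therefore first shown to commute with forming jets; for example,
  \<open>jet_map_jet\<close> turns \<open>jet_map\<close> into composition of curves. This is
  possible because contact of order \<open>k\<close> survives composition with smooth maps
  (\<open>agree_compose\<close>). That smooth maps into a jet manifold come from families rests on
  an explicit representative: in a chart, the Taylor polynomial with the given derivatives, which
  depends smoothly on the jet. The same polynomials show that the induced charts form a smooth
  atlas. Model spaces are inner product spaces with a finite spanning set, zero dimension included;
  the inner product supplies frame coordinates for the chain rule and scalar tests for the symmetry
  of mixed derivatives.\<close>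

definition finite_dim :: "'x::real_inner itself \<Rightarrow> bool" where
  "finite_dim T \<longleftrightarrow> (\<exists>B::'x set. finite B \<and> span B = UNIV)"

text \<open>Orthogonalise a finite spanning set, drop zero and normalise. The defect
  \<open>y\<close> of the expansion of \<open>x\<close> is orthogonal to every element of
  \<open>D\<close>, hence to the whole space and to itself. Only the expansion formula is exported;
  the set constructed is empty in dimension zero.\<close>

lemma finite_dim_frame:
  assumes "finite_dim TYPE('x::real_inner)"
  obtains B :: "'x::real_inner set" where "finite B" "\<And>x. x = (\<Sum>b\<in>B. (x \<bullet> b) *\<^sub>R b)"
proof -
  obtain B0 :: "'x set" where B0: "finite B0" "span B0 = UNIV"
    using assms unfolding finite_dim_def by blast
  obtain C where C: "finite C" "span C = span B0" "pairwise orthogonal C"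
    using basis_orthogonal[OF B0(1)] by blast
  define n where "n b = (1 / norm b) *\<^sub>R b" for b :: 'x
  define D where "D = C - {0}"
  have D: "finite D" "span D = UNIV" "pairwise orthogonal D"
    using C B0 by (auto simp: D_def pairwise_def span_delete_0)
  have inj: "inj_on n D"
  proof (rule inj_onI, rule ccontr)
    fix a b assume ab: "a \<in> D" "b \<in> D" "n a = n b" "a \<noteq> b"
    then have "a \<bullet> b = 0" using D(3) by (auto simp: pairwise_def orthogonal_def)
    then have "n a \<bullet> n b = 0" by (simp add: n_def)
    then have "n a = 0" using ab by simp
    then show False using ab by (auto simp: n_def D_def)
  qed
  have rep: "x = (\<Sum>b\<in>D. (x \<bullet> n b) *\<^sub>R n b)" for x
  proof -
    define y where "y = x - (\<Sum>b\<in>D. (x \<bullet> n b) *\<^sub>R n b)"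
    have "y \<bullet> a = 0" if a: "a \<in> D" for a
    proof -
      have "(\<Sum>b\<in>D. (x \<bullet> n b) * (n b \<bullet> a)) = (\<Sum>b\<in>D. if b = a then x \<bullet> a else 0)"
      proof (rule sum.cong[OF refl])
        fix b assume b: "b \<in> D"
        show "(x \<bullet> n b) * (n b \<bullet> a) = (if b = a then x \<bullet> a else 0)"
        proof (cases "b = a")
          case True
          have "a \<bullet> a \<noteq> 0" using a by (simp add: D_def)
          then show ?thesis using True
            by (simp add: n_def field_simps dot_square_norm power2_eq_square)
        next
          case False
          then have "b \<bullet> a = 0" using D(3) a b by (auto simp: pairwise_def orthogonal_def)
          then show ?thesis using False by (simp add: n_def)
        qed
      qed
      then show ?thesis
        using a D(1) by (simp add: y_def inner_diff_left inner_sum_left)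
    qed
    then have "orthogonal y a" if "a \<in> D" for a using that by (simp add: orthogonal_def)
    then have "orthogonal y y"
      using orthogonal_to_span[of y D y] D(2) by auto
    then show ?thesis by (simp add: y_def orthogonal_def)
  qed
  show thesis
  proof (rule that[of "n ` D"])
    show "finite (n ` D)" using D by simp
    fix x show "x = (\<Sum>b\<in>n ` D. (x \<bullet> b) *\<^sub>R b)"
      using rep[of x] by (subst sum.reindex[OF inj]) simp
  qed
qed

lemma finite_dim_real: "finite_dim TYPE(real)"
proof -
  have "span {1::real} = UNIV" by (simp add: span_singleton)
  then show ?thesis unfolding finite_dim_def by (intro exI[of _ "{1}"]) simp
qed

lemma finite_dim_prod:
  assumes "finite_dim TYPE('x::real_inner)" "finite_dim TYPE('y::real_inner)"
  shows "finite_dim TYPE('x::real_inner \<times> 'y::real_inner)"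
proof -
  obtain B :: "'x set" and C :: "'y set"
    where B: "finite B" "span B = UNIV" and C: "finite C" "span C = UNIV"
    using assms unfolding finite_dim_def by blast
  let ?l = "\<lambda>x::'x. (x, 0::'y)" and ?r = "\<lambda>y::'y. (0::'x, y)"
  have l: "linear ?l" and r: "linear ?r" by (auto intro!: linearI)
  have "(x, y) \<in> span (?l ` B \<union> ?r ` C)" for x y
  proof -
    have "?l x \<in> span (?l ` B)" "?r y \<in> span (?r ` C)"
      using linear_span_image[OF l, of B] linear_span_image[OF r, of C] B C by auto
    then have "?l x \<in> span (?l ` B \<union> ?r ` C)" "?r y \<in> span (?l ` B \<union> ?r ` C)"
      using span_mono[of "?l ` B" "?l ` B \<union> ?r ` C"] span_mono[of "?r ` C" "?l ` B \<union> ?r ` C"] by auto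
    from span_add[OF this] show ?thesis by simp
  qed
  then show ?thesis unfolding finite_dim_def using B C
    by (intro exI[of _ "?l ` B \<union> ?r ` C"]) auto
qed

lemma linear_axis: "linear (axis i :: 'x::real_normed_vector \<Rightarrow> 'x ^ 'n)"
  by (rule linearI) (auto simp: vec_eq_iff axis_def)

lemma vec_eq_sum_axis: "(v :: 'x::real_normed_vector ^ 'n) = (\<Sum>i\<in>UNIV. axis i (v $ i))"
  by (simp add: vec_eq_iff axis_def if_distrib cong: if_cong)

lemma bounded_linear_axis: "bounded_linear (axis i :: 'x::real_normed_vector \<Rightarrow> 'x ^ 'n)"
proof (rule bounded_linear_intro[where K = 1])
  fix x :: 'x
  have "norm (axis i x :: 'x ^ 'n) \<le> (\<Sum>j\<in>UNIV. norm ((axis i x :: 'x ^ 'n) $ j))"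
    unfolding norm_vec_def by (rule L2_set_le_sum) simp
  also have "\<dots> = norm x" by (simp add: axis_def if_distrib cong: if_cong)
  finally show "norm (axis i x :: 'x ^ 'n) \<le> norm x * 1" by simp
qed (simp_all add: linear_axis linear_add linear_scale)

lemma finite_dim_vec:
  assumes "finite_dim TYPE('x::real_inner)"
  shows "finite_dim TYPE('x::real_inner ^ 'n)"
proof -
  obtain B :: "'x set" where B: "finite B" "span B = UNIV"
    using assms unfolding finite_dim_def by blast
  let ?C = "\<Union>i::'n. axis i ` B"
  have "v \<in> span ?C" for v :: "'x ^ 'n"
  proof -
    have "axis i (v $ i) \<in> span ?C" for i
    proof -
      have "axis i (v $ i) \<in> span (axis i ` B)"
        using linear_span_image[OF linear_axis, of i B] B by auto
      then show ?thesis using span_mono[of "axis i ` B" ?C] by auto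
    qed
    then have "(\<Sum>i\<in>UNIV. axis i (v $ i)) \<in> span ?C" by (intro span_sum) auto
    then show ?thesis by (simp flip: vec_eq_sum_axis)
  qed
  then show ?thesis unfolding finite_dim_def using B by (intro exI[of _ ?C]) auto
qed

section \<open>Closure properties of \<open>Ck_on\<close>\<close>

lemma Ck_on_cong:
  assumes "open S" "\<And>x. x \<in> S \<Longrightarrow> f x = g x" "Ck_on n S f"
  shows "Ck_on n S g"
  using assms(2,3)
proof (induction n arbitrary: f g)
  case 0
  then show ?case by (metis Ck_on.simps(1) continuous_on_cong)
next
  case (Suc n)
  have d: "f differentiable at x" if "x \<in> S" for x using Suc that by simp
  have h: "(g has_derivative frechet_derivative f (at x)) (at x)" if "x \<in> S" for x
    using has_derivative_transform_within_open[OF d[OF that, unfolded frechet_derivative_works] assms(1) that]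
      Suc.prems(1) by auto
  have "Ck_on n S (\<lambda>x. frechet_derivative g (at x) v)" for v
  proof (rule Suc.IH[of "\<lambda>x. frechet_derivative f (at x) v"])
    show "Ck_on n S (\<lambda>x. frechet_derivative f (at x) v)" using Suc.prems by simp
    fix x assume "x \<in> S"
    then show "frechet_derivative f (at x) v = frechet_derivative g (at x) v"
      using frechet_derivative_at[OF h] by simp
  qed
  then show ?case using h by (auto simp: differentiable_def)
qed

text \<open>Uniqueness of derivatives allows any explicit formula \<open>f'\<close> in place of the
  operator \<open>frechet_derivative\<close>; openness of \<open>S\<close> carries the replacement
  on to the higher orders. The inductions below supply \<open>f'\<close> by a differentiation
  rule.\<close>

lemma Ck_on_SucI:
  assumes "open S" "\<And>x. x \<in> S \<Longrightarrow> (f has_derivative f' x) (at x)" "\<And>v. Ck_on n S (\<lambda>x. f' x v)"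
  shows "Ck_on (Suc n) S f"
proof -
  have "Ck_on n S (\<lambda>x. frechet_derivative f (at x) v)" for v
    by (rule Ck_on_cong[OF assms(1) _ assms(3)[of v]])
       (use frechet_derivative_at[OF assms(2)] in auto)
  then show ?thesis using assms(2) by (auto simp: differentiable_def)
qed

lemma Ck_on_SucD:
  assumes "Ck_on (Suc n) S f"
  shows "x \<in> S \<Longrightarrow> (f has_derivative frechet_derivative f (at x)) (at x)"
    "Ck_on n S (\<lambda>x. frechet_derivative f (at x) v)"
  using assms frechet_derivative_works by auto

lemma Ck_on_Suc_imp: "Ck_on (Suc n) S f \<Longrightarrow> Ck_on n S f"
proof (induction n arbitrary: f)
  case 0
  then show ?case
    by (auto intro!: continuous_at_imp_continuous_on differentiable_imp_continuous_within)
next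
  case (Suc n)
  then show ?case by auto
qed

lemma Ck_on_subset: "Ck_on n S f \<Longrightarrow> T \<subseteq> S \<Longrightarrow> Ck_on n T f"
  by (induction n arbitrary: f) (auto intro: continuous_on_subset)

lemma Ck_on_local:
  assumes "\<And>x. x \<in> S \<Longrightarrow> \<exists>W. open W \<and> x \<in> W \<and> Ck_on n W f"
  shows "Ck_on n S f"
  using assms
proof (induction n arbitrary: f)
  case 0
  show ?case unfolding Ck_on.simps
  proof (intro continuous_at_imp_continuous_on ballI)
    fix x assume "x \<in> S"
    then obtain W where "open W" "x \<in> W" "continuous_on W f" using 0 by auto
    then show "isCont f x" by (simp add: continuous_on_eq_continuous_at)
  qed
next
  case (Suc n)
  have "f differentiable at x" if "x \<in> S" for x
    using Suc.prems[OF that] by auto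
  moreover have "Ck_on n S (\<lambda>x. frechet_derivative f (at x) v)" for v
    by (rule Suc.IH) (use Suc.prems in fastforce)
  ultimately show ?case by simp
qed

lemma Ck_on_const: "open S \<Longrightarrow> Ck_on n S (\<lambda>x. c)"
proof (induction n arbitrary: c)
  case (Suc n)
  show ?case by (rule Ck_on_SucI[OF Suc.prems, where f' = "\<lambda>_ _. 0"]) (auto intro: Suc)
qed simp

lemma Ck_on_linear:
  assumes "open S" "bounded_linear L"
  shows "Ck_on n S L"
proof (cases n)
  case 0
  then show ?thesis using assms(2) by (simp add: linear_continuous_on)
next
  case (Suc m)
  show ?thesis unfolding Suc
    by (rule Ck_on_SucI[OF assms(1), where f' = "\<lambda>_. L"])
       (auto intro: bounded_linear_imp_has_derivative assms Ck_on_const)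
qed

lemma Ck_on_linear_comp:
  assumes "open S" "bounded_linear L" "Ck_on n S f"
  shows "Ck_on n S (\<lambda>x. L (f x))"
  using assms(3)
proof (induction n arbitrary: f)
  case 0
  then show ?case using bounded_linear.continuous_on[OF assms(2)] by simp
next
  case (Suc n)
  note D = Ck_on_SucD[OF Suc.prems]
  show ?case
    by (rule Ck_on_SucI[OF assms(1), where f' = "\<lambda>x v. L (frechet_derivative f (at x) v)"])
       (auto intro: bounded_linear.has_derivative[OF assms(2)] D Suc.IH)
qed

lemma Ck_on_add:
  assumes "open S" "Ck_on n S f" "Ck_on n S g"
  shows "Ck_on n S (\<lambda>x. f x + g x)"
  using assms(2,3)
proof (induction n arbitrary: f g)
  case 0
  then show ?case by (auto intro: continuous_intros)
next
  case (Suc n)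
  note D = Ck_on_SucD[OF Suc.prems(1)] Ck_on_SucD[OF Suc.prems(2)]
  show ?case
    by (rule Ck_on_SucI[OF assms(1),
          where f' = "\<lambda>x v. frechet_derivative f (at x) v + frechet_derivative g (at x) v"])
       (auto intro: has_derivative_add D Suc.IH)
qed

lemma Ck_on_sum:
  assumes "open S" "finite I" "\<And>i. i \<in> I \<Longrightarrow> Ck_on n S (f i)"
  shows "Ck_on n S (\<lambda>x. \<Sum>i\<in>I. f i x)"
  using assms(2,3)
  by (induction I) (auto intro: Ck_on_const Ck_on_add assms(1))

lemma Ck_on_scaleR:
  fixes f :: "'x::real_normed_vector \<Rightarrow> real"
  assumes "open S" "Ck_on n S f" "Ck_on n S g"
  shows "Ck_on n S (\<lambda>x. f x *\<^sub>R g x)"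
  using assms(2,3)
proof (induction n arbitrary: f g)
  case 0
  then show ?case by (auto intro: continuous_intros)
next
  case (Suc n)
  note D = Ck_on_SucD[OF Suc.prems(1)] Ck_on_SucD[OF Suc.prems(2)] Suc.prems[THEN Ck_on_Suc_imp]
  show ?case
    by (rule Ck_on_SucI[OF assms(1), where
          f' = "\<lambda>x v. f x *\<^sub>R frechet_derivative g (at x) v + frechet_derivative f (at x) v *\<^sub>R g x"])
       (auto intro!: has_derivative_scaleR Ck_on_add D Suc.IH assms(1))
qed

text \<open>Finite dimension enters here: the derivative of the composition is
  \<open>Df(g x)(Dg(x) v)\<close>, and expanding \<open>Dg(x) v\<close> in a frame reduces it to directional derivatives of
  \<open>f\<close> in fixed directions.\<close>

lemma Ck_on_compose:
  fixes f :: "'y::real_inner \<Rightarrow> 'z::real_normed_vector"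
  assumes fin: "finite_dim TYPE('y)" and S: "open S" and "Ck_on n T f" "Ck_on n S g" "g ` S \<subseteq> T"
  shows "Ck_on n S (\<lambda>x. f (g x))"
  using assms(3-)
proof (induction n arbitrary: f)
  case 0
  then show ?case by (auto intro: continuous_on_compose2)
next
  case (Suc n)
  obtain B :: "'y set" where B: "finite B" "\<And>x. x = (\<Sum>b\<in>B. (x \<bullet> b) *\<^sub>R b)"
    using finite_dim_frame[OF fin] by blast
  note F = Ck_on_SucD[OF Suc.prems(1)] and G = Ck_on_SucD[OF Suc.prems(2)]
  let ?f' = "\<lambda>y. frechet_derivative f (at y)" and ?g' = "\<lambda>x. frechet_derivative g (at x)"
  show ?case
  proof (rule Ck_on_SucI[OF S, where f' = "\<lambda>x v. \<Sum>b\<in>B. (?g' x v \<bullet> b) *\<^sub>R ?f' (g x) b"])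
    fix x assume x: "x \<in> S"
    then have gx: "g x \<in> T" using Suc.prems by auto
    have lin: "linear (?f' (g x))" using F(1)[OF gx] by (rule has_derivative_linear)
    have eq: "?f' (g x) w = (\<Sum>b\<in>B. (w \<bullet> b) *\<^sub>R ?f' (g x) b)" for w
      using arg_cong[OF B(2), of "?f' (g x)" w] unfolding linear_sum[OF lin] linear_scale[OF lin] .
    have "(\<lambda>v. \<Sum>b\<in>B. (?g' x v \<bullet> b) *\<^sub>R ?f' (g x) b) = (\<lambda>v. ?f' (g x) (?g' x v))"
      by (intro ext eq[symmetric])
    then show "((\<lambda>x. f (g x)) has_derivative (\<lambda>v. \<Sum>b\<in>B. (?g' x v \<bullet> b) *\<^sub>R ?f' (g x) b)) (at x)"
      using has_derivative_compose[OF G(1)[OF x] F(1)[OF gx]] by simp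
  next
    fix v
    have "Ck_on n S g" using Suc.prems(2) by (rule Ck_on_Suc_imp)
    then have "Ck_on n S (\<lambda>x. ?f' (g x) b)" for b by (intro Suc.IH F Suc.prems)
    then show "Ck_on n S (\<lambda>x. \<Sum>b\<in>B. (?g' x v \<bullet> b) *\<^sub>R ?f' (g x) b)"
      by (intro Ck_on_sum Ck_on_scaleR S B Ck_on_linear_comp[OF S bounded_linear_inner_left] G)
  qed
qed

text \<open>Smoothness of a germ. Hiding the neighbourhood removes the bookkeeping of domains:
  conditions are combined with \<open>eventually\<close> on \<open>nhds x\<close> instead of by
  intersecting open sets.\<close>

definition smooth_at :: "'x::real_normed_vector \<Rightarrow> ('x \<Rightarrow> 'y::real_normed_vector) \<Rightarrow> bool" where
  "smooth_at x f \<longleftrightarrow> (\<exists>W. open W \<and> x \<in> W \<and> smooth_on W f)"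

lemma smooth_on_imp_smooth_at: "smooth_on S f \<Longrightarrow> open S \<Longrightarrow> x \<in> S \<Longrightarrow> smooth_at x f"
  unfolding smooth_at_def by blast

lemma smooth_onI_smooth_at: "(\<And>x. x \<in> S \<Longrightarrow> smooth_at x f) \<Longrightarrow> smooth_on S f"
  unfolding smooth_at_def smooth_on_def by (meson Ck_on_local)

lemma smooth_at_eventually: "smooth_at x f \<Longrightarrow> \<forall>\<^sub>F y in nhds x. smooth_at y f"
  unfolding smooth_at_def eventually_nhds by blast

lemma smooth_at_cong:
  assumes "smooth_at x f" "\<forall>\<^sub>F y in nhds x. f y = g y"
  shows "smooth_at x g"
proof -
  obtain W V where "open W" "x \<in> W" "smooth_on W f" "open V" "x \<in> V" "\<And>y. y \<in> V \<Longrightarrow> f y = g y"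
    using assms unfolding smooth_at_def eventually_nhds by blast
  then have "smooth_on (W \<inter> V) g"
    unfolding smooth_on_def by (auto intro!: Ck_on_cong[of "W \<inter> V" f g] intro: Ck_on_subset)
  then show ?thesis unfolding smooth_at_def using \<open>open W\<close> \<open>x \<in> W\<close> \<open>open V\<close> \<open>x \<in> V\<close>
    by (intro exI[of _ "W \<inter> V"]) auto
qed

lemma smooth_at_linear: "bounded_linear L \<Longrightarrow> smooth_at x L"
  unfolding smooth_at_def smooth_on_def by (auto intro!: exI[of _ UNIV] Ck_on_linear)

lemma smooth_at_const [simp]: "smooth_at x (\<lambda>x. c)"
  unfolding smooth_at_def smooth_on_def by (auto intro!: exI[of _ UNIV] Ck_on_const)

lemma smooth_at_ident [simp]: "smooth_at x (\<lambda>x. x)"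
  by (intro smooth_at_linear bounded_linear_ident)

lemma smooth_at_linear_comp:
  assumes "bounded_linear L" "smooth_at x f"
  shows "smooth_at x (\<lambda>x. L (f x))"
  using assms unfolding smooth_at_def smooth_on_def by (blast intro: Ck_on_linear_comp)

lemma smooth_at_inter:
  assumes "smooth_at x f" "smooth_at x g"
  obtains W where "open W" "x \<in> W" "smooth_on W f" "smooth_on W g"
proof -
  obtain W V where "open W" "x \<in> W" "smooth_on W f" "open V" "x \<in> V" "smooth_on V g"
    using assms unfolding smooth_at_def by blast
  then show ?thesis
    by (intro that[of "W \<inter> V"]) (auto simp: smooth_on_def intro: Ck_on_subset)
qed

lemma smooth_at_add:
  assumes "smooth_at x f" "smooth_at x g"
  shows "smooth_at x (\<lambda>x. f x + g x)"
proof -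
  obtain W where "open W" "x \<in> W" "smooth_on W f" "smooth_on W g"
    using smooth_at_inter[OF assms] .
  then show ?thesis unfolding smooth_at_def smooth_on_def by (auto intro!: exI[of _ W] Ck_on_add)
qed

lemma smooth_at_scaleR:
  fixes f :: "'x::real_normed_vector \<Rightarrow> real"
  assumes "smooth_at x f" "smooth_at x g"
  shows "smooth_at x (\<lambda>x. f x *\<^sub>R g x)"
proof -
  obtain W where "open W" "x \<in> W" "smooth_on W f" "smooth_on W g"
    using smooth_at_inter[OF assms] .
  then show ?thesis unfolding smooth_at_def smooth_on_def by (auto intro!: exI[of _ W] Ck_on_scaleR)
qed

lemma smooth_at_diff:
  assumes "smooth_at x f" "smooth_at x g"
  shows "smooth_at x (\<lambda>x. f x - g x)"
  using smooth_at_add[OF assms(1) smooth_at_linear_comp[OF bounded_linear_minus[OF bounded_linear_ident] assms(2)]]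
  by simp

lemma smooth_at_sum:
  assumes "\<And>i. i \<in> I \<Longrightarrow> smooth_at x (f i)"
  shows "smooth_at x (\<lambda>x. \<Sum>i\<in>I. f i x)"
  using assms by (induction I rule: infinite_finite_induct) (auto intro: smooth_at_add)

lemma smooth_at_power:
  fixes f :: "'x::real_normed_vector \<Rightarrow> real"
  assumes "smooth_at x f"
  shows "smooth_at x (\<lambda>x. f x ^ n)"
proof (induction n)
  case (Suc n)
  from smooth_at_scaleR[OF assms Suc] show ?case by simp
qed simp

lemma smooth_at_fst: "smooth_at x f \<Longrightarrow> smooth_at x (\<lambda>x. fst (f x))"
  by (rule smooth_at_linear_comp[OF bounded_linear_fst])

lemma smooth_at_snd: "smooth_at x f \<Longrightarrow> smooth_at x (\<lambda>x. snd (f x))"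
  by (rule smooth_at_linear_comp[OF bounded_linear_snd])

lemma smooth_at_Pair:
  assumes "smooth_at x f" "smooth_at x g"
  shows "smooth_at x (\<lambda>x. (f x, g x))"
proof -
  have "bounded_linear (\<lambda>y. (y, 0))" "bounded_linear (\<lambda>y. (0, y))"
    by (auto intro!: bounded_linear_Pair bounded_linear_ident bounded_linear_zero)
  from smooth_at_add[OF this[THEN smooth_at_linear_comp] , OF assms] show ?thesis by simp
qed

lemma smooth_at_vec_nth: "smooth_at x f \<Longrightarrow> smooth_at x (\<lambda>x. f x $ i)"
  by (rule smooth_at_linear_comp[OF bounded_linear_vec_nth])

lemma smooth_at_vec_lambda:
  assumes "\<And>i. smooth_at x (\<lambda>x. f x $ i)"
  shows "smooth_at x f"
proof -
  have "smooth_at x (\<lambda>x. \<Sum>i\<in>UNIV. axis i (f x $ i))"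
    by (intro smooth_at_sum smooth_at_linear_comp[OF bounded_linear_axis] assms)
  then show ?thesis by (simp flip: vec_eq_sum_axis)
qed

lemma smooth_at_has_derivative:
  "smooth_at x f \<Longrightarrow> (f has_derivative frechet_derivative f (at x)) (at x)"
  unfolding smooth_at_def smooth_on_def using Ck_on_SucD(1) by blast

lemma smooth_at_isCont: "smooth_at x f \<Longrightarrow> isCont f x"
  by (rule has_derivative_continuous[OF smooth_at_has_derivative])

lemma smooth_at_tendsto: "smooth_at x f \<Longrightarrow> filterlim f (nhds (f x)) (nhds x)"
  using smooth_at_isCont[of x f] by (simp add: continuous_at tendsto_at_iff_tendsto_nhds)

lemma smooth_at_eventually_comp:
  "smooth_at x g \<Longrightarrow> eventually P (nhds (g x)) \<Longrightarrow> \<forall>\<^sub>F y in nhds x. P (g y)"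
  using smooth_at_tendsto[of x g] by (auto simp: filterlim_iff)

lemma smooth_at_frechet_derivative:
  "smooth_at x f \<Longrightarrow> smooth_at x (\<lambda>x. frechet_derivative f (at x) v)"
  unfolding smooth_at_def smooth_on_def using Ck_on_SucD(2) by blast

lemma smooth_at_compose:
  fixes f :: "'y::real_inner \<Rightarrow> 'z::real_normed_vector"
  assumes "finite_dim TYPE('y)" "smooth_at (g x) f" "smooth_at x g"
  shows "smooth_at x (\<lambda>x. f (g x))"
proof -
  obtain T where T: "open T" "g x \<in> T" "smooth_on T f" using assms(2) smooth_at_def by blast
  obtain W where W: "open W" "x \<in> W" "smooth_on W g" using assms(3) smooth_at_def by blast
  have "\<forall>\<^sub>F y in nhds x. g y \<in> T"
    by (rule smooth_at_eventually_comp[OF assms(3)])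
       (use T in \<open>simp add: eventually_nhds_in_open\<close>)
  then obtain V where V: "open V" "x \<in> V" "\<And>y. y \<in> V \<Longrightarrow> g y \<in> T"
    unfolding eventually_nhds by blast
  have "smooth_on (W \<inter> V) (\<lambda>x. f (g x))"
    unfolding smooth_on_def
  proof
    fix n
    have "Ck_on n T f" "Ck_on n (W \<inter> V) g"
      using T(3) W(3) by (auto simp: smooth_on_def intro: Ck_on_subset[of n W])
    then show "Ck_on n (W \<inter> V) (\<lambda>x. f (g x))"
      using W V by (auto intro!: Ck_on_compose[OF assms(1), of "W \<inter> V" n T f g])
  qed
  then show ?thesis unfolding smooth_at_def using W V by (intro exI[of _ "W \<inter> V"]) auto
qed

section \<open>Iterated derivatives of curves\<close>

lemma nth_vderiv_0 [simp]: "nth_vderiv 0 f = f"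
  by (simp add: nth_vderiv_def)

lemma nth_vderiv_Suc: "nth_vderiv (Suc i) f t = vector_derivative (nth_vderiv i f) (at t)"
  by (simp add: nth_vderiv_def)

text \<open>\<open>nth_vderiv_Suc\<close> takes the extra derivative last; here it is taken first.
  The inductions on contact order use this second form, since they replace a curve by its
  velocity.\<close>

lemma nth_vderiv_Suc_inner:
  "nth_vderiv (Suc i) f = nth_vderiv i (\<lambda>t. vector_derivative f (at t))"
  by (simp add: nth_vderiv_def funpow_Suc_right del: funpow.simps)

lemma vector_derivative_eventually_cong:
  assumes "\<forall>\<^sub>F s in nhds t. f s = g s"
  shows "vector_derivative f (at t) = vector_derivative g (at t)"
  using assms by (intro vector_derivative_cong_eq) auto

text \<open>Equality at the single point \<open>t\<close> would not survive differentiation, so the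
  induction carries equality on a neighbourhood; \<open>eventually_eventually\<close> supplies it
  around each nearby point.\<close>

lemma eventually_nth_vderiv_cong:
  assumes "\<forall>\<^sub>F s in nhds t. f s = g s"
  shows "\<forall>\<^sub>F s in nhds t. nth_vderiv i f s = nth_vderiv i g s"
proof (induction i)
  case (Suc i)
  then have "\<forall>\<^sub>F s in nhds t. \<forall>\<^sub>F r in nhds s. nth_vderiv i f r = nth_vderiv i g r"
    by (simp add: eventually_eventually)
  then show ?case
    by eventually_elim (simp add: nth_vderiv_Suc vector_derivative_eventually_cong)
qed (simp add: assms)

lemma nth_vderiv_cong:
  "\<forall>\<^sub>F s in nhds t. f s = g s \<Longrightarrow> nth_vderiv i f t = nth_vderiv i g t"
  using eventually_nth_vderiv_cong eventually_nhds_x_imp_x by fast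

lemma eventually_nhds_PairD:
  assumes "eventually P (nhds (x, s))"
  shows "\<forall>\<^sub>F y in nhds x. \<forall>\<^sub>F r in nhds s. P (y, r)" "\<forall>\<^sub>F r in nhds s. P (x, r)"
proof -
  obtain A B where AB: "eventually A (nhds x)" "eventually B (nhds s)" "\<And>y r. A y \<Longrightarrow> B r \<Longrightarrow> P (y, r)"
    using assms unfolding nhds_prod eventually_prod_filter by blast
  show "\<forall>\<^sub>F y in nhds x. \<forall>\<^sub>F r in nhds s. P (y, r)"
    using AB(1) by eventually_elim (use AB in \<open>auto elim: eventually_mono\<close>)
  then show "\<forall>\<^sub>F r in nhds s. P (x, r)" by (rule eventually_nhds_x_imp_x)
qed

lemma has_derivative_imp_directional:
  assumes "(H has_derivative H') (at (c t))" "(c has_vector_derivative c') (at t)"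
  shows "((\<lambda>t. H (c t)) has_vector_derivative H' c') (at t)"
proof -
  have "H' (x *\<^sub>R c') = x *\<^sub>R H' c'" for x
    using has_derivative_linear[OF assms(1)] by (rule linear_scale)
  then show ?thesis
    using has_derivative_compose[OF assms(2)[unfolded has_vector_derivative_def] assms(1)]
    by (simp add: has_vector_derivative_def)
qed

lemma smooth_at_directional:
  assumes "smooth_at (c t) H" "(c has_vector_derivative c') (at t)"
  shows "((\<lambda>t. H (c t)) has_vector_derivative frechet_derivative H (at (c t)) c') (at t)"
  by (rule has_derivative_imp_directional[OF smooth_at_has_derivative[OF assms(1)] assms(2)])

lemma smooth_at_vderiv_eq:
  "smooth_at t f \<Longrightarrow> vector_derivative f (at t) = frechet_derivative f (at t) 1"
  using smooth_at_directional[of "\<lambda>t. t" t f 1] vector_derivative_at by fastforce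

lemma smooth_at_has_vderiv:
  "smooth_at t f \<Longrightarrow> (f has_vector_derivative vector_derivative f (at t)) (at t)"
  using smooth_at_directional[of "\<lambda>t. t" t f 1] vector_derivative_at by fastforce

lemma smooth_at_vderiv:
  assumes "smooth_at t f"
  shows "smooth_at t (\<lambda>t. vector_derivative f (at t))"
proof (rule smooth_at_cong[OF smooth_at_frechet_derivative[OF assms, of 1]])
  show "\<forall>\<^sub>F s in nhds t. frechet_derivative f (at s) 1 = vector_derivative f (at s)"
    using smooth_at_eventually[OF assms] by eventually_elim (simp add: smooth_at_vderiv_eq)
qed

lemma smooth_at_nth_vderiv: "smooth_at t f \<Longrightarrow> smooth_at t (nth_vderiv i f)"
proof (induction i)
  case (Suc i)
  then show ?case using smooth_at_vderiv[of t "nth_vderiv i f"] by (simp add: nth_vderiv_Suc[abs_def])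
qed simp

section \<open>Partial derivatives of functions of several parameters\<close>

lemma partial_vderiv_snd:
  assumes "smooth_at (x, s) H"
  shows "vector_derivative (\<lambda>s. H (x, s)) (at s) = frechet_derivative H (at (x, s)) (0, 1)"
proof -
  have "((\<lambda>s. (x, s)) has_vector_derivative (0, 1)) (at s)"
    by (auto intro!: derivative_eq_intros)
  from smooth_at_directional[OF _ this, of H] assms show ?thesis
    by (simp add: vector_derivative_at)
qed

lemma partial_vderiv_fst:
  assumes "smooth_at (t, s) H"
  shows "vector_derivative (\<lambda>t. H (t, s)) (at t) = frechet_derivative H (at (t, s)) (1, 0)"
proof -
  have "((\<lambda>t. (t, s)) has_vector_derivative (1, 0)) (at t)"
    by (auto intro!: derivative_eq_intros)
  from smooth_at_directional[OF _ this, of H] assms show ?thesis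
    by (simp add: vector_derivative_at)
qed

text \<open>The \<open>i\<close>-th derivative in the second variable is kept as a function on the
  whole product. Its next derivative is then a directional derivative in direction
  \<open>(0, 1)\<close>, and these preserve smoothness.\<close>

lemma smooth_at_partial_nth:
  assumes "smooth_at p H"
  shows "smooth_at p (\<lambda>q. nth_vderiv i (\<lambda>s. H (fst q, s)) (snd q))"
proof (induction i)
  case (Suc i)
  let ?K = "\<lambda>q. nth_vderiv i (\<lambda>s. H (fst q, s)) (snd q)"
  have "\<forall>\<^sub>F q in nhds p. frechet_derivative ?K (at q) (0, 1)
          = nth_vderiv (Suc i) (\<lambda>s. H (fst q, s)) (snd q)"
    using smooth_at_eventually[OF Suc]
  proof eventually_elim
    case (elim q)
    then show ?case using partial_vderiv_snd[of "fst q" "snd q" ?K] by (simp add: nth_vderiv_Suc)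
  qed
  then show ?case
    by (rule smooth_at_cong[OF smooth_at_frechet_derivative[OF Suc]])
qed (simp add: assms)

lemma smooth_at_param_nth:
  assumes "finite_dim TYPE('x::real_inner)" "smooth_at (x, s) H"
  shows "smooth_at (x::'x) (\<lambda>x. nth_vderiv i (\<lambda>s. H (x, s)) s)"
  using smooth_at_compose[OF finite_dim_prod[OF assms(1) finite_dim_real] smooth_at_partial_nth,
      of "\<lambda>x. (x, s)" x H] assms(2)
  by (simp add: smooth_at_Pair)

lemma nth_vderiv_linear_comp:
  assumes "bounded_linear L" "smooth_at t f"
  shows "nth_vderiv i (\<lambda>t. L (f t)) t = L (nth_vderiv i f t)"
proof -
  have "\<forall>\<^sub>F s in nhds t. nth_vderiv i (\<lambda>t. L (f t)) s = L (nth_vderiv i f s)"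
  proof (induction i)
    case (Suc i)
    have "\<forall>\<^sub>F s in nhds t. \<forall>\<^sub>F r in nhds s. nth_vderiv i (\<lambda>t. L (f t)) r = L (nth_vderiv i f r)"
      using Suc by (simp add: eventually_eventually)
    moreover have "\<forall>\<^sub>F s in nhds t. smooth_at s (nth_vderiv i f)"
      by (intro smooth_at_eventually smooth_at_nth_vderiv assms)
    ultimately show ?case
    proof eventually_elim
      case (elim s)
      show ?case
        unfolding nth_vderiv_Suc vector_derivative_eventually_cong[OF elim(1)]
        by (intro vector_derivative_at bounded_linear.has_vector_derivative[OF assms(1)]
            smooth_at_has_vderiv elim)
    qed
  qed simp
  then show ?thesis by (rule eventually_nhds_x_imp_x)
qed

lemma nth_vderiv_diff:
  fixes f g :: "real \<Rightarrow> 'y::real_normed_vector"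
  assumes "smooth_at t f" "smooth_at t g"
  shows "nth_vderiv i (\<lambda>t. f t - g t) t = nth_vderiv i f t - nth_vderiv i g t"
proof -
  have sm: "smooth_at t (\<lambda>t. (f t, g t))" by (intro smooth_at_Pair assms)
  have "bounded_linear (\<lambda>p :: 'y \<times> 'y. fst p - snd p)"
    by (intro bounded_linear_sub bounded_linear_fst bounded_linear_snd)
  from nth_vderiv_linear_comp[OF this sm] nth_vderiv_linear_comp[OF bounded_linear_fst sm]
    nth_vderiv_linear_comp[OF bounded_linear_snd sm]
  show ?thesis by simp
qed

text \<open>The mean value theorem applied twice turns the second difference of \<open>u\<close> over a small
  parallelogram into a value of either mixed derivative.\<close>

lemma second_difference:
  fixes u :: "'x::real_normed_vector \<Rightarrow> real"
  assumes "h > 0" and B: "\<And>q. dist p q < e \<Longrightarrow> smooth_at q u" "h * (norm a + norm b) < e"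
  shows "\<exists>q. dist p q \<le> h * (norm a + norm b) \<and>
     u (p + h *\<^sub>R a + h *\<^sub>R b) - u (p + h *\<^sub>R a) - u (p + h *\<^sub>R b) + u p =
     h\<^sup>2 * frechet_derivative (\<lambda>q. frechet_derivative u (at q) a) (at q) b"
proof -
  let ?Da = "\<lambda>q. frechet_derivative u (at q) a"
  have near: "dist p (p + r *\<^sub>R a + r' *\<^sub>R b) \<le> h * (norm a + norm b)"
    if "0 \<le> r" "r \<le> h" "0 \<le> r'" "r' \<le> h" for r r'
  proof -
    have "dist p (p + r *\<^sub>R a + r' *\<^sub>R b) = norm (r *\<^sub>R a + r' *\<^sub>R b)"
      by (subst dist_commute) (simp add: dist_norm algebra_simps)
    also have "\<dots> \<le> r * norm a + r' * norm b"
      using norm_triangle_ineq[of "r *\<^sub>R a" "r' *\<^sub>R b"] that by simp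
    also have "\<dots> \<le> h * norm a + h * norm b"
      by (intro add_mono mult_right_mono that) auto
    finally show ?thesis by (simp add: distrib_left)
  qed
  then have sm: "smooth_at (p + r *\<^sub>R a + r' *\<^sub>R b) u"
    if "0 \<le> r" "r \<le> h" "0 \<le> r'" "r' \<le> h" for r r'
    using that B by (meson le_less_trans)
  have d1: "((\<lambda>r. u (p + r *\<^sub>R a + r' *\<^sub>R b)) has_real_derivative ?Da (p + r *\<^sub>R a + r' *\<^sub>R b)) (at r)"
    if "0 \<le> r" "r \<le> h" "0 \<le> r'" "r' \<le> h" for r r'
    unfolding has_real_derivative_iff_has_vector_derivative
    by (rule smooth_at_directional) (use sm that in \<open>auto intro!: derivative_eq_intros\<close>)
  have "\<exists>r>0. r < h \<and> (\<lambda>r. u (p + r *\<^sub>R a + h *\<^sub>R b) - u (p + r *\<^sub>R a + 0 *\<^sub>R b)) h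
       - (\<lambda>r. u (p + r *\<^sub>R a + h *\<^sub>R b) - u (p + r *\<^sub>R a + 0 *\<^sub>R b)) 0
     = (h - 0) * (?Da (p + r *\<^sub>R a + h *\<^sub>R b) - ?Da (p + r *\<^sub>R a + 0 *\<^sub>R b))"
    by (rule MVT2[OF \<open>h > 0\<close>], rule DERIV_diff; rule d1) (use \<open>h > 0\<close> in auto)
  then obtain r where r: "0 < r" "r < h"
    "u (p + h *\<^sub>R a + h *\<^sub>R b) - u (p + h *\<^sub>R a) - u (p + h *\<^sub>R b) + u p =
     h * (?Da (p + r *\<^sub>R a + h *\<^sub>R b) - ?Da (p + r *\<^sub>R a))" by (auto simp: algebra_simps)
  have "((\<lambda>r'. ?Da (p + r *\<^sub>R a + r' *\<^sub>R b)) has_real_derivative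
      frechet_derivative ?Da (at (p + r *\<^sub>R a + r' *\<^sub>R b)) b) (at r')"
    if "0 \<le> r'" "r' \<le> h" for r'
    unfolding has_real_derivative_iff_has_vector_derivative
    by (rule smooth_at_directional)
       (use sm[of r r'] that r in \<open>auto intro!: derivative_eq_intros smooth_at_frechet_derivative\<close>)
  from MVT2[OF \<open>h > 0\<close> this] obtain r' where r': "0 < r'" "r' < h"
    "?Da (p + r *\<^sub>R a + h *\<^sub>R b) - ?Da (p + r *\<^sub>R a) =
       h * frechet_derivative ?Da (at (p + r *\<^sub>R a + r' *\<^sub>R b)) b" by auto
  show ?thesis
    by (intro exI[of _ "p + r *\<^sub>R a + r' *\<^sub>R b"] conjI near)
       (use r r' in \<open>auto simp: power2_eq_square\<close>)
qed

text \<open>The second difference over the parallelogram spanned by multiples of \<open>a\<close>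
  and \<open>b\<close> is symmetric in \<open>a\<close> and \<open>b\<close>. So the two mixed
  derivatives take a common value at points \<open>q1\<close> and \<open>q2\<close> arbitrarily
  close to \<open>p\<close>, and their continuity at \<open>p\<close> excludes a gap.\<close>

lemma mixed_derivatives_commute_real:
  fixes u :: "'x::real_normed_vector \<Rightarrow> real"
  assumes "smooth_at p u"
  shows "frechet_derivative (\<lambda>q. frechet_derivative u (at q) a) (at p) b
       = frechet_derivative (\<lambda>q. frechet_derivative u (at q) b) (at p) a" (is "?F p = ?G p")
proof (rule ccontr)
  assume ne: "?F p \<noteq> ?G p"
  \<comment> \<open>Half the gap: two deviations below \<open>\<epsilon>\<close> cannot add up to
    it.\<close>
  define \<epsilon> where "\<epsilon> = \<bar>?F p - ?G p\<bar> / 2"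
  have \<epsilon>: "\<epsilon> > 0" using ne by (simp add: \<epsilon>_def)
  have "isCont ?F p" "isCont ?G p"
    by (intro smooth_at_isCont smooth_at_frechet_derivative assms)+
  then obtain d1 d2 where d: "d1 > 0" "\<And>q. dist q p < d1 \<Longrightarrow> dist (?F q) (?F p) < \<epsilon>"
      "d2 > 0" "\<And>q. dist q p < d2 \<Longrightarrow> dist (?G q) (?G p) < \<epsilon>"
    unfolding continuous_at_eps_delta using \<epsilon> by metis
  obtain e where e: "e > 0" "\<And>q. dist q p < e \<Longrightarrow> smooth_at q u"
    using smooth_at_eventually[OF assms] by (auto simp: eventually_nhds_metric)
  define m where "m = Min {d1, d2, e}"
  have m: "m > 0" "m \<le> d1" "m \<le> d2" "m \<le> e" using d e by (auto simp: m_def)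
  \<comment> \<open>The summand \<open>1\<close> keeps the denominator positive when
    \<open>a\<close> and \<open>b\<close> both vanish, and makes the resulting distance bound by
    \<open>m\<close> strict.\<close>
  define h where "h = m / (norm a + norm b + 1)"
  have pos: "norm a + norm b + 1 > 0" by (simp add: add_nonneg_pos)
  have h: "h > 0" using m pos by (simp add: h_def)
  have "h * (norm a + norm b) < h * (norm a + norm b + 1)" using h by simp
  also have "\<dots> = m" using pos by (simp add: h_def)
  finally have hm: "h * (norm a + norm b) < m" .
  have sm: "smooth_at q u" if "dist p q < m" for q
    using e(2)[of q] that m by (simp add: dist_commute)
  obtain q1 where q1: "dist p q1 \<le> h * (norm a + norm b)"
    "u (p + h *\<^sub>R a + h *\<^sub>R b) - u (p + h *\<^sub>R a) - u (p + h *\<^sub>R b) + u p = h\<^sup>2 * ?F q1"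
    using second_difference[OF h sm hm] by blast
  obtain q2 where q2: "dist p q2 \<le> h * (norm b + norm a)"
    "u (p + h *\<^sub>R b + h *\<^sub>R a) - u (p + h *\<^sub>R b) - u (p + h *\<^sub>R a) + u p = h\<^sup>2 * ?G q2"
    using second_difference[OF h sm, where a = b and b = a] hm by (auto simp: add.commute)
  have "h\<^sup>2 * ?F q1 = h\<^sup>2 * ?G q2" using q1(2) q2(2) by (simp add: algebra_simps)
  then have "?F q1 = ?G q2" using h by simp
  moreover have "dist (?F q1) (?F p) < \<epsilon>" "dist (?G q2) (?G p) < \<epsilon>"
    using d(2)[of q1] d(4)[of q2] q1(1) q2(1) hm m by (auto simp: dist_commute add.commute)
  ultimately have "\<bar>?F p - ?G p\<bar> < 2 * \<epsilon>" by (simp add: dist_real_def)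
  then show False by (simp add: \<epsilon>_def)
qed

text \<open>Pairing with a fixed \<open>w\<close> commutes with both differentiations and reduces to
  the real-valued case; a vector is determined by its inner products.\<close>

lemma mixed_derivatives_commute:
  fixes u :: "'x::real_normed_vector \<Rightarrow> 'y::real_inner"
  assumes "smooth_at p u"
  shows "frechet_derivative (\<lambda>q. frechet_derivative u (at q) a) (at p) b
       = frechet_derivative (\<lambda>q. frechet_derivative u (at q) b) (at p) a"
proof -
  have lin: "frechet_derivative (\<lambda>q. f q \<bullet> w) (at q) c = frechet_derivative f (at q) c \<bullet> w"
    if "smooth_at q f" for f :: "'x \<Rightarrow> 'y" and q c w
    using frechet_derivative_at[OF bounded_linear.has_derivative[OF bounded_linear_inner_left[of w]
        smooth_at_has_derivative[OF that]]] by metis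
  have lin2: "frechet_derivative (\<lambda>q. frechet_derivative (\<lambda>q. u q \<bullet> w) (at q) c) (at p) d
     = frechet_derivative (\<lambda>q. frechet_derivative u (at q) c) (at p) d \<bullet> w" for c d w
  proof -
    obtain S where S: "open S" "p \<in> S" "\<And>q. q \<in> S \<Longrightarrow> smooth_at q u"
      using smooth_at_eventually[OF assms] unfolding eventually_nhds by blast
    have "((\<lambda>q. frechet_derivative u (at q) c \<bullet> w) has_derivative
        (\<lambda>d. frechet_derivative (\<lambda>q. frechet_derivative u (at q) c) (at p) d \<bullet> w)) (at p)"
      by (intro bounded_linear.has_derivative[OF bounded_linear_inner_left]
          smooth_at_has_derivative smooth_at_frechet_derivative assms)
    then have "((\<lambda>q. frechet_derivative (\<lambda>q. u q \<bullet> w) (at q) c) has_derivative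
        (\<lambda>d. frechet_derivative (\<lambda>q. frechet_derivative u (at q) c) (at p) d \<bullet> w)) (at p)"
      by (rule has_derivative_transform_within_open[OF _ S(1,2)]) (use S lin in auto)
    from frechet_derivative_at[OF this] show ?thesis by metis
  qed
  have "smooth_at p (\<lambda>q. u q \<bullet> w)" for w
    by (intro smooth_at_linear_comp[OF bounded_linear_inner_left] assms)
  from mixed_derivatives_commute_real[OF this] show ?thesis
    unfolding lin2 using vector_eq_rdot by blast
qed

lemma partial_vderivs_commute:
  fixes u :: "real \<times> real \<Rightarrow> 'y::real_inner"
  assumes "smooth_at (t, s) u"
  shows "vector_derivative (\<lambda>t. vector_derivative (\<lambda>s. u (t, s)) (at s)) (at t)
       = vector_derivative (\<lambda>s. vector_derivative (\<lambda>t. u (t, s)) (at t)) (at s)"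
proof -
  let ?D = "\<lambda>a q. frechet_derivative u (at q) a"
  have "finite_dim TYPE(real \<times> real)" by (intro finite_dim_prod finite_dim_real)
  have ev: "\<forall>\<^sub>F q in nhds (t, s). smooth_at q u" by (rule smooth_at_eventually[OF assms])
  have "\<forall>\<^sub>F t' in nhds t. smooth_at (t', s) u"
    by (rule smooth_at_eventually_comp[where P = "\<lambda>q. smooth_at q u"])
       (use ev in \<open>auto intro!: smooth_at_Pair\<close>)
  then have "\<forall>\<^sub>F t' in nhds t. vector_derivative (\<lambda>s. u (t', s)) (at s) = ?D (0, 1) (t', s)"
    by eventually_elim (rule partial_vderiv_snd)
  from vector_derivative_eventually_cong[OF this]
  have 1: "vector_derivative (\<lambda>t. vector_derivative (\<lambda>s. u (t, s)) (at s)) (at t)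
      = frechet_derivative (?D (0, 1)) (at (t, s)) (1, 0)"
    using partial_vderiv_fst[OF smooth_at_frechet_derivative[OF assms]] by simp
  have "\<forall>\<^sub>F s' in nhds s. vector_derivative (\<lambda>t. u (t, s')) (at t) = ?D (1, 0) (t, s')"
    using eventually_nhds_PairD(2)[OF ev] by eventually_elim (rule partial_vderiv_fst)
  from vector_derivative_eventually_cong[OF this]
  have 2: "vector_derivative (\<lambda>s. vector_derivative (\<lambda>t. u (t, s)) (at t)) (at s)
      = frechet_derivative (?D (1, 0)) (at (t, s)) (0, 1)"
    using partial_vderiv_snd[OF smooth_at_frechet_derivative[OF assms]] by simp
  show ?thesis unfolding 1 2 by (rule mixed_derivatives_commute[OF assms])
qed

text \<open>In the step, commutation of two partial derivatives is applied to \<open>?K\<close>, the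
  \<open>j\<close>-th \<open>s\<close>-derivative as a function on the plane. The induction
  hypothesis is then used at all points near the given \<open>s\<close>, which is why
  \<open>s\<close> is generalised.\<close>

lemma vderiv_nth_vderiv_commute:
  fixes u :: "real \<times> real \<Rightarrow> 'y::real_inner"
  assumes "smooth_at (t, s) u"
  shows "vector_derivative (\<lambda>t. nth_vderiv j (\<lambda>s. u (t, s)) s) (at t)
       = nth_vderiv j (\<lambda>s. vector_derivative (\<lambda>t. u (t, s)) (at t)) s"
  using assms
proof (induction j arbitrary: s)
  case (Suc j)
  let ?K = "\<lambda>q. nth_vderiv j (\<lambda>s. u (fst q, s)) (snd q)"
  have "smooth_at (t, s) ?K" by (rule smooth_at_partial_nth[OF Suc.prems])
  from partial_vderivs_commute[OF this]
  have "vector_derivative (\<lambda>t. nth_vderiv (Suc j) (\<lambda>s. u (t, s)) s) (at t) =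
    vector_derivative (\<lambda>s. vector_derivative (\<lambda>t. nth_vderiv j (\<lambda>s. u (t, s)) s) (at t)) (at s)"
    by (simp add: nth_vderiv_Suc)
  also have "\<dots> = vector_derivative (nth_vderiv j (\<lambda>s. vector_derivative (\<lambda>t. u (t, s)) (at t))) (at s)"
  proof (rule vector_derivative_eventually_cong)
    show "\<forall>\<^sub>F s in nhds s. vector_derivative (\<lambda>t. nth_vderiv j (\<lambda>s. u (t, s)) s) (at t) =
        nth_vderiv j (\<lambda>s. vector_derivative (\<lambda>t. u (t, s)) (at t)) s"
      using eventually_nhds_PairD(2)[OF smooth_at_eventually[OF Suc.prems]]
      by eventually_elim (rule Suc.IH)
  qed
  finally show ?case by (simp add: nth_vderiv_Suc)
qed simp

section \<open>Contact of finite order between curves in a vector space\<close>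

definition agree :: "nat \<Rightarrow> (real \<Rightarrow> 'x::real_normed_vector) \<Rightarrow> (real \<Rightarrow> 'x) \<Rightarrow> bool" where
  "agree n f g \<longleftrightarrow> (\<forall>i\<le>n. nth_vderiv i f 0 = nth_vderiv i g 0)"

lemma agree_0 [simp]: "agree 0 f g \<longleftrightarrow> f 0 = g 0"
  by (simp add: agree_def)

text \<open>Taking the innermost derivative first turns one order of contact into a condition on
  velocities. Inductions along this equivalence get by with the first-order sum, product and chain
  rules.\<close>

lemma agree_Suc: "agree (Suc n) f g \<longleftrightarrow>
    f 0 = g 0 \<and> agree n (\<lambda>t. vector_derivative f (at t)) (\<lambda>t. vector_derivative g (at t))"
proof -
  have "(\<forall>i\<le>Suc n. nth_vderiv i f 0 = nth_vderiv i g 0) \<longleftrightarrow>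
     nth_vderiv 0 f 0 = nth_vderiv 0 g 0 \<and> (\<forall>i\<le>n. nth_vderiv (Suc i) f 0 = nth_vderiv (Suc i) g 0)"
    by (metis Suc_le_mono not0_implies_Suc zero_le)
  then show ?thesis by (simp add: agree_def nth_vderiv_Suc_inner)
qed

lemma agree_Suc_imp: "agree (Suc n) f g \<Longrightarrow> agree n f g"
  by (simp add: agree_def)

lemma agree_cong:
  assumes "\<forall>\<^sub>F t in nhds 0. f t = f' t" "\<forall>\<^sub>F t in nhds 0. g t = g' t" "agree n f' g'"
  shows "agree n f g"
  using assms(3) unfolding agree_def nth_vderiv_cong[OF assms(1)] nth_vderiv_cong[OF assms(2)] .

lemma agree_linear:
  assumes "bounded_linear L" "smooth_at 0 f" "smooth_at 0 g" "agree n f g"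
  shows "agree n (\<lambda>t. L (f t)) (\<lambda>t. L (g t))"
  using assms by (simp add: agree_def nth_vderiv_linear_comp)

lemma agree_add:
  assumes "smooth_at 0 f" "smooth_at 0 g" "smooth_at 0 f'" "smooth_at 0 g'" "agree n f f'" "agree n g g'"
  shows "agree n (\<lambda>t. f t + g t) (\<lambda>t. f' t + g' t)"
  using assms
proof (induction n arbitrary: f g f' g')
  case (Suc n)
  have ev: "\<forall>\<^sub>F t in nhds 0. vector_derivative (\<lambda>t. f t + g t) (at t)
      = vector_derivative f (at t) + vector_derivative g (at t)"
    if "smooth_at 0 f" "smooth_at 0 g" for f g :: "real \<Rightarrow> 'a"
    using that[THEN smooth_at_eventually]
    by eventually_elim (intro vector_derivative_at has_vector_derivative_add smooth_at_has_vderiv)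
  show ?case unfolding agree_Suc
    by (intro conjI agree_cong[OF ev ev] Suc.IH smooth_at_vderiv)
       (use Suc.prems in \<open>auto simp: agree_Suc\<close>)
qed simp

lemma agree_sum:
  assumes "finite I" "\<And>i. i \<in> I \<Longrightarrow> smooth_at 0 (f i)" "\<And>i. i \<in> I \<Longrightarrow> smooth_at 0 (g i)"
    "\<And>i. i \<in> I \<Longrightarrow> agree n (f i) (g i)"
  shows "agree n (\<lambda>t. \<Sum>i\<in>I. f i t) (\<lambda>t. \<Sum>i\<in>I. g i t)"
  using assms
proof (induction I)
  case (insert i I)
  then have "agree n (\<lambda>t. f i t + (\<Sum>i\<in>I. f i t)) (\<lambda>t. g i t + (\<Sum>i\<in>I. g i t))"
    by (intro agree_add smooth_at_sum) auto
  then show ?case using insert.hyps by simp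
qed (simp add: agree_def)

lemma agree_scaleR:
  fixes f f' :: "real \<Rightarrow> real"
  assumes "smooth_at 0 f" "smooth_at 0 g" "smooth_at 0 f'" "smooth_at 0 g'" "agree n f f'" "agree n g g'"
  shows "agree n (\<lambda>t. f t *\<^sub>R g t) (\<lambda>t. f' t *\<^sub>R g' t)"
  using assms
proof (induction n arbitrary: f g f' g')
  case (Suc n)
  have ev: "\<forall>\<^sub>F t in nhds 0. vector_derivative (\<lambda>t. f t *\<^sub>R g t) (at t)
      = f t *\<^sub>R vector_derivative g (at t) + vector_derivative f (at t) *\<^sub>R g t"
    if "smooth_at 0 f" "smooth_at 0 g" for f and g :: "real \<Rightarrow> 'a"
    using that[THEN smooth_at_eventually]
  proof eventually_elim
    case (elim t)
    then show ?case
      using vector_derivative_at[OF has_vector_derivative_scaleR[OF _ smooth_at_has_vderiv[of t g],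
        of f "vector_derivative f (at t)"]] smooth_at_has_vderiv[of t f]
      by (simp add: has_real_derivative_iff_has_vector_derivative)
  qed
  note lower = Suc.prems(5,6)[THEN agree_Suc_imp]
  show ?case unfolding agree_Suc
    by (intro conjI agree_cong[OF ev ev] agree_add Suc.IH smooth_at_vderiv smooth_at_scaleR lower)
       (use Suc.prems in \<open>auto simp: agree_Suc\<close>)
qed simp

text \<open>In a frame, the velocity of \<open>f\<close> along \<open>c\<close> is a sum of products
  of velocity components of \<open>c\<close> with directional derivatives of \<open>f\<close> along
  \<open>c\<close>. The former are in contact to order \<open>n\<close> by assumption, the latter by
  the induction hypothesis for the directional derivatives, hence the generalisation over
  \<open>f\<close>. This is why jets do not depend on charts and why smooth maps act on
  them.\<close>

lemma agree_compose:
  fixes f :: "'y::real_inner \<Rightarrow> 'z::real_normed_vector"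
  assumes fin: "finite_dim TYPE('y)"
    and "smooth_at (c 0) f" "smooth_at 0 c" "smooth_at 0 d" "agree n c d"
  shows "agree n (\<lambda>t. f (c t)) (\<lambda>t. f (d t))"
  using assms(2-)
proof (induction n arbitrary: f)
  case (Suc n)
  obtain B :: "'y set" where B: "finite B" "\<And>x. x = (\<Sum>b\<in>B. (x \<bullet> b) *\<^sub>R b)"
    using finite_dim_frame[OF fin] by blast
  let ?f' = "\<lambda>b y. frechet_derivative f (at y) b"
  have ev: "\<forall>\<^sub>F t in nhds 0. vector_derivative (\<lambda>t. f (c t)) (at t)
      = (\<Sum>b\<in>B. (vector_derivative c (at t) \<bullet> b) *\<^sub>R ?f' b (c t))"
    if "smooth_at 0 c" "smooth_at (c 0) f" for c
    using smooth_at_eventually[OF that(1)]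
      smooth_at_eventually_comp[OF that(1) smooth_at_eventually[OF that(2)]]
  proof eventually_elim
    case (elim t)
    have lin: "linear (frechet_derivative f (at (c t)))"
      using smooth_at_has_derivative[OF elim(2)] by (rule has_derivative_linear)
    have "vector_derivative (\<lambda>t. f (c t)) (at t) = ?f' (vector_derivative c (at t)) (c t)"
      by (intro vector_derivative_at smooth_at_directional smooth_at_has_vderiv elim)
    also have "\<dots> = ?f' (\<Sum>b\<in>B. (vector_derivative c (at t) \<bullet> b) *\<^sub>R b) (c t)"
      using B(2) by metis
    finally show ?case by (simp add: linear_sum[OF lin] linear_scale[OF lin])
  qed
  have eq: "c 0 = d 0" and ag: "agree n c d"
      "agree n (\<lambda>t. vector_derivative c (at t)) (\<lambda>t. vector_derivative d (at t))"
    using Suc.prems agree_Suc_imp by (auto simp: agree_Suc)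
  have sm: "smooth_at 0 (\<lambda>t. ?f' b (c t))" "smooth_at 0 (\<lambda>t. ?f' b (d t))" for b
    by (rule smooth_at_compose[OF fin smooth_at_frechet_derivative]; use Suc.prems eq in simp)+
  show ?case unfolding agree_Suc
  proof (intro conjI agree_cong[OF ev ev] agree_sum B agree_scaleR)
    fix b
    show "agree n (\<lambda>t. ?f' b (c t)) (\<lambda>t. ?f' b (d t))"
      by (intro Suc.IH smooth_at_frechet_derivative Suc.prems ag)
    show "agree n (\<lambda>t. vector_derivative c (at t) \<bullet> b) (\<lambda>t. vector_derivative d (at t) \<bullet> b)"
      by (intro agree_linear[OF bounded_linear_inner_left] smooth_at_vderiv Suc.prems ag)
  qed (use Suc.prems eq sm in \<open>auto intro!: smooth_at_scaleR
        smooth_at_linear_comp[OF bounded_linear_inner_left] smooth_at_vderiv\<close>)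
qed simp

section \<open>Smooth atlases\<close>

text \<open>Separation and countability are left out so that the notion passes to jet atlases without
  any topology.\<close>

definition smooth_atlas :: "('a, 'e::real_inner) atlas \<Rightarrow> bool" where
  "smooth_atlas A \<longleftrightarrow> finite_dim TYPE('e) \<and>
     (\<forall>(D, \<phi>)\<in>A. inj_on \<phi> D \<and> open (\<phi> ` D)) \<and>
     (\<forall>(D, \<phi>)\<in>A. \<forall>(E, \<psi>)\<in>A.
        open (\<phi> ` (D \<inter> E)) \<and> smooth_on (\<phi> ` (D \<inter> E)) (\<psi> \<circ> inv_into D \<phi>))"

lemma smooth_manifold_imp_smooth_atlas: "smooth_manifold A \<Longrightarrow> smooth_atlas A"
  unfolding smooth_manifold_def smooth_atlas_def finite_dim_def by blast

lemma smooth_atlasD: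
  assumes "smooth_atlas (A :: ('a, 'e::real_inner) atlas)"
  shows "finite_dim TYPE('e::real_inner)"
    "(D, \<phi>) \<in> A \<Longrightarrow> inj_on \<phi> D" "(D, \<phi>) \<in> A \<Longrightarrow> open (\<phi> ` D)"
    "(D, \<phi>) \<in> A \<Longrightarrow> p \<in> D \<Longrightarrow> inv_into D \<phi> (\<phi> p) = p"
    "(D, \<phi>) \<in> A \<Longrightarrow> (E, \<psi>) \<in> A \<Longrightarrow> open (\<phi> ` (D \<inter> E))"
    "(D, \<phi>) \<in> A \<Longrightarrow> (E, \<psi>) \<in> A \<Longrightarrow> p \<in> D \<Longrightarrow> p \<in> E \<Longrightarrow>
       smooth_at (\<phi> p) (\<lambda>y. \<psi> (inv_into D \<phi> y))"
proof -
  note * = assms[unfolded smooth_atlas_def]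
  show "finite_dim TYPE('e)" "(D, \<phi>) \<in> A \<Longrightarrow> inj_on \<phi> D" "(D, \<phi>) \<in> A \<Longrightarrow> open (\<phi> ` D)"
    "(D, \<phi>) \<in> A \<Longrightarrow> (E, \<psi>) \<in> A \<Longrightarrow> open (\<phi> ` (D \<inter> E))"
    "(D, \<phi>) \<in> A \<Longrightarrow> p \<in> D \<Longrightarrow> inv_into D \<phi> (\<phi> p) = p"
    using * by (auto intro: inv_into_f_f)
  assume "(D, \<phi>) \<in> A" "(E, \<psi>) \<in> A" "p \<in> D" "p \<in> E"
  then have "open (\<phi> ` (D \<inter> E))" "smooth_on (\<phi> ` (D \<inter> E)) (\<psi> \<circ> inv_into D \<phi>)" "\<phi> p \<in> \<phi> ` (D \<inter> E)"
    using * by auto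
  from smooth_on_imp_smooth_at[OF this(2,1,3)]
  show "smooth_at (\<phi> p) (\<lambda>y. \<psi> (inv_into D \<phi> y))" by (simp add: o_def)
qed

section \<open>Germs of smooth maps from a vector space into an atlas\<close>

lemma smooth_near_iff:
  "smooth_near x A c \<longleftrightarrow>
     (\<exists>(E, \<psi>)\<in>A. (\<forall>\<^sub>F y in nhds x. c y \<in> E) \<and> smooth_at x (\<lambda>y. \<psi> (c y)))" (is "?L \<longleftrightarrow> ?R")
proof
  assume ?L
  then obtain W where W: "open W" "x \<in> W" "smooth_map_on eucl_atlas A W c"
    unfolding smooth_near_def by blast
  then obtain E \<psi> V where "(E, \<psi>) \<in> A" "open V" "x \<in> V" "c ` V \<subseteq> E" "smooth_on V (\<lambda>y. \<psi> (c y))"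
    unfolding smooth_map_on_def eucl_atlas_def man_open_def by (fastforce simp: o_def id_def)
  then show ?R unfolding smooth_at_def eventually_nhds by blast
next
  assume ?R
  then obtain E \<psi> V W where E: "(E, \<psi>) \<in> A" "open V" "x \<in> V" "\<forall>y\<in>V. c y \<in> E"
      "open W" "x \<in> W" "smooth_on W (\<lambda>y. \<psi> (c y))"
    unfolding smooth_at_def eventually_nhds by blast
  then have "smooth_on (V \<inter> W) (\<lambda>y. \<psi> (c y))"
    by (meson smooth_on_imp_smooth_at smooth_onI_smooth_at IntD2)
  moreover have "man_open eucl_atlas (V \<inter> W)"
    using E unfolding man_open_def eucl_atlas_def carrier_def by (simp add: open_Int)
  ultimately have "smooth_map_on eucl_atlas A (V \<inter> W) c"
    unfolding smooth_map_on_def eucl_atlas_def using E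
    by (auto simp: o_def id_def image_subset_iff intro!: bexI[of _ "(E, \<psi>)"] exI[of _ "V \<inter> W"])
  then show ?L unfolding smooth_near_def using E by (intro exI[of _ "V \<inter> W"]) auto
qed

text \<open>One chart witnesses smoothness; every other chart around \<open>c x\<close> then works
  as well, by composing with the transition map. That \<open>c\<close> stays in \<open>E\<close>
  comes from openness of the image of \<open>D \<inter> E\<close> under \<open>\<phi>\<close> and
  injectivity of \<open>\<phi>\<close>.\<close>

lemma smooth_near_chart:
  fixes A :: "('a, 'e::real_inner) atlas"
  assumes A: "smooth_atlas A" and "smooth_near x A c" "(E, \<psi>) \<in> A" "c x \<in> E"
  shows "\<forall>\<^sub>F y in nhds x. c y \<in> E" "smooth_at x (\<lambda>y. \<psi> (c y))"
proof -
  note [simp] = smooth_atlasD[OF A]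
  obtain D \<phi> where D: "(D, \<phi>) \<in> A" "\<forall>\<^sub>F y in nhds x. c y \<in> D" "smooth_at x (\<lambda>y. \<phi> (c y))"
    using assms(2) unfolding smooth_near_iff by blast
  have cx: "c x \<in> D" using D(2) by (rule eventually_nhds_x_imp_x)
  have "\<forall>\<^sub>F z in nhds (\<phi> (c x)). z \<in> \<phi> ` (D \<inter> E)"
    using D assms cx by (intro eventually_nhds_in_open) simp_all
  then have "\<forall>\<^sub>F y in nhds x. \<phi> (c y) \<in> \<phi> ` (D \<inter> E)"
    by (rule smooth_at_eventually_comp[OF D(3)])
  with D(2) show ev: "\<forall>\<^sub>F y in nhds x. c y \<in> E"
    by eventually_elim (use smooth_atlasD(2)[OF A D(1)] in \<open>auto simp: inj_on_def\<close>)
  have "smooth_at x (\<lambda>y. \<psi> (inv_into D \<phi> (\<phi> (c y))))"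
    by (rule smooth_at_compose[OF _ _ D(3)]) (use D assms cx in auto)
  then show "smooth_at x (\<lambda>y. \<psi> (c y))"
    by (rule smooth_at_cong) (use D(2) in eventually_elim, use D in simp)
qed

lemma smooth_near_obtain_chart:
  assumes "smooth_near x A c"
  obtains D \<phi> where "(D, \<phi>) \<in> A" "c x \<in> D" "\<forall>\<^sub>F y in nhds x. c y \<in> D" "smooth_at x (\<lambda>y. \<phi> (c y))"
  using assms unfolding smooth_near_iff by (auto dest: eventually_nhds_x_imp_x)

lemma smooth_nearI:
  "(D, \<phi>) \<in> A \<Longrightarrow> \<forall>\<^sub>F y in nhds x. c y \<in> D \<Longrightarrow> smooth_at x (\<lambda>y. \<phi> (c y)) \<Longrightarrow> smooth_near x A c"
  unfolding smooth_near_iff by auto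

lemma smooth_near_eventually:
  assumes "smooth_near x A c"
  shows "\<forall>\<^sub>F y in nhds x. smooth_near y A c"
proof -
  obtain D \<phi> where D: "(D, \<phi>) \<in> A" "\<forall>\<^sub>F y in nhds x. c y \<in> D" "smooth_at x (\<lambda>y. \<phi> (c y))"
    using assms by (rule smooth_near_obtain_chart)
  have "\<forall>\<^sub>F y in nhds x. \<forall>\<^sub>F z in nhds y. c z \<in> D" using D(2) by (simp add: eventually_eventually)
  with smooth_at_eventually[OF D(3)] show ?thesis
    by eventually_elim (rule smooth_nearI[OF D(1)])
qed

lemma smooth_near_cong:
  assumes "smooth_near x A c" "\<forall>\<^sub>F y in nhds x. c y = d y"
  shows "smooth_near x A d"
proof -
  obtain D \<phi> where D: "(D, \<phi>) \<in> A" "\<forall>\<^sub>F y in nhds x. c y \<in> D" "smooth_at x (\<lambda>y. \<phi> (c y))"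
    using assms(1) by (rule smooth_near_obtain_chart)
  show ?thesis
  proof (rule smooth_nearI[OF D(1)])
    show "\<forall>\<^sub>F y in nhds x. d y \<in> D" using D(2) assms(2) by eventually_elim simp
    show "smooth_at x (\<lambda>y. \<phi> (d y))"
      by (rule smooth_at_cong[OF D(3)]) (use assms(2) in eventually_elim, simp)
  qed
qed

lemma smooth_near_compose:
  fixes c :: "'y::real_inner \<Rightarrow> 'a"
  assumes "finite_dim TYPE('y)" "smooth_near (g x) A c" "smooth_at x g"
  shows "smooth_near x A (\<lambda>x. c (g x))"
proof -
  obtain D \<phi> where D: "(D, \<phi>) \<in> A" "\<forall>\<^sub>F y in nhds (g x). c y \<in> D" "smooth_at (g x) (\<lambda>y. \<phi> (c y))"
    using assms(2) by (rule smooth_near_obtain_chart)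
  show ?thesis
    by (intro smooth_nearI[OF D(1)] smooth_at_eventually_comp[OF assms(3) D(2)]
        smooth_at_compose[OF assms(1) D(3) assms(3)])
qed

lemma smooth_near_imp_carrier: "smooth_near x A c \<Longrightarrow> c x \<in> carrier A"
  by (erule smooth_near_obtain_chart) (auto simp: carrier_def)

lemma smooth_near_inv_chart:
  assumes A: "smooth_atlas A" and "(D, \<phi>) \<in> A" "y \<in> \<phi> ` D"
  shows "smooth_near y A (inv_into D \<phi>)"
proof (rule smooth_nearI[OF assms(2)])
  have ev: "\<forall>\<^sub>F z in nhds y. z \<in> \<phi> ` D"
    using smooth_atlasD(3)[OF A assms(2)] assms(3) by (rule eventually_nhds_in_open)
  then show "\<forall>\<^sub>F z in nhds y. inv_into D \<phi> z \<in> D" by eventually_elim (rule inv_into_into)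
  show "smooth_at y (\<lambda>z. \<phi> (inv_into D \<phi> z))"
    by (rule smooth_at_cong[OF smooth_at_ident]) (use ev in eventually_elim, simp add: f_inv_into_f)
qed

lemma smooth_near_prod:
  "smooth_near x (prod_atlas A B) c \<longleftrightarrow>
     smooth_near x A (\<lambda>y. fst (c y)) \<and> smooth_near x B (\<lambda>y. snd (c y))" (is "?L \<longleftrightarrow> ?R")
proof
  assume ?L
  then obtain D \<phi> E \<psi> where *: "(D, \<phi>) \<in> A" "(E, \<psi>) \<in> B" "\<forall>\<^sub>F y in nhds x. c y \<in> D \<times> E"
    "smooth_at x (\<lambda>y. map_prod \<phi> \<psi> (c y))"
    unfolding smooth_near_iff prod_atlas_def by blast
  show ?R
  proof
    show "smooth_near x A (\<lambda>y. fst (c y))"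
      by (rule smooth_nearI[OF *(1)]) (use *(3) smooth_at_fst[OF *(4)] in \<open>auto elim: eventually_mono\<close>)
    show "smooth_near x B (\<lambda>y. snd (c y))"
      by (rule smooth_nearI[OF *(2)]) (use *(3) smooth_at_snd[OF *(4)] in \<open>auto elim: eventually_mono\<close>)
  qed
next
  assume ?R
  then obtain D \<phi> E \<psi> where *: "(D, \<phi>) \<in> A" "\<forall>\<^sub>F y in nhds x. fst (c y) \<in> D" "smooth_at x (\<lambda>y. \<phi> (fst (c y)))"
     "(E, \<psi>) \<in> B" "\<forall>\<^sub>F y in nhds x. snd (c y) \<in> E" "smooth_at x (\<lambda>y. \<psi> (snd (c y)))"
    unfolding smooth_near_iff by blast
  show ?L
  proof (rule smooth_nearI)
    show "(D \<times> E, map_prod \<phi> \<psi>) \<in> prod_atlas A B" using * by (auto simp: prod_atlas_def)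
    show "\<forall>\<^sub>F y in nhds x. c y \<in> D \<times> E"
      using *(2,5) by eventually_elim (auto simp: mem_Times_iff)
    show "smooth_at x (\<lambda>y. map_prod \<phi> \<psi> (c y))"
      using smooth_at_Pair[OF *(3,6)] by (simp add: map_prod_def split_beta)
  qed
qed

section \<open>Smoothness of maps and openness of sets, tested along germs\<close>

definition smooth_map_at ::
  "('a, 'e::real_normed_vector) atlas \<Rightarrow> ('b, 'f::real_normed_vector) atlas \<Rightarrow> ('a \<Rightarrow> 'b) \<Rightarrow> 'a \<Rightarrow> bool"
where
  "smooth_map_at A B F p \<longleftrightarrow> (\<exists>(D, \<phi>)\<in>A. p \<in> D \<and> smooth_near (\<phi> p) B (\<lambda>y. F (inv_into D \<phi> y)))"

text \<open>Near \<open>x\<close>, \<open>c\<close> is the inverse chart applied to its own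
  coordinate expression, so \<open>F\<close> along \<open>c\<close> is the germ from
  \<open>smooth_map_at\<close> composed with a smooth function. This lets maps be handled through
  their action on smooth germs.\<close>

lemma smooth_near_map:
  assumes A: "smooth_atlas A" and "smooth_map_at A B F (c x)" "smooth_near x A c"
  shows "smooth_near x B (\<lambda>x. F (c x))"
proof -
  obtain D \<phi> where D: "(D, \<phi>) \<in> A" "c x \<in> D" "smooth_near (\<phi> (c x)) B (\<lambda>y. F (inv_into D \<phi> y))"
    using assms(2) unfolding smooth_map_at_def by blast
  note c = smooth_near_chart[OF A assms(3) D(1,2)]
  show ?thesis
    by (rule smooth_near_cong[OF smooth_near_compose[OF smooth_atlasD(1)[OF A] D(3) c(2)]])
       (use c(1) in eventually_elim, simp add: smooth_atlasD(4)[OF A D(1)])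
qed

lemma smooth_map_at_prodD:
  assumes "smooth_map_at A (prod_atlas B C) F p"
  shows "smooth_map_at A B (\<lambda>p. fst (F p)) p" "smooth_map_at A C (\<lambda>p. snd (F p)) p"
  using assms unfolding smooth_map_at_def by (auto simp: smooth_near_prod)

lemma man_open_smooth_near:
  assumes A: "smooth_atlas A" and "man_open A W" "smooth_near x A c" "c x \<in> W"
  shows "\<forall>\<^sub>F y in nhds x. c y \<in> W"
proof -
  obtain D \<phi> where D: "(D, \<phi>) \<in> A" "c x \<in> D" "\<forall>\<^sub>F y in nhds x. c y \<in> D" "smooth_at x (\<lambda>y. \<phi> (c y))"
    using assms(3) by (rule smooth_near_obtain_chart)
  have "open (\<phi> ` (W \<inter> D))" using assms(2) D(1) by (auto simp: man_open_def)
  then have "\<forall>\<^sub>F z in nhds (\<phi> (c x)). z \<in> \<phi> ` (W \<inter> D)"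
    using D assms(4) by (intro eventually_nhds_in_open) auto
  then have "\<forall>\<^sub>F y in nhds x. \<phi> (c y) \<in> \<phi> ` (W \<inter> D)" by (rule smooth_at_eventually_comp[OF D(4)])
  with D(3) show ?thesis
    by eventually_elim (use smooth_atlasD(2)[OF A D(1)] in \<open>auto simp: inj_on_def\<close>)
qed

text \<open>\<open>man_open\<close> asks for open images in every chart. One chart around each point
  is enough, since the condition is carried to any other chart \<open>E\<close> by the transition
  map, which is continuous.\<close>

lemma man_openI:
  assumes A: "smooth_atlas A"
    and W: "\<And>p. p \<in> W \<Longrightarrow> \<exists>(D, \<phi>)\<in>A. p \<in> D \<and> (\<forall>\<^sub>F y in nhds (\<phi> p). inv_into D \<phi> y \<in> W)"
  shows "man_open A W"
  unfolding man_open_def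
proof (intro conjI ballI)
  show "W \<subseteq> carrier A" using W by (fastforce simp: carrier_def)
  fix a assume "a \<in> A"
  moreover obtain E \<psi> where a: "a = (E, \<psi>)" by fastforce
  ultimately have E: "(E, \<psi>) \<in> A" by simp
  have "\<forall>\<^sub>F y in nhds (\<psi> p). y \<in> \<psi> ` (W \<inter> E)" if p: "p \<in> W" "p \<in> E" for p
  proof -
    obtain D \<phi> where D: "(D, \<phi>) \<in> A" "p \<in> D" "\<forall>\<^sub>F y in nhds (\<phi> p). inv_into D \<phi> y \<in> W"
      using W[OF p(1)] by blast
    have [simp]: "inv_into E \<psi> (\<psi> p) = p" by (rule smooth_atlasD(4)[OF A E p(2)])
    have "smooth_near (\<psi> p) A (inv_into E \<psi>)" by (rule smooth_near_inv_chart[OF A E]) (use p in simp)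
    note c = smooth_near_chart[OF A this D(1), simplified, OF D(2)]
    have "\<forall>\<^sub>F y in nhds (\<psi> p). inv_into D \<phi> (\<phi> (inv_into E \<psi> y)) \<in> W"
      using smooth_at_eventually_comp[OF c(2)] D(3) by simp
    moreover have "\<forall>\<^sub>F y in nhds (\<psi> p). y \<in> \<psi> ` E"
      using smooth_atlasD(3)[OF A E] p by (intro eventually_nhds_in_open) auto
    ultimately show ?thesis using c(1)
    proof eventually_elim
      case (elim y)
      then have "inv_into E \<psi> y \<in> W \<inter> E"
        using smooth_atlasD(4)[OF A D(1)] by (auto intro: inv_into_into)
      then show ?case using f_inv_into_f[OF elim(2)] by (metis imageI)
    qed
  qed
  then show "case a of (D, \<phi>) \<Rightarrow> open (\<phi> ` (W \<inter> D))"
    unfolding a eventually_nhds by (auto simp: open_subopen[of "\<psi> ` (W \<inter> E)"] subset_eq)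
qed

lemma man_open_preimage:
  assumes A: "smooth_atlas A" and B: "smooth_atlas B"
    and "\<And>p. p \<in> carrier A \<Longrightarrow> smooth_map_at A B F p" "man_open B V"
  shows "man_open A {p \<in> carrier A. F p \<in> V}"
proof (rule man_openI[OF A])
  fix p assume p: "p \<in> {p \<in> carrier A. F p \<in> V}"
  then obtain D \<phi> where D: "(D, \<phi>) \<in> A" "p \<in> D" by (auto simp: carrier_def)
  have [simp]: "inv_into D \<phi> (\<phi> p) = p" by (rule smooth_atlasD(4)[OF A D])
  have c: "smooth_near (\<phi> p) A (inv_into D \<phi>)" by (rule smooth_near_inv_chart[OF A D(1)]) (use D in simp)
  have "smooth_near (\<phi> p) B (\<lambda>y. F (inv_into D \<phi> y))"
    by (rule smooth_near_map[OF A _ c]) (use p assms(3) in simp)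
  then have "\<forall>\<^sub>F y in nhds (\<phi> p). F (inv_into D \<phi> y) \<in> V"
    by (rule man_open_smooth_near[OF B assms(4)]) (use p in simp)
  moreover have "\<forall>\<^sub>F y in nhds (\<phi> p). inv_into D \<phi> y \<in> carrier A"
    using smooth_near_eventually[OF c] by eventually_elim (rule smooth_near_imp_carrier)
  ultimately have "\<forall>\<^sub>F y in nhds (\<phi> p). inv_into D \<phi> y \<in> {p \<in> carrier A. F p \<in> V}"
    by eventually_elim simp
  then show "\<exists>(D, \<phi>)\<in>A. p \<in> D \<and> (\<forall>\<^sub>F y in nhds (\<phi> p). inv_into D \<phi> y \<in> {p \<in> carrier A. F p \<in> V})"
    using D by auto
qed

lemma smooth_map_on_imp_at:
  assumes A: "smooth_atlas A" and "smooth_map_on A B U F" "p \<in> U"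
  shows "smooth_map_at A B F p"
proof -
  obtain D \<phi> E \<psi> W where *: "(D, \<phi>) \<in> A" "(E, \<psi>) \<in> B" "man_open A W" "p \<in> W" "W \<subseteq> U \<inter> D"
    "F ` W \<subseteq> E" "smooth_on (\<phi> ` W) (\<psi> \<circ> F \<circ> inv_into D \<phi>)"
    using bspec[OF assms(2)[unfolded smooth_map_on_def] assms(3)] by blast
  have "W \<inter> D = W" using * by auto
  then have op: "open (\<phi> ` W)" using *(1,3) unfolding man_open_def by fastforce
  have "smooth_near (\<phi> p) B (\<lambda>y. F (inv_into D \<phi> y))"
  proof (rule smooth_nearI[OF *(2)])
    have "\<forall>\<^sub>F y in nhds (\<phi> p). y \<in> \<phi> ` W" using op * by (intro eventually_nhds_in_open) auto
    then show "\<forall>\<^sub>F y in nhds (\<phi> p). F (inv_into D \<phi> y) \<in> E"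
      by eventually_elim (use * smooth_atlasD(4)[OF A *(1)] in force)
    show "smooth_at (\<phi> p) (\<lambda>y. \<psi> (F (inv_into D \<phi> y)))"
      using smooth_on_imp_smooth_at[OF *(7) op] * by (simp add: o_def)
  qed
  then show ?thesis unfolding smooth_map_at_def using * by (intro bexI[of _ "(D, \<phi>)"]) auto
qed

lemma smooth_map_onI:
  assumes A: "smooth_atlas A" and U: "man_open A U" and F: "\<And>p. p \<in> U \<Longrightarrow> smooth_map_at A B F p"
  shows "smooth_map_on A B U F"
  unfolding smooth_map_on_def
proof
  fix p assume p: "p \<in> U"
  then obtain D \<phi> where D: "(D, \<phi>) \<in> A" "p \<in> D" "smooth_near (\<phi> p) B (\<lambda>y. F (inv_into D \<phi> y))"
    using F unfolding smooth_map_at_def by blast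
  obtain E \<psi> where E: "(E, \<psi>) \<in> B" "\<forall>\<^sub>F y in nhds (\<phi> p). F (inv_into D \<phi> y) \<in> E"
      "smooth_at (\<phi> p) (\<lambda>y. \<psi> (F (inv_into D \<phi> y)))"
    using D(3) by (rule smooth_near_obtain_chart)
  have invp: "inv_into D \<phi> (\<phi> p) = p" by (rule smooth_atlasD(4)[OF A D(1,2)])
  have "smooth_near (\<phi> p) A (inv_into D \<phi>)" by (rule smooth_near_inv_chart[OF A D(1)]) (use D in simp)
  then have "\<forall>\<^sub>F y in nhds (\<phi> p). inv_into D \<phi> y \<in> U"
    by (rule man_open_smooth_near[OF A U]) (use p invp in simp)
  moreover have "\<forall>\<^sub>F y in nhds (\<phi> p). y \<in> \<phi> ` D"
    using smooth_atlasD(3)[OF A D(1)] D by (intro eventually_nhds_in_open) auto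
  ultimately have "\<forall>\<^sub>F y in nhds (\<phi> p). y \<in> \<phi> ` D \<and> inv_into D \<phi> y \<in> U \<and> F (inv_into D \<phi> y) \<in> E \<and>
      smooth_at y (\<lambda>y. \<psi> (F (inv_into D \<phi> y)))"
    using E(2) smooth_at_eventually[OF E(3)] by eventually_elim simp
  then obtain V where V: "open V" "\<phi> p \<in> V" "\<And>y. y \<in> V \<Longrightarrow> y \<in> \<phi> ` D \<and> inv_into D \<phi> y \<in> U \<and>
      F (inv_into D \<phi> y) \<in> E \<and> smooth_at y (\<lambda>y. \<psi> (F (inv_into D \<phi> y)))"
    unfolding eventually_nhds by blast
  \<comment> \<open>The single open set required by \<open>smooth_map_on\<close> is pulled back from
    \<open>V\<close>, a neighbourhood in the model space on which the conditions on chart domain,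
    \<open>U\<close>, target chart and smoothness hold simultaneously.\<close>
  define W where "W = inv_into D \<phi> ` V"
  have phiW: "\<phi> ` W = V" using V f_inv_into_f[of _ \<phi> D] unfolding W_def image_image by force
  have "man_open A W"
  proof (rule man_openI[OF A])
    fix q assume q: "q \<in> W"
    then have "q \<in> D" "\<phi> q \<in> V" using V phiW unfolding W_def by (auto intro: inv_into_into)
    moreover have "\<forall>\<^sub>F y in nhds (\<phi> q). inv_into D \<phi> y \<in> W"
      using eventually_nhds_in_open[OF V(1) \<open>\<phi> q \<in> V\<close>] by eventually_elim (simp add: W_def)
    ultimately show "\<exists>(D, \<phi>)\<in>A. q \<in> D \<and> (\<forall>\<^sub>F y in nhds (\<phi> q). inv_into D \<phi> y \<in> W)"
      using D(1) by auto
  qed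
  moreover have "p \<in> W" unfolding W_def using V(2) invp by (metis imageI)
  moreover have "W \<subseteq> U \<inter> D" "F ` W \<subseteq> E" using V unfolding W_def by (auto intro: inv_into_into)
  moreover have "smooth_on (\<phi> ` W) (\<psi> \<circ> F \<circ> inv_into D \<phi>)"
    unfolding phiW by (rule smooth_onI_smooth_at) (use V in \<open>simp add: o_def\<close>)
  ultimately show "\<exists>(D, \<phi>)\<in>A. \<exists>(E, \<psi>)\<in>B. \<exists>W. man_open A W \<and> p \<in> W \<and> W \<subseteq> U \<inter> D \<and> F ` W \<subseteq> E \<and>
        smooth_on (\<phi> ` W) (\<psi> \<circ> F \<circ> inv_into D \<phi>)"
    using D(1) E(1) by blast
qed

section \<open>Jets of curves\<close>

abbreviation jet_order :: "'k::{finite, linorder} \<Rightarrow> nat" where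
  "jet_order i \<equiv> card {..<i}"

lemma jet_order_less: "i < j \<Longrightarrow> jet_order i < jet_order (j :: 'k::{finite, linorder})"
  by (intro psubset_card_mono) auto

lemma jet_order_eq_iff: "jet_order i = jet_order j \<longleftrightarrow> i = (j :: 'k::{finite, linorder})"
  by (metis jet_order_less less_irrefl linorder_neqE)

lemma jet_order_le:
  assumes "CARD('k) = k + 1"
  shows "jet_order (i :: 'k::{finite, linorder}) \<le> k"
proof -
  have "jet_order i < card (UNIV :: 'k set)" by (intro psubset_card_mono) auto
  then show ?thesis using assms by simp
qed

text \<open>The rank function is injective and bounded by \<open>k\<close> on a type of
  \<open>k + 1\<close> elements, hence onto \<open>{..k}\<close>.\<close>

lemma jet_order_surj:
  assumes "CARD('k) = k + 1" "j \<le> k"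
  obtains i :: "'k::{finite, linorder}" where "jet_order i = j"
proof -
  have "jet_order ` (UNIV :: 'k set) = {..k}"
  proof (rule card_subset_eq)
    show "jet_order ` (UNIV :: 'k set) \<subseteq> {..k}" using jet_order_le[OF assms(1)] by auto
    show "card (jet_order ` (UNIV :: 'k set)) = card {..k}"
      using assms(1) by (subst card_image) (auto simp: inj_on_def jet_order_eq_iff)
  qed simp
  then show thesis using that assms(2) by (metis atMost_iff imageE)
qed

lemma jet_order_all:
  assumes "CARD('k) = k + 1"
  shows "(\<forall>j::'k::{finite, linorder}. P (jet_order j)) \<longleftrightarrow> (\<forall>j\<le>k. P j)"
proof
  assume *: "\<forall>j::'k. P (jet_order j)"
  show "\<forall>j\<le>k. P j"
  proof (intro allI impI)
    fix j assume "j \<le> k"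
    then obtain i :: 'k where "jet_order i = j" using jet_order_surj[OF assms] by blast
    then show "P j" using * by blast
  qed
qed (simp add: jet_order_le[OF assms])

lemma agree_iff_jet_order:
  assumes "CARD('k) = k + 1"
  shows "agree k f g \<longleftrightarrow>
    (\<forall>i::'k::{finite, linorder}. nth_vderiv (jet_order i) f 0 = nth_vderiv (jet_order i) g 0)"
  unfolding agree_def jet_order_all[OF assms, of "\<lambda>i. nth_vderiv i f 0 = nth_vderiv i g 0"] ..

text \<open>The Taylor polynomial whose derivatives at \<open>0\<close> are the entries of
  \<open>y\<close>. It is linear in \<open>y\<close> and polynomial in \<open>s\<close>, hence
  smooth in both together.\<close>

definition jet_poly :: "'e::real_normed_vector ^ 'k::{finite, linorder} \<Rightarrow> real \<Rightarrow> 'e" where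
  "jet_poly y s = (\<Sum>i\<in>UNIV. (s ^ jet_order i / fact (jet_order i)) *\<^sub>R (y $ i))"

lemma smooth_at_jet_poly:
  assumes "smooth_at p y" "smooth_at p s"
  shows "smooth_at p (\<lambda>x. jet_poly (y x) (s x))"
  unfolding jet_poly_def divide_inverse
  by (intro smooth_at_sum smooth_at_scaleR smooth_at_vec_nth assms
      smooth_at_linear_comp[OF bounded_linear_mult_left] smooth_at_power)

text \<open>The case distinction guards against truncated subtraction: for
  \<open>jet_order i < m\<close> the coefficient would otherwise be \<open>s ^ 0 / fact 0\<close>,
  which is \<open>1\<close>, although the derivative vanishes.\<close>

lemma nth_vderiv_jet_poly:
  "nth_vderiv m (jet_poly y) = (\<lambda>s. \<Sum>i\<in>UNIV. (if jet_order i < m then 0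
      else s ^ (jet_order i - m) / fact (jet_order i - m)) *\<^sub>R (y $ i))"
proof (induction m)
  case (Suc m)
  show ?case
  proof
    fix s
    have d: "((\<lambda>s. (if n < m then 0 else s ^ (n - m) / fact (n - m))) has_real_derivative
       (if n < Suc m then 0 else s ^ (n - Suc m) / fact (n - Suc m))) (at s)" for n
    proof (cases "n \<le> m")
      case False
      then obtain l where l: "n - m = Suc l" "n - Suc m = l" by (metis Suc_diff_Suc not_le)
      have "((\<lambda>s. s ^ Suc l / fact (Suc l)) has_real_derivative real (Suc l) * s ^ l / fact (Suc l)) (at s)"
        using DERIV_cdivide[OF DERIV_pow[of "Suc l" s], of "fact (Suc l)"] by simp
      moreover have "real (Suc l) * s ^ l / fact (Suc l) = s ^ l / fact l"
        by (simp add: divide_simps)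
      ultimately show ?thesis using False l by simp
    qed (cases "n = m"; simp)
    have "((\<lambda>s. \<Sum>i\<in>UNIV. (if jet_order i < m then 0
        else s ^ (jet_order i - m) / fact (jet_order i - m)) *\<^sub>R (y $ i)) has_vector_derivative
      (\<Sum>i\<in>UNIV. (if jet_order i < Suc m then 0
        else s ^ (jet_order i - Suc m) / fact (jet_order i - Suc m)) *\<^sub>R (y $ i))) (at s)"
    proof (rule has_vector_derivative_sum)
      fix i
      show "((\<lambda>s. (if jet_order i < m then 0
        else s ^ (jet_order i - m) / fact (jet_order i - m)) *\<^sub>R (y $ i)) has_vector_derivative
        (if jet_order i < Suc m then 0
        else s ^ (jet_order i - Suc m) / fact (jet_order i - Suc m)) *\<^sub>R (y $ i)) (at s)"
        using has_vector_derivative_scaleR[OF d[of "jet_order i"] has_vector_derivative_const[of "y $ i"]]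
        by simp
    qed
    then show "nth_vderiv (Suc m) (jet_poly y) s = (\<Sum>i\<in>UNIV. (if jet_order i < Suc m then 0
        else s ^ (jet_order i - Suc m) / fact (jet_order i - Suc m)) *\<^sub>R (y $ i))"
      unfolding nth_vderiv_Suc Suc by (rule vector_derivative_at)
  qed
qed (simp add: jet_poly_def fun_eq_iff)

text \<open>At \<open>0\<close> only the term whose order equals that of \<open>i\<close> survives:
  lower orders are cut off, higher ones carry a positive power of \<open>0\<close>, and
  \<open>0 ^ 0 = 1\<close>.\<close>

lemma nth_vderiv_jet_poly_0: "nth_vderiv (jet_order i) (jet_poly y) 0 = y $ i"
proof -
  have "(if jet_order j < jet_order i then 0
      else 0 ^ (jet_order j - jet_order i) / fact (jet_order j - jet_order i)) *\<^sub>R (y $ j)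
     = (if j = i then y $ j else 0)" for j
    using jet_order_less[of j i] jet_order_less[of i j] by (cases i j rule: linorder_cases) auto
  then show ?thesis unfolding nth_vderiv_jet_poly by simp
qed

section \<open>Equality of jets and the maps induced on them\<close>

lemma jet_mem: "smooth_near 0 A c \<Longrightarrow> c \<in> jet A k c"
  by (simp add: jet_def)

lemma jet_cong:
  assumes "\<forall>\<^sub>F t in nhds 0. c t = d t"
  shows "jet A k c = jet A k d"
proof -
  have "nth_vderiv i (\<phi> \<circ> c) 0 = nth_vderiv i (\<phi> \<circ> d) 0" for i and \<phi> :: "'a \<Rightarrow> 'b"
    by (rule nth_vderiv_cong) (use assms in eventually_elim, simp)
  then show ?thesis unfolding jet_def using eventually_nhds_x_imp_x[OF assms] by simp
qed

text \<open>The jet of a smooth curve contains that curve, so the choice in \<open>jet_rep\<close>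
  lands in the class. Later facts use the chosen curve only through these three properties.\<close>

lemma jet_rep_jet:
  assumes "smooth_near 0 A c"
  shows "smooth_near 0 A (jet_rep (jet A k c))" "jet_rep (jet A k c) 0 = c 0"
    "(D, \<phi>) \<in> A \<Longrightarrow> c 0 \<in> D \<Longrightarrow> agree k (\<lambda>t. \<phi> (jet_rep (jet A k c) t)) (\<lambda>t. \<phi> (c t))"
proof -
  have "jet_rep (jet A k c) \<in> jet A k c"
    unfolding jet_rep_def by (rule someI[of "\<lambda>d. d \<in> jet A k c", OF jet_mem[OF assms]])
  then show "smooth_near 0 A (jet_rep (jet A k c))" "jet_rep (jet A k c) 0 = c 0"
    "(D, \<phi>) \<in> A \<Longrightarrow> c 0 \<in> D \<Longrightarrow> agree k (\<lambda>t. \<phi> (jet_rep (jet A k c) t)) (\<lambda>t. \<phi> (c t))"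
    by (auto simp: jet_def agree_def o_def)
qed

lemma jet_base_jet: "smooth_near 0 A c \<Longrightarrow> jet_base (jet A k c) = c 0"
  by (simp add: jet_base_def jet_rep_jet)

lemma jet_coord_jet:
  assumes "smooth_near 0 A c" "(D, \<phi>) \<in> A" "c 0 \<in> D" "i \<le> k"
  shows "jet_coord \<phi> i (jet A k c) = nth_vderiv i (\<lambda>t. \<phi> (c t)) 0"
  using jet_rep_jet(3)[OF assms(1-3), where k = k] assms(4) by (simp add: jet_coord_def agree_def o_def)

text \<open>Read \<open>F\<close> in the charts \<open>\<phi>\<close> and \<open>\<psi>\<close> and
  apply \<open>agree_compose\<close>. Taking the identity for \<open>F\<close> compares two charts
  of one manifold.\<close>

lemma agree_map:
  assumes A: "smooth_atlas A" and c: "smooth_near 0 A c" and d: "smooth_near 0 A d"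
    and "c 0 = d 0" and D: "(D, \<phi>) \<in> A" "c 0 \<in> D"
    and "agree k (\<lambda>t. \<phi> (c t)) (\<lambda>t. \<phi> (d t))"
    and F: "smooth_map_at A B F (c 0)" and B: "smooth_atlas B" "(E, \<psi>) \<in> B" "F (c 0) \<in> E"
  shows "agree k (\<lambda>t. \<psi> (F (c t))) (\<lambda>t. \<psi> (F (d t)))"
proof -
  have inv: "inv_into D \<phi> (\<phi> p) = p" if "p \<in> D" for p by (rule smooth_atlasD(4)[OF A D(1) that])
  have "smooth_near (\<phi> (c 0)) B (\<lambda>y. F (inv_into D \<phi> y))"
    by (rule smooth_near_map[OF A _ smooth_near_inv_chart[OF A D(1)]]) (use F D inv in auto)
  then have f: "smooth_at (\<phi> (c 0)) (\<lambda>y. \<psi> (F (inv_into D \<phi> y)))"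
    by (rule smooth_near_chart(2)[OF B(1) _ B(2)]) (use B inv D in simp)
  note c' = smooth_near_chart[OF A c D] and d' = smooth_near_chart[OF A d D(1)]
  have "agree k (\<lambda>t. \<psi> (F (inv_into D \<phi> (\<phi> (c t))))) (\<lambda>t. \<psi> (F (inv_into D \<phi> (\<phi> (d t)))))"
    by (rule agree_compose[OF smooth_atlasD(1)[OF A] f c'(2) d'(2)]) (use assms in auto)
  then show ?thesis
  proof (rule agree_cong[rotated 2])
    show "\<forall>\<^sub>F t in nhds 0. \<psi> (F (c t)) = \<psi> (F (inv_into D \<phi> (\<phi> (c t))))"
      using c'(1) by eventually_elim (simp add: inv)
    show "\<forall>\<^sub>F t in nhds 0. \<psi> (F (d t)) = \<psi> (F (inv_into D \<phi> (\<phi> (d t))))"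
      using d'(1) assms(4) D(2) by (auto simp: inv elim!: eventually_mono)
  qed
qed

lemma smooth_map_at_ident:
  assumes A: "smooth_atlas A" and "p \<in> carrier A"
  shows "smooth_map_at A A (\<lambda>p. p) p"
proof -
  obtain D \<phi> where D: "(D, \<phi>) \<in> A" "p \<in> D" using assms(2) by (auto simp: carrier_def)
  then have "smooth_near (\<phi> p) A (inv_into D \<phi>)" by (intro smooth_near_inv_chart[OF A]) auto
  then show ?thesis unfolding smooth_map_at_def using D by auto
qed

text \<open>\<open>jet\<close> quantifies over all charts at the base point;
  \<open>agree_map\<close> for the identity spreads contact in one chart to all of them.\<close>

lemma jet_eq_iff:
  assumes A: "smooth_atlas A" and c: "smooth_near 0 A c" and d: "smooth_near 0 A d"
    and D: "(D, \<phi>) \<in> A" "c 0 \<in> D"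
  shows "jet A k c = jet A k d \<longleftrightarrow> c 0 = d 0 \<and> agree k (\<lambda>t. \<phi> (c t)) (\<lambda>t. \<phi> (d t))"
    (is "?L \<longleftrightarrow> ?R")
proof
  assume ?L
  then have "d \<in> jet A k c" using jet_mem[OF d] by simp
  then show ?R using D by (auto simp: jet_def agree_def o_def)
next
  assume R: ?R
  have "nth_vderiv i (\<psi> \<circ> c) 0 = nth_vderiv i (\<psi> \<circ> d) 0" if E: "(E, \<psi>) \<in> A" "c 0 \<in> E" "i \<le> k" for E \<psi> i
  proof -
    have "agree k (\<lambda>t. \<psi> (c t)) (\<lambda>t. \<psi> (d t))"
      by (rule agree_map[OF A c d _ D _ smooth_map_at_ident[OF A smooth_near_imp_carrier[OF c]] A E(1,2)])
         (use R in auto)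
    then show ?thesis using E(3) by (simp add: agree_def o_def)
  qed
  then show ?L unfolding jet_def using R by (auto; metis)
qed

text \<open>\<open>jet_map\<close> composes \<open>F\<close> with the chosen representative; since
  \<open>F\<close> preserves contact, any other smooth curve in the class gives the same
  jet.\<close>

lemma jet_map_jet:
  assumes A: "smooth_atlas A" and B: "smooth_atlas B" and c: "smooth_near 0 A c"
    and F: "smooth_map_at A B F (c 0)"
  shows "jet_map B k F (jet A k c) = jet B k (\<lambda>t. F (c t))"
proof -
  obtain D \<phi> where D: "(D, \<phi>) \<in> A" "c 0 \<in> D" using c by (rule smooth_near_obtain_chart)
  have Fc: "smooth_near 0 B (\<lambda>t. F (c t))" by (rule smooth_near_map[OF A F c])
  then obtain E \<psi> where E: "(E, \<psi>) \<in> B" "F (c 0) \<in> E" by (rule smooth_near_obtain_chart)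
  let ?r = "jet_rep (jet A k c)"
  note r = jet_rep_jet[OF c, where k = k]
  have Fr: "smooth_near 0 B (\<lambda>t. F (?r t))" by (rule smooth_near_map[OF A _ r(1)]) (simp add: r F)
  have "jet B k (\<lambda>t. F (?r t)) = jet B k (\<lambda>t. F (c t))"
    unfolding jet_eq_iff[OF B Fr Fc E(1), unfolded r(2), OF E(2)]
    using agree_map[OF A r(1) c r(2) D(1) _ r(3)[OF D] _ B E(1)] D F E by (simp add: r(2))
  then show ?thesis by (simp add: jet_map_def o_def)
qed

text \<open>The projections are treated directly in a product chart, where contact splits by the
  linear maps \<open>fst\<close> and \<open>snd\<close>. The product atlas thus enters only through
  \<open>smooth_near_prod\<close> and its product charts.\<close>

lemma jet_map_fst_snd:
  assumes A: "smooth_atlas A" and B: "smooth_atlas B" and c: "smooth_near 0 (prod_atlas A B) c"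
  shows "jet_map A k fst (jet (prod_atlas A B) k c) = jet A k (\<lambda>t. fst (c t))"
    "jet_map B k snd (jet (prod_atlas A B) k c) = jet B k (\<lambda>t. snd (c t))"
proof -
  let ?r = "jet_rep (jet (prod_atlas A B) k c)"
  note r = jet_rep_jet[OF c, where k = k]
  note rs = r(1)[unfolded smooth_near_prod] and cs = c[unfolded smooth_near_prod]
  obtain D \<phi> where D: "(D, \<phi>) \<in> A" "fst (c 0) \<in> D" using cs by (blast elim: smooth_near_obtain_chart)
  obtain E \<psi> where E: "(E, \<psi>) \<in> B" "snd (c 0) \<in> E" using cs by (blast elim: smooth_near_obtain_chart)
  have "(D \<times> E, map_prod \<phi> \<psi>) \<in> prod_atlas A B" "c 0 \<in> D \<times> E"
    using D E by (auto simp: prod_atlas_def mem_Times_iff)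
  from r(3)[OF this] have ag: "agree k (\<lambda>t. map_prod \<phi> \<psi> (?r t)) (\<lambda>t. map_prod \<phi> \<psi> (c t))" .
  have "smooth_at 0 (\<lambda>t. map_prod \<phi> \<psi> (b t))"
    if "smooth_near 0 A (\<lambda>t. fst (b t))" "smooth_near 0 B (\<lambda>t. snd (b t))" "b 0 = c 0" for b
    using smooth_at_Pair[OF smooth_near_chart(2)[OF A that(1) D(1)] smooth_near_chart(2)[OF B that(2) E(1)]]
      that(3) D E by (simp add: map_prod_def split_beta)
  note sm = this[of ?r] this[of c]
  have ags: "agree k (\<lambda>t. \<phi> (fst (?r t))) (\<lambda>t. \<phi> (fst (c t)))" "agree k (\<lambda>t. \<psi> (snd (?r t))) (\<lambda>t. \<psi> (snd (c t)))"
    using agree_linear[OF bounded_linear_fst _ _ ag] agree_linear[OF bounded_linear_snd _ _ ag] sm rs cs r(2)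
    by auto
  have "jet A k (\<lambda>t. fst (?r t)) = jet A k (\<lambda>t. fst (c t))"
    by (subst jet_eq_iff[OF A _ _ D(1)]) (use rs cs r(2) ags D in auto)
  then show "jet_map A k fst (jet (prod_atlas A B) k c) = jet A k (\<lambda>t. fst (c t))"
    by (simp add: jet_map_def o_def)
  have "jet B k (\<lambda>t. snd (?r t)) = jet B k (\<lambda>t. snd (c t))"
    by (subst jet_eq_iff[OF B _ _ E(1)]) (use rs cs r(2) ags E in auto)
  then show "jet_map B k snd (jet (prod_atlas A B) k c) = jet B k (\<lambda>t. snd (c t))"
    by (simp add: jet_map_def o_def)
qed

lemma jet_in_jets_over_iff:
  assumes "smooth_near 0 A c"
  shows "jet A k c \<in> jets_over A k U \<longleftrightarrow> c 0 \<in> U"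
proof
  assume "jet A k c \<in> jets_over A k U"
  then obtain d where d: "jet A k c = jet A k d" "smooth_near 0 A d" "d 0 \<in> U"
    unfolding jets_over_def by blast
  then show "c 0 \<in> U" using jet_base_jet[OF assms, of k] jet_base_jet[OF d(2), of k] by simp
qed (use assms in \<open>auto simp: jets_over_def\<close>)

lemma jets_overE:
  assumes "z \<in> jets_over A k U"
  obtains c where "smooth_near 0 A c" "c 0 \<in> U" "z = jet A k c"
  using assms unfolding jets_over_def by blast

section \<open>Induced charts and jets of smooth families\<close>

lemma jet_chart_jet:
  assumes K: "CARD('k) = k + 1"
    and "smooth_near 0 A c" "(D, \<phi>) \<in> A" "c 0 \<in> D"
  shows "(jet_chart \<phi> (jet A k c) :: 'e::real_normed_vector ^ 'k::{finite, linorder}) $ i = nth_vderiv (jet_order i) (\<lambda>t. \<phi> (c t)) 0"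
  using jet_coord_jet[OF assms(2-4) jet_order_le[OF K]] by (simp add: jet_chart_def)

lemma smooth_near_slice:
  fixes c :: "'x::real_inner \<times> 'y::real_inner \<Rightarrow> 'a"
  assumes "finite_dim TYPE('x)" "finite_dim TYPE('y)" "smooth_near (x, s) A c"
  shows "smooth_near s A (\<lambda>s. c (x, s))" "smooth_near x A (\<lambda>x. c (x, s))"
  using smooth_near_compose[OF finite_dim_prod[OF assms(1,2)], of "\<lambda>s. (x, s)" s A c]
    smooth_near_compose[OF finite_dim_prod[OF assms(1,2)], of "\<lambda>x. (x, s)" x A c] assms(3)
    smooth_at_Pair[OF smooth_at_const smooth_at_ident, of s x]
    smooth_at_Pair[OF smooth_at_ident smooth_at_const, of x s]
  by auto

text \<open>The coordinates of the jet at \<open>y\<close> are \<open>s\<close>-derivatives at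
  \<open>0\<close> of \<open>\<phi> (c (y, s))\<close>, and these depend smoothly on
  \<open>y\<close> by \<open>smooth_at_param_nth\<close>. The formula has to hold for all
  \<open>y\<close> near \<open>x\<close> before smoothness can be transferred.\<close>

lemma jet_family_chart:
  fixes c :: "'x::real_inner \<times> real \<Rightarrow> 'a"
  assumes A: "smooth_atlas (A :: ('a, 'e::real_inner) atlas)" and K: "CARD('k) = k + 1"
    and X: "finite_dim TYPE('x)" and c: "smooth_near (x, 0) A c" and D: "(D, \<phi>) \<in> A" "c (x, 0) \<in> D"
  shows "\<forall>\<^sub>F y in nhds x. smooth_near 0 A (\<lambda>s. c (y, s)) \<and> c (y, 0) \<in> D \<and>
          (\<forall>i. (jet_chart \<phi> (jet A k (\<lambda>s. c (y, s))) :: 'e ^ 'k::{finite, linorder}) $ i = nth_vderiv (jet_order i) (\<lambda>s. \<phi> (c (y, s))) 0)"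
    and "smooth_at x (\<lambda>y. jet_chart \<phi> (jet A k (\<lambda>s. c (y, s))) :: 'e ^ 'k::{finite, linorder})"
proof -
  have c0: "smooth_near x A (\<lambda>y. c (y, 0))" by (rule smooth_near_slice[OF X finite_dim_real c])
  have "\<forall>\<^sub>F y in nhds x. smooth_near (y, 0) A c"
    by (rule smooth_at_eventually_comp[where P = "\<lambda>q. smooth_near q A c"])
       (use smooth_near_eventually[OF c] in \<open>auto intro!: smooth_at_Pair\<close>)
  with smooth_near_chart(1)[OF A c0 D]
  show ev: "\<forall>\<^sub>F y in nhds x. smooth_near 0 A (\<lambda>s. c (y, s)) \<and> c (y, 0) \<in> D \<and>
          (\<forall>i. (jet_chart \<phi> (jet A k (\<lambda>s. c (y, s))) :: ('e, 'k) vec) $ i = nth_vderiv (jet_order i) (\<lambda>s. \<phi> (c (y, s))) 0)"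
  proof eventually_elim
    case (elim y)
    then show ?case
      using smooth_near_slice(1)[OF X finite_dim_real elim(2)] jet_chart_jet[OF K _ D(1), of "\<lambda>s. c (y, s)"]
      by simp
  qed
  show "smooth_at x (\<lambda>y. jet_chart \<phi> (jet A k (\<lambda>s. c (y, s))) :: ('e, 'k) vec)"
  proof (rule smooth_at_vec_lambda)
    fix i :: 'k
    have "smooth_at (x, 0) (\<lambda>q. \<phi> (c q))" by (rule smooth_near_chart(2)[OF A c D])
    then have "smooth_at x (\<lambda>y. nth_vderiv (jet_order i) (\<lambda>s. \<phi> (c (y, s))) 0)"
      by (rule smooth_at_param_nth[OF X])
    then show "smooth_at x (\<lambda>y. (jet_chart \<phi> (jet A k (\<lambda>s. c (y, s))) :: ('e, 'k) vec) $ i)"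
      by (rule smooth_at_cong) (use ev in eventually_elim, simp)
  qed
qed

lemma jet_atlas_chart: "(D, \<phi>) \<in> A \<Longrightarrow> (jets_over A k D, jet_chart \<phi>) \<in> jet_atlas k A"
  unfolding jet_atlas_def by blast

lemma jet_family:
  fixes c :: "'x::real_inner \<times> real \<Rightarrow> 'a"
  assumes A: "smooth_atlas (A :: ('a, 'e::real_inner) atlas)" and K: "CARD('k) = k + 1"
    and X: "finite_dim TYPE('x)" and c: "smooth_near (x, 0) A c"
  shows "smooth_near x (jet_atlas k A :: ('a jet, 'e ^ 'k::{finite, linorder}) atlas) (\<lambda>y. jet A k (\<lambda>s. c (y, s)))"
proof -
  obtain D \<phi> where D: "(D, \<phi>) \<in> A" "c (x, 0) \<in> D" using c by (rule smooth_near_obtain_chart)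
  note f = jet_family_chart[OF A K X c D]
  show ?thesis
    by (rule smooth_nearI[OF jet_atlas_chart[OF D(1)] _ f(2)])
       (use f(1) in eventually_elim, simp add: jet_in_jets_over_iff)
qed

text \<open>The standard representative: a Taylor polynomial read back through the chart. Where the
  polynomial leaves the image of \<open>D\<close> the value of \<open>inv_into\<close> is arbitrary,
  so it is used only near parameters at which the polynomial lies in that image.\<close>

definition poly_curve :: "('a \<Rightarrow> 'e::real_normed_vector) \<Rightarrow> 'a set \<Rightarrow> 'e ^ 'k::{finite, linorder} \<Rightarrow> real \<Rightarrow> 'a" where
  "poly_curve \<phi> D y s = inv_into D \<phi> (jet_poly y s)"

lemma smooth_near_poly_curve:
  assumes A: "smooth_atlas A" and D: "(D, \<phi>) \<in> A" "jet_poly (y x) (s x) \<in> \<phi> ` D"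
    and "smooth_at x y" "smooth_at x s"
  shows "smooth_near x A (\<lambda>x. poly_curve \<phi> D (y x) (s x))"
  unfolding poly_curve_def
  by (rule smooth_near_compose[OF smooth_atlasD(1)[OF A] smooth_near_inv_chart[OF A D]
        smooth_at_jet_poly[OF assms(4,5)]])

lemma jet_poly_curve:
  fixes y :: "'e::real_inner ^ 'k::{finite, linorder}"
  assumes A: "smooth_atlas A" and K: "CARD('k) = k + 1" and D: "(D, \<phi>) \<in> A" "jet_poly y 0 \<in> \<phi> ` D"
  shows "smooth_near 0 A (poly_curve \<phi> D y)" "poly_curve \<phi> D y 0 \<in> D"
    "\<phi> (poly_curve \<phi> D y 0) = jet_poly y 0"
    "jet_chart \<phi> (jet A k (poly_curve \<phi> D y)) = y"
proof -
  show c: "smooth_near 0 A (poly_curve \<phi> D y)"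
    using smooth_near_poly_curve[OF A D(1), of "\<lambda>_. y" 0 "\<lambda>s. s"] D(2) by simp
  show D0: "poly_curve \<phi> D y 0 \<in> D" unfolding poly_curve_def using D(2) by (rule inv_into_into)
  show "\<phi> (poly_curve \<phi> D y 0) = jet_poly y 0" unfolding poly_curve_def using D(2) by (rule f_inv_into_f)
  have "\<forall>\<^sub>F s in nhds 0. jet_poly y s \<in> \<phi> ` D"
  proof (rule smooth_at_eventually_comp[where P = "\<lambda>z. z \<in> \<phi> ` D"])
    show "smooth_at 0 (jet_poly y)" by (intro smooth_at_jet_poly) auto
    show "\<forall>\<^sub>F z in nhds (jet_poly y 0). z \<in> \<phi> ` D"
      using smooth_atlasD(3)[OF A D(1)] D(2) by (rule eventually_nhds_in_open)
  qed
  then have "\<forall>\<^sub>F s in nhds 0. \<phi> (poly_curve \<phi> D y s) = jet_poly y s"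
    by eventually_elim (simp add: poly_curve_def f_inv_into_f)
  then show "jet_chart \<phi> (jet A k (poly_curve \<phi> D y)) = y"
    using jet_chart_jet[OF K c D(1) D0] by (simp add: vec_eq_iff nth_vderiv_cong nth_vderiv_jet_poly_0)
qed

lemma jet_chart_eq_iff:
  assumes A: "smooth_atlas (A :: ('a, 'e::real_inner) atlas)" and K: "CARD('k) = k + 1"
    and D: "(D, \<phi>) \<in> A" and z: "z \<in> jets_over A k D" "w \<in> jets_over A k D"
  shows "(jet_chart \<phi> z :: 'e ^ 'k::{finite, linorder}) = jet_chart \<phi> w \<longleftrightarrow> z = w"
proof
  obtain c where c: "smooth_near 0 A c" "c 0 \<in> D" "z = jet A k c" using z(1) by (rule jets_overE)
  obtain d where d: "smooth_near 0 A d" "d 0 \<in> D" "w = jet A k d" using z(2) by (rule jets_overE)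
  assume "(jet_chart \<phi> z :: ('e, 'k) vec) = jet_chart \<phi> w"
  then have ag: "agree k (\<lambda>t. \<phi> (c t)) (\<lambda>t. \<phi> (d t))"
    unfolding c(3) d(3) agree_iff_jet_order[OF K] vec_eq_iff
    using jet_chart_jet[OF K c(1) D c(2)] jet_chart_jet[OF K d(1) D d(2)] by simp
  then have "\<phi> (c 0) = \<phi> (d 0)" unfolding agree_def by (metis nth_vderiv_0 zero_le)
  then have "c 0 = d 0" using smooth_atlasD(2)[OF A D] c d by (auto simp: inj_on_def)
  then show "z = w" unfolding c(3) d(3) jet_eq_iff[OF A c(1) d(1) D c(2)] using ag by simp
qed simp

lemma jet_poly_jet_chart:
  fixes A :: "('a, 'e::real_inner) atlas"
  assumes K: "CARD('k) = k + 1"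
    and c: "smooth_near 0 A c" "(D, \<phi>) \<in> A" "c 0 \<in> D"
  shows "jet_poly (jet_chart \<phi> (jet A k c) :: 'e ^ 'k::{finite, linorder}) 0 = \<phi> (c 0)"
proof -
  obtain i :: 'k where i: "jet_order i = 0" using jet_order_surj[OF K, of 0] by auto
  have "jet_poly (y :: ('e, 'k) vec) 0 = y $ i" for y
    using nth_vderiv_jet_poly_0[of i y] i by simp
  then show ?thesis using jet_chart_jet[OF K c] i by simp
qed

text \<open>Inverts the induced chart explicitly: \<open>poly_curve\<close> of the coordinates has
  the same coordinates as \<open>z\<close> by \<open>jet_poly_curve\<close>, and these determine a
  jet over \<open>D\<close>.\<close>

lemma jet_of_jet_chart:
  fixes A :: "('a, 'e::real_inner) atlas"
  assumes A: "smooth_atlas A" and K: "CARD('k) = k + 1"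
    and D: "(D, \<phi>) \<in> A" and z: "z \<in> jets_over A k D"
  shows "jet_poly (jet_chart \<phi> z :: 'e ^ 'k::{finite, linorder}) 0 \<in> \<phi> ` D"
    "z = jet A k (poly_curve \<phi> D (jet_chart \<phi> z :: 'e ^ 'k::{finite, linorder}))"
proof -
  obtain c where c: "smooth_near 0 A c" "c 0 \<in> D" "z = jet A k c" using z by (rule jets_overE)
  show p: "jet_poly (jet_chart \<phi> z :: ('e, 'k) vec) 0 \<in> \<phi> ` D"
    unfolding c(3) jet_poly_jet_chart[OF K c(1) D c(2)] using c(2) by simp
  note * = jet_poly_curve[OF A K D p]
  have "jet A k (poly_curve \<phi> D (jet_chart \<phi> z :: ('e, 'k) vec)) \<in> jets_over A k D"
    using *(1,2) by (simp add: jet_in_jets_over_iff)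
  from jet_chart_eq_iff[OF A K D z this] *(4)
  show "z = jet A k (poly_curve \<phi> D (jet_chart \<phi> z :: ('e, 'k) vec))" by simp
qed

text \<open>Only the constant term is constrained, because the higher derivatives of a curve can be
  prescribed freely. Openness of the image therefore reduces to continuity of
  \<open>jet_poly y 0\<close> in \<open>y\<close>.\<close>

lemma jet_chart_image:
  fixes A :: "('a, 'e::real_inner) atlas"
  assumes A: "smooth_atlas A" and K: "CARD('k) = k + 1" and D: "(D, \<phi>) \<in> A" "U \<subseteq> D"
  shows "jet_chart \<phi> ` jets_over A k U = {y :: 'e ^ 'k::{finite, linorder}. jet_poly y 0 \<in> \<phi> ` U}" (is "?L = ?R")
proof
  show "?L \<subseteq> ?R"
  proof
    fix y assume "y \<in> ?L"
    then obtain c where c: "smooth_near 0 A c" "c 0 \<in> U" "y = jet_chart \<phi> (jet A k c)"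
      by (auto elim: jets_overE)
    have "c 0 \<in> D" using c D by auto
    from jet_poly_jet_chart[OF K c(1) D(1) this] show "y \<in> ?R" using c by simp
  qed
  show "?R \<subseteq> ?L"
  proof
    fix y assume "y \<in> ?R"
    then have y: "jet_poly y 0 \<in> \<phi> ` U" by simp
    then have "jet_poly y 0 \<in> \<phi> ` D" using D by auto
    note * = jet_poly_curve[OF A K D(1) this]
    obtain u where u: "u \<in> U" "jet_poly y 0 = \<phi> u" using y by blast
    then have "poly_curve \<phi> D y 0 = u"
      using inj_onD[OF smooth_atlasD(2)[OF A D(1)], of "poly_curve \<phi> D y 0" u] *(2,3) D(2) by auto
    then have "poly_curve \<phi> D y 0 \<in> U" using u by simp
    then show "y \<in> ?L" using *(1,4) jet_in_jets_over_iff by (metis imageI)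
  qed
qed

text \<open>One inclusion is monotonicity; the other holds because a jet determines its base point,
  so a single curve serves for both memberships.\<close>

lemma jets_over_Int: "jets_over A k (U \<inter> V) = jets_over A k U \<inter> jets_over A k V"
proof
  show "jets_over A k U \<inter> jets_over A k V \<subseteq> jets_over A k (U \<inter> V)"
  proof
    fix z assume z: "z \<in> jets_over A k U \<inter> jets_over A k V"
    then obtain c where "smooth_near 0 A c" "z = jet A k c" by (auto elim: jets_overE)
    then show "z \<in> jets_over A k (U \<inter> V)" using z by (simp add: jet_in_jets_over_iff)
  qed
qed (auto simp: jets_over_def)

text \<open>The transition map sends \<open>y\<close> to the \<open>\<psi>\<close>-coordinates of
  the jet of \<open>poly_curve \<phi> D y\<close>. This is the jet of a smooth family with parameter
  \<open>y\<close>, so \<open>jet_family_chart\<close> gives smoothness.\<close>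

lemma smooth_atlas_jet_atlas:
  assumes A: "smooth_atlas (A :: ('a, 'e::real_inner) atlas)" and K: "CARD('k) = k + 1"
  shows "smooth_atlas (jet_atlas k A :: ('a jet, 'e ^ 'k::{finite, linorder}) atlas)"
proof -
  have op: "open {y :: ('e, 'k) vec. jet_poly y 0 \<in> V}" if "open V" for V
  proof -
    have "isCont (\<lambda>y :: ('e, 'k) vec. jet_poly y 0) y" for y
      by (intro smooth_at_isCont smooth_at_jet_poly) auto
    then have "open ((\<lambda>y :: ('e, 'k) vec. jet_poly y 0) -` V)"
      using that by (intro open_vimage continuous_at_imp_continuous_on) auto
    then show ?thesis by (simp add: vimage_def)
  qed
  have inj: "inj_on (jet_chart \<phi> :: _ \<Rightarrow> ('e, 'k) vec) (jets_over A k D)" if "(D, \<phi>) \<in> A" for D \<phi>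
    using jet_chart_eq_iff[OF A K that] by (auto simp: inj_on_def)
  have image: "jet_chart \<phi> ` (jets_over A k D \<inter> jets_over A k E) = {y :: ('e, 'k) vec. jet_poly y 0 \<in> \<phi> ` (D \<inter> E)}"
    if "(D, \<phi>) \<in> A" for D \<phi> E
    unfolding jets_over_Int[symmetric] by (rule jet_chart_image[OF A K that]) simp
  have smooth: "smooth_on (jet_chart \<phi> ` (jets_over A k D \<inter> jets_over A k E))
      ((jet_chart \<psi> :: _ \<Rightarrow> ('e, 'k) vec) \<circ> inv_into (jets_over A k D) (jet_chart \<phi> :: _ \<Rightarrow> ('e, 'k) vec))"
    if D: "(D, \<phi>) \<in> A" and E: "(E, \<psi>) \<in> A" for D \<phi> E \<psi>
    unfolding image[OF D] o_def
  proof (rule smooth_onI_smooth_at)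
    fix y :: "('e, 'k) vec" assume "y \<in> {y. jet_poly y 0 \<in> \<phi> ` (D \<inter> E)}"
    then have y: "jet_poly y 0 \<in> \<phi> ` D" "jet_poly y 0 \<in> \<phi> ` (D \<inter> E)" by auto
    let ?c = "\<lambda>q. poly_curve \<phi> D (fst q :: ('e, 'k) vec) (snd q)"
    note p = jet_poly_curve[OF A K D y(1)]
    obtain u where u: "u \<in> D" "u \<in> E" "jet_poly y 0 = \<phi> u" using y(2) by blast
    then have yE: "poly_curve \<phi> D y 0 \<in> E"
      using inj_onD[OF smooth_atlasD(2)[OF A D], of "poly_curve \<phi> D y 0" u] p(2,3) by auto
    have "smooth_near (y, 0) A ?c"
      by (rule smooth_near_poly_curve[OF A D]) (use y in \<open>auto intro: smooth_at_fst smooth_at_snd\<close>)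
    then have "smooth_at y (\<lambda>x. jet_chart \<psi> (jet A k (\<lambda>s. ?c (x, s))) :: ('e, 'k) vec)"
      by (rule jet_family_chart(2)[OF A K finite_dim_vec[OF smooth_atlasD(1)[OF A]] _ E]) (simp add: yE)
    then show "smooth_at y (\<lambda>x. (jet_chart \<psi> :: _ \<Rightarrow> ('e, 'k) vec) (inv_into (jets_over A k D) (jet_chart \<phi>) x))"
    proof (rule smooth_at_cong)
      have "\<forall>\<^sub>F x in nhds y. x \<in> {y. jet_poly y 0 \<in> \<phi> ` D}"
        using op smooth_atlasD(3)[OF A D] y by (intro eventually_nhds_in_open) auto
      then show "\<forall>\<^sub>F x in nhds y. jet_chart \<psi> (jet A k (\<lambda>s. ?c (x, s)))
          = (jet_chart \<psi> :: _ \<Rightarrow> ('e, 'k) vec) (inv_into (jets_over A k D) (jet_chart \<phi>) x)"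
      proof eventually_elim
        case (elim x)
        then have x: "jet_poly x 0 \<in> \<phi> ` D" by simp
        note p = jet_poly_curve[OF A K D x]
        have "jet A k (poly_curve \<phi> D x) \<in> jets_over A k D" using p by (simp add: jet_in_jets_over_iff)
        from inv_into_f_f[OF inj[OF D] this] p(4)
        have "inv_into (jets_over A k D) (jet_chart \<phi>) x = jet A k (poly_curve \<phi> D x)" by simp
        then show ?case by simp
      qed
    qed
  qed
  have "finite_dim TYPE(('e, 'k) vec)" by (rule finite_dim_vec[OF smooth_atlasD(1)[OF A]])
  then show ?thesis
    unfolding smooth_atlas_def
  proof (intro conjI ballI)
    fix a assume "a \<in> (jet_atlas k A :: ('a jet, ('e, 'k) vec) atlas)"
    then obtain D \<phi> where D: "(D, \<phi>) \<in> A" "a = (jets_over A k D, jet_chart \<phi>)"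
      unfolding jet_atlas_def by blast
    show "case a of (D, \<phi>) \<Rightarrow> inj_on \<phi> D \<and> open (\<phi> ` D)"
      using inj[OF D(1)] image[OF D(1), of D] op smooth_atlasD(3)[OF A D(1)] by (simp add: D(2))
    have "case b of (E, \<psi>) \<Rightarrow> open ((jet_chart \<phi> :: _ \<Rightarrow> ('e, 'k) vec) ` (jets_over A k D \<inter> E)) \<and>
        smooth_on ((jet_chart \<phi> :: _ \<Rightarrow> ('e, 'k) vec) ` (jets_over A k D \<inter> E))
          (\<psi> \<circ> inv_into (jets_over A k D) (jet_chart \<phi> :: _ \<Rightarrow> ('e, 'k) vec))"
      if "b \<in> (jet_atlas k A :: ('a jet, ('e, 'k) vec) atlas)" for b
    proof -
      obtain E \<psi> where E: "(E, \<psi>) \<in> A" "b = (jets_over A k E, jet_chart \<psi>)"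
        using \<open>b \<in> _\<close> unfolding jet_atlas_def by blast
      show ?thesis
        using smooth[OF D(1) E(1)] image[OF D(1), of E] op smooth_atlasD(5)[OF A D(1) E(1)]
        by (simp add: E(2))
    qed
    then show "case a of (D, \<phi>) \<Rightarrow> \<forall>(E, \<psi>)\<in>(jet_atlas k A :: ('a jet, ('e, 'k) vec) atlas).
        open (\<phi> ` (D \<inter> E)) \<and> smooth_on (\<phi> ` (D \<inter> E)) (\<psi> \<circ> inv_into D \<phi>)"
      unfolding D(2) by simp
  qed
qed

text \<open>Together with \<open>jet_family\<close>: smooth maps into a jet manifold are exactly the maps that arise from
  smooth families of curves. This replaces computations in jet coordinates below.\<close>

lemma jet_family_lift:
  fixes g :: "'x::real_inner \<Rightarrow> 'a jet"
  assumes A: "smooth_atlas (A :: ('a, 'e::real_inner) atlas)" and K: "CARD('k) = k + 1"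
    and X: "finite_dim TYPE('x)" and g: "smooth_near x (jet_atlas k A :: ('a jet, 'e ^ 'k::{finite, linorder}) atlas) g"
  obtains c where "smooth_near (x, 0) A c" "\<forall>\<^sub>F y in nhds x. g y = jet A k (\<lambda>s. c (y, s))"
proof -
  obtain D \<phi> where D: "(D, \<phi>) \<in> A" "g x \<in> jets_over A k D" "\<forall>\<^sub>F y in nhds x. g y \<in> jets_over A k D"
    and sm: "smooth_at x (\<lambda>y. jet_chart \<phi> (g y) :: ('e, 'k) vec)"
    by (rule smooth_near_obtain_chart[OF g]) (auto simp: jet_atlas_def)
  let ?c = "\<lambda>q. poly_curve \<phi> D (jet_chart \<phi> (g (fst q)) :: ('e, 'k) vec) (snd q)"
  show thesis
  proof (rule that[of ?c])
    show "smooth_near (x, 0) A ?c"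
    proof (rule smooth_near_poly_curve[OF A D(1)])
      show "jet_poly (jet_chart \<phi> (g (fst (x, 0))) :: ('e, 'k) vec) (snd (x, 0)) \<in> \<phi> ` D"
        using jet_of_jet_chart(1)[OF A K D(1,2)] by simp
      show "smooth_at (x, 0) (\<lambda>q. jet_chart \<phi> (g (fst q)) :: ('e, 'k) vec)"
        by (rule smooth_at_compose[OF X]) (use sm in \<open>auto intro: smooth_at_fst\<close>)
    qed (auto intro: smooth_at_snd)
    show "\<forall>\<^sub>F y in nhds x. g y = jet A k (\<lambda>s. ?c (y, s))"
      using D(3) by eventually_elim (use jet_of_jet_chart(2)[OF A K D(1)] in simp)
  qed
qed

declare One_nat_def [simp del]

lemma carrier_jet_atlas: "carrier (jet_atlas k A) = jets_over A k (carrier A)"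
proof
  show "jets_over A k (carrier A) \<subseteq> carrier (jet_atlas k A)"
  proof
    fix z assume "z \<in> jets_over A k (carrier A)"
    then obtain c D \<phi> where "smooth_near 0 A c" "z = jet A k c" "c 0 \<in> D" and D: "(D, \<phi>) \<in> A"
      unfolding carrier_def by (auto elim!: jets_overE)
    then have "z \<in> jets_over A k D" by (auto simp: jets_over_def)
    then show "z \<in> carrier (jet_atlas k A)" using D by (auto simp: carrier_def jet_atlas_def)
  qed
qed (auto simp: carrier_def jet_atlas_def jets_over_def)

lemma eventually_smooth_near_slice:
  fixes c :: "'x::real_inner \<times> 'y::real_inner \<Rightarrow> 'a"
  assumes "finite_dim TYPE('x)" "finite_dim TYPE('y)" "smooth_near (x, s) A c"
  shows "\<forall>\<^sub>F y in nhds x. smooth_near s A (\<lambda>s. c (y, s))"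
    "\<forall>\<^sub>F r in nhds s. smooth_near x A (\<lambda>x. c (x, r))"
proof -
  note ev = smooth_near_eventually[OF assms(3)]
  have "\<forall>\<^sub>F y in nhds x. smooth_near (y, s) A c"
    by (rule smooth_at_eventually_comp[where P = "\<lambda>q. smooth_near q A c"])
       (use ev in \<open>auto intro!: smooth_at_Pair\<close>)
  then show "\<forall>\<^sub>F y in nhds x. smooth_near s A (\<lambda>s. c (y, s))"
    by eventually_elim (rule smooth_near_slice(1)[OF assms(1,2)])
  show "\<forall>\<^sub>F r in nhds s. smooth_near x A (\<lambda>x. c (x, r))"
    using eventually_nhds_PairD(2)[OF ev] by eventually_elim (rule smooth_near_slice(2)[OF assms(1,2)])
qed

text \<open>It suffices to test \<open>F\<close> on germs from the model space, as the inverse chart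
  is one of them. Combined with \<open>jet_family_lift\<close> this replaces a map on jets by a map
  on families.\<close>

lemma smooth_map_atI:
  fixes A :: "('a, 'e::real_inner) atlas"
  assumes A: "smooth_atlas A" and p: "p \<in> carrier A"
    and F: "\<And>x g. smooth_near (x :: 'e) A g \<Longrightarrow> g x = p \<Longrightarrow> smooth_near x B (\<lambda>y. F (g y))"
  shows "smooth_map_at A B F p"
proof -
  obtain D \<phi> where D: "(D, \<phi>) \<in> A" "p \<in> D" using p by (auto simp: carrier_def)
  have "smooth_near (\<phi> p) A (inv_into D \<phi>)" using D by (intro smooth_near_inv_chart[OF A]) auto
  from F[OF this smooth_atlasD(4)[OF A D]] show ?thesis unfolding smooth_map_at_def using D by blast
qed

text \<open>Locally the inverse induced chart is the jet of a family \<open>c (y, s)\<close>; the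
  base points \<open>c (y, 0)\<close> vary continuously with \<open>y\<close> and so stay in
  \<open>U\<close>.\<close>

lemma man_open_jets_over:
  fixes A :: "('a, 'e::real_inner) atlas"
  assumes A: "smooth_atlas A" and K: "CARD('k) = k + 1" and U: "man_open A U"
  shows "man_open (jet_atlas k A :: ('a jet, 'e ^ 'k::{finite, linorder}) atlas) (jets_over A k U)"
proof (rule man_openI[OF smooth_atlas_jet_atlas[OF A K]])
  let ?J = "jet_atlas k A :: ('a jet, ('e, 'k) vec) atlas"
  fix z assume z: "z \<in> jets_over A k U"
  have "U \<subseteq> carrier A" using U by (simp add: man_open_def)
  then have "z \<in> carrier ?J" using z unfolding carrier_jet_atlas jets_over_def by auto
  then obtain D \<phi> where D: "(D, \<phi>) \<in> ?J" "z \<in> D" unfolding carrier_def by auto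
  note J = smooth_atlas_jet_atlas[OF A K]
  have fd: "finite_dim TYPE(('e, 'k) vec)" by (rule smooth_atlasD(1)[OF J])
  have iz: "inv_into D \<phi> (\<phi> z) = z" by (rule smooth_atlasD(4)[OF J D])
  have "smooth_near (\<phi> z) ?J (inv_into D \<phi>)" using D by (intro smooth_near_inv_chart[OF J]) auto
  then obtain c where c: "smooth_near (\<phi> z, 0) A c"
      "\<forall>\<^sub>F y in nhds (\<phi> z). inv_into D \<phi> y = jet A k (\<lambda>s. c (y, s))"
    by (rule jet_family_lift[OF A K fd])
  have "z = jet A k (\<lambda>s. c (\<phi> z, s))" using eventually_nhds_x_imp_x[OF c(2)] iz by simp
  then have "c (\<phi> z, 0) \<in> U"
    using z jet_in_jets_over_iff[OF smooth_near_slice(1)[OF fd finite_dim_real c(1)], of k U] by metis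
  from man_open_smooth_near[OF A U smooth_near_slice(2)[OF fd finite_dim_real c(1)] this]
    eventually_smooth_near_slice(1)[OF fd finite_dim_real c(1)] c(2)
  have "\<forall>\<^sub>F y in nhds (\<phi> z). inv_into D \<phi> y \<in> jets_over A k U"
    by eventually_elim (simp add: jet_in_jets_over_iff)
  then show "\<exists>(D, \<phi>)\<in>?J. z \<in> D \<and> (\<forall>\<^sub>F y in nhds (\<phi> z). inv_into D \<phi> y \<in> jets_over A k U)"
    using D by auto
qed

section \<open>Jets of families and the canonical identification\<close>

lemma nth_vderiv_jet_chart_family:
  fixes A :: "('a, 'e::real_inner) atlas" and c :: "real \<times> real \<Rightarrow> 'a"
  assumes A: "smooth_atlas A" and K: "CARD('k) = k + 1"
    and c: "smooth_near (0, 0) A c" and D: "(D, \<phi>) \<in> A" "c (0, 0) \<in> D"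
  shows "nth_vderiv m (\<lambda>t. jet_chart \<phi> (jet A k (\<lambda>s. c (t, s))) :: 'e ^ 'k::{finite, linorder}) 0 $ i
     = nth_vderiv m (\<lambda>t. nth_vderiv (jet_order i) (\<lambda>s. \<phi> (c (t, s))) 0) 0"
proof -
  note f = jet_family_chart[OF A K finite_dim_real c D]
  have "nth_vderiv m (\<lambda>t. jet_chart \<phi> (jet A k (\<lambda>s. c (t, s))) :: ('e, 'k) vec) 0 $ i
     = nth_vderiv m (\<lambda>t. (jet_chart \<phi> (jet A k (\<lambda>s. c (t, s))) :: ('e, 'k) vec) $ i) 0"
    by (rule nth_vderiv_linear_comp[OF bounded_linear_vec_nth f(2), symmetric])
  also have "\<dots> = nth_vderiv m (\<lambda>t. nth_vderiv (jet_order i) (\<lambda>s. \<phi> (c (t, s))) 0) 0"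
    by (rule nth_vderiv_cong) (use f(1) in eventually_elim, simp)
  finally show ?thesis .
qed

text \<open>A jet of jets is described by mixed derivatives of \<open>\<phi> (c (t, s))\<close>
  alone, so that both parameters play the same kind of role. The exchange of parameters in
  \<open>canon_Phi\<close> is checked in this form.\<close>

lemma jet_jet_eq_iff:
  fixes A :: "('a, 'e::real_inner) atlas" and c d :: "real \<times> real \<Rightarrow> 'a"
  assumes A: "smooth_atlas A" and K: "CARD('k) = k + 1"
    and c: "smooth_near (0, 0) A c" and d: "smooth_near (0, 0) A d"
    and D: "(D, \<phi>) \<in> A" "c (0, 0) \<in> D"
  shows "jet (jet_atlas k A :: ('a jet, 'e ^ 'k::{finite, linorder}) atlas) m (\<lambda>t. jet A k (\<lambda>s. c (t, s)))
       = jet (jet_atlas k A :: ('a jet, 'e ^ 'k::{finite, linorder}) atlas) m (\<lambda>t. jet A k (\<lambda>s. d (t, s)))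
     \<longleftrightarrow> c (0, 0) = d (0, 0) \<and> (\<forall>i\<le>m. \<forall>j\<le>k.
        nth_vderiv i (\<lambda>t. nth_vderiv j (\<lambda>s. \<phi> (c (t, s))) 0) 0
      = nth_vderiv i (\<lambda>t. nth_vderiv j (\<lambda>s. \<phi> (d (t, s))) 0) 0)" (is "?L \<longleftrightarrow> ?R")
proof (cases "c (0, 0) = d (0, 0)")
  case True
  note slice = smooth_near_slice[OF finite_dim_real finite_dim_real]
  have "?L \<longleftrightarrow> jet A k (\<lambda>s. c (0, s)) = jet A k (\<lambda>s. d (0, s)) \<and>
     agree m (\<lambda>t. jet_chart \<phi> (jet A k (\<lambda>s. c (t, s))) :: ('e, 'k) vec) (\<lambda>t. jet_chart \<phi> (jet A k (\<lambda>s. d (t, s))))"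
    by (rule jet_eq_iff[OF smooth_atlas_jet_atlas[OF A K] jet_family[OF A K finite_dim_real c]
          jet_family[OF A K finite_dim_real d] jet_atlas_chart[OF D(1)]])
       (use D slice(1)[OF c] in \<open>simp add: jet_in_jets_over_iff\<close>)
  also have "jet A k (\<lambda>s. c (0, s)) = jet A k (\<lambda>s. d (0, s)) \<longleftrightarrow>
      agree k (\<lambda>s. \<phi> (c (0, s))) (\<lambda>s. \<phi> (d (0, s)))"
    using jet_eq_iff[OF A slice(1)[OF c] slice(1)[OF d] D] True by simp
  also have "agree m (\<lambda>t. jet_chart \<phi> (jet A k (\<lambda>s. c (t, s))) :: ('e, 'k) vec) (\<lambda>t. jet_chart \<phi> (jet A k (\<lambda>s. d (t, s))))
     \<longleftrightarrow> (\<forall>i\<le>m. \<forall>j::'k. nth_vderiv i (\<lambda>t. nth_vderiv (jet_order j) (\<lambda>s. \<phi> (c (t, s))) 0) 0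
      = nth_vderiv i (\<lambda>t. nth_vderiv (jet_order j) (\<lambda>s. \<phi> (d (t, s))) 0) 0)"
    unfolding agree_def vec_eq_iff nth_vderiv_jet_chart_family[OF A K c D]
      nth_vderiv_jet_chart_family[OF A K d D(1) D(2)[unfolded True]] ..
  also have "\<dots> \<longleftrightarrow> (\<forall>i\<le>m. \<forall>j\<le>k. nth_vderiv i (\<lambda>t. nth_vderiv j (\<lambda>s. \<phi> (c (t, s))) 0) 0
      = nth_vderiv i (\<lambda>t. nth_vderiv j (\<lambda>s. \<phi> (d (t, s))) 0) 0)"
  proof -
    have "(\<forall>i\<le>m. \<forall>j::'k. P i (jet_order j)) \<longleftrightarrow> (\<forall>i\<le>m. \<forall>j\<le>k. P i j)" for P
      by (simp add: jet_order_all[OF K, of "P i" for i])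
    then show ?thesis .
  qed
  \<comment> \<open>The terms with \<open>i = 0\<close> already say that the two jets at
    \<open>t = 0\<close> coincide, so this conjunct is absorbed.\<close>
  also have "agree k (\<lambda>s. \<phi> (c (0, s))) (\<lambda>s. \<phi> (d (0, s))) \<and> \<dots> \<longleftrightarrow> ?R"
    unfolding agree_def using True by force
  finally show ?thesis .
next
  case False
  have "\<not> ?L"
  proof
    assume L: ?L
    note slice = smooth_near_slice[OF finite_dim_real finite_dim_real]
    have "jet A k (\<lambda>s. c (0, s)) = jet A k (\<lambda>s. d (0, s))"
      using L jet_base_jet[OF jet_family[OF A K finite_dim_real c]]
        jet_base_jet[OF jet_family[OF A K finite_dim_real d]] by metis
    then show False using False jet_base_jet[OF slice(1)[OF c]] jet_base_jet[OF slice(1)[OF d]] by metis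
  qed
  then show ?thesis using False by simp
qed

lemma smooth_atlas_tangent_atlas:
  assumes "smooth_atlas A"
  shows "smooth_atlas (tangent_atlas A)"
  unfolding tangent_atlas_def by (rule smooth_atlas_jet_atlas[OF assms]) simp

lemma smooth_near_swap:
  fixes c :: "'x::real_inner \<times> 'y::real_inner \<Rightarrow> 'a"
  assumes "finite_dim TYPE('x)" "finite_dim TYPE('y)" "smooth_near (x, y) A c"
  shows "smooth_near (y, x) A (\<lambda>q. c (snd q, fst q))"
  by (rule smooth_near_compose[OF finite_dim_prod[OF assms(1,2)]])
     (use assms(3) in \<open>auto intro!: smooth_at_Pair smooth_at_fst smooth_at_snd\<close>)

lemma nth_vderiv_commute:
  fixes u :: "real \<times> real \<Rightarrow> 'y::real_inner"
  assumes "smooth_at (t, s) u" "i \<le> 1"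
  shows "nth_vderiv i (\<lambda>t. nth_vderiv j (\<lambda>s. u (t, s)) s) t
       = nth_vderiv j (\<lambda>s. nth_vderiv i (\<lambda>t. u (t, s)) t) s"
proof (cases i)
  case (Suc m)
  then show ?thesis using vderiv_nth_vderiv_commute[OF assms(1)] assms(2) by (simp add: nth_vderiv_Suc One_nat_def)
qed simp

text \<open>Well-definedness of the canonical identification. The family \<open>d\<close> chosen in
  \<open>canon_Phi\<close> has the same double jet as \<open>c\<close>, hence the same mixed
  derivatives of order at most \<open>1\<close> in \<open>t\<close> and \<open>k\<close> in
  \<open>s\<close>; after interchanging the differentiations, the same data describe the swapped
  double jet.\<close>

lemma canon_Phi_jet:
  fixes Q :: "('a, 'e::real_inner) atlas" and c :: "real \<times> real \<Rightarrow> 'a"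
  assumes Q: "smooth_atlas Q" and K: "CARD('k) = k + 1" and c: "smooth_near (0, 0) Q c"
  shows "canon_Phi TYPE('k) k Q
       (jet (jet_atlas k Q :: ('a jet, 'e ^ 'k::{finite, linorder}) atlas) 1 (\<lambda>t. jet Q k (\<lambda>s. c (t, s))))
     = jet (tangent_atlas Q) k (\<lambda>s. jet Q 1 (\<lambda>t. c (t, s)))"
proof -
  let ?X = "\<lambda>c :: real \<times> real \<Rightarrow> 'a.
    jet (jet_atlas k Q :: ('a jet, ('e, 'k) vec) atlas) 1 (\<lambda>t. jet Q k (\<lambda>s. c (t, s)))"
  define d where "d = (SOME d. smooth_near 0 Q d \<and> ?X c = ?X d)"
  have "smooth_near 0 Q d \<and> ?X c = ?X d"
    unfolding d_def by (rule someI[of _ c]) (use c in \<open>simp add: zero_prod_def\<close>)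
  then have d: "smooth_near (0, 0) Q d" "?X c = ?X d" by (simp_all add: zero_prod_def)
  obtain D \<phi> where D: "(D, \<phi>) \<in> Q" "c (0, 0) \<in> D" using c by (rule smooth_near_obtain_chart)
  have *: "c (0, 0) = d (0, 0)" "\<And>i j. i \<le> 1 \<Longrightarrow> j \<le> k \<Longrightarrow>
        nth_vderiv i (\<lambda>t. nth_vderiv j (\<lambda>s. \<phi> (c (t, s))) 0) 0
      = nth_vderiv i (\<lambda>t. nth_vderiv j (\<lambda>s. \<phi> (d (t, s))) 0) 0"
    using d(2) unfolding jet_jet_eq_iff[OF Q K c d(1) D] by blast+
  have sm: "smooth_at (0, 0) (\<lambda>q. \<phi> (c q))" "smooth_at (0, 0) (\<lambda>q. \<phi> (d q))"
    using smooth_near_chart(2)[OF Q c D] smooth_near_chart(2)[OF Q d(1) D(1)] D *(1) by auto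
  note swap = smooth_near_swap[OF finite_dim_real finite_dim_real]
  have "jet (tangent_atlas Q) k (\<lambda>s. jet Q 1 (\<lambda>t. d (t, s))) = jet (tangent_atlas Q) k (\<lambda>s. jet Q 1 (\<lambda>t. c (t, s)))"
    unfolding tangent_atlas_def
  \<comment> \<open>With the parameters swapped, the inner jet is of order \<open>1\<close>, indexed
    by the two-element type, and the outer one of order \<open>k\<close>.\<close>
  proof (rule jet_jet_eq_iff[where 'k = 2 and k = 1 and m = k, OF Q _ swap[OF d(1)] swap[OF c] D(1),
        unfolded fst_conv snd_conv, THEN iffD2], goal_cases)
    case 3
    have "nth_vderiv i (\<lambda>t. nth_vderiv j (\<lambda>s. \<phi> (d (s, t))) 0) 0
        = nth_vderiv i (\<lambda>t. nth_vderiv j (\<lambda>s. \<phi> (c (s, t))) 0) 0" if "i \<le> k" "j \<le> 1" for i j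
      using nth_vderiv_commute[OF sm(1) that(2), of i] nth_vderiv_commute[OF sm(2) that(2), of i]
        *(2)[OF that(2,1)] by simp
    then show ?case using *(1) by simp
  qed (use D * in simp_all)
  then show ?thesis unfolding canon_Phi_def Let_def d_def .
qed

section \<open>Tangent vectors\<close>

lemma jet_coord_tangent:
  assumes "smooth_near 0 A c" "(D, \<phi>) \<in> A" "c 0 \<in> D"
  shows "jet_coord \<phi> 1 (jet A 1 c) = vector_derivative (\<lambda>t. \<phi> (c t)) (at 0)"
  using jet_coord_jet[OF assms, of 1 1] by (simp add: nth_vderiv_Suc One_nat_def)

lemma tangent_eq_iff:
  assumes A: "smooth_atlas A" and c: "smooth_near 0 A c" and d: "smooth_near 0 A d"
    and D: "(D, \<phi>) \<in> A" "c 0 \<in> D" and "c 0 = d 0"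
  shows "jet A 1 c = jet A 1 d \<longleftrightarrow>
     vector_derivative (\<lambda>t. \<phi> (c t)) (at 0) = vector_derivative (\<lambda>t. \<phi> (d t)) (at 0)"
  using jet_eq_iff[OF A c d D, of 1] assms(6) by (simp add: One_nat_def agree_Suc)

lemma tangent_spaceE:
  assumes "X \<in> tangent_space A p"
  obtains c where "smooth_near 0 A c" "c 0 = p" "X = jet A 1 c"
  using assms unfolding tangent_space_def by (auto elim: jets_overE)

lemma jet_in_tangent_space: "smooth_near 0 A c \<Longrightarrow> jet A 1 c \<in> tangent_space A p \<longleftrightarrow> c 0 = p"
  unfolding tangent_space_def by (simp add: jet_in_jets_over_iff)

text \<open>Evaluates the definite descriptions behind \<open>tangent_scale\<close> and
  \<open>tangent_diff\<close>: existence asks for the coordinates in all charts at the base point,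
  uniqueness follows from a single one.\<close>

lemma tangent_the_eq:
  assumes A: "smooth_atlas A" and c: "smooth_near 0 A c"
    and P: "\<And>D \<phi>. (D, \<phi>) \<in> A \<Longrightarrow> c 0 \<in> D \<Longrightarrow> vector_derivative (\<lambda>t. \<phi> (c t)) (at 0) = v \<phi>"
  shows "(THE Z. Z \<in> tangent_space A (c 0) \<and> (\<forall>(D, \<phi>)\<in>A. c 0 \<in> D \<longrightarrow> jet_coord \<phi> 1 Z = v \<phi>)) = jet A 1 c"
proof (rule the_equality)
  show "jet A 1 c \<in> tangent_space A (c 0) \<and> (\<forall>(D, \<phi>)\<in>A. c 0 \<in> D \<longrightarrow> jet_coord \<phi> 1 (jet A 1 c) = v \<phi>)"
    using c P jet_coord_tangent[OF c] by (auto simp: jet_in_tangent_space)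
next
  fix Z assume Z: "Z \<in> tangent_space A (c 0) \<and> (\<forall>(D, \<phi>)\<in>A. c 0 \<in> D \<longrightarrow> jet_coord \<phi> 1 Z = v \<phi>)"
  then obtain d where d: "smooth_near 0 A d" "d 0 = c 0" "Z = jet A 1 d" by (blast elim: tangent_spaceE)
  obtain D \<phi> where D: "(D, \<phi>) \<in> A" "c 0 \<in> D" using c by (rule smooth_near_obtain_chart)
  then have "vector_derivative (\<lambda>t. \<phi> (d t)) (at 0) = v \<phi>"
    using Z jet_coord_tangent[OF d(1) D(1)] d by auto
  then show "Z = jet A 1 c" unfolding d(3)
    using tangent_eq_iff[OF A d(1) c D(1)] P[OF D] D d(2) by simp
qed

text \<open>Scaling a velocity is linear reparametrisation of a curve, so the ray through a vector
  is again given by a family of curves; \<open>r = 0\<close> gives the constant curve.\<close>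

lemma tangent_scale_jet:
  assumes A: "smooth_atlas A" and c: "smooth_near 0 A c"
  shows "tangent_scale A r (jet A 1 c) = jet A 1 (\<lambda>t. c (r * t))"
proof -
  have d: "smooth_near 0 A (\<lambda>t. c (r * t))"
    using c by (auto intro!: smooth_near_compose[OF finite_dim_real, where c = c and g = "(*) r"]
        smooth_at_linear[OF bounded_linear_mult_right])
  have *: "vector_derivative (\<lambda>t. \<phi> (c (r * t))) (at 0) = r *\<^sub>R vector_derivative (\<lambda>t. \<phi> (c t)) (at 0)"
    if D: "(D, \<phi>) \<in> A" "c 0 \<in> D" for D \<phi>
  proof -
    have sm: "smooth_at 0 (\<lambda>t. \<phi> (c t))" by (rule smooth_near_chart(2)[OF A c D])
    have "((*) r has_vector_derivative r) (at 0)" by (auto intro!: derivative_eq_intros)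
    then have "vector_derivative (\<lambda>t. \<phi> (c (r * t))) (at 0) = frechet_derivative (\<lambda>t. \<phi> (c t)) (at 0) (r *\<^sub>R 1)"
      using smooth_at_directional[of "(*) r" 0 "\<lambda>t. \<phi> (c t)" r] sm by (simp add: vector_derivative_at)
    then show ?thesis
      using linear_scale[OF has_derivative_linear[OF smooth_at_has_derivative[OF sm]], of r 1]
        smooth_at_vderiv_eq[OF sm] by simp
  qed
  show ?thesis
    unfolding tangent_scale_def jet_base_jet[OF c]
    using tangent_the_eq[OF A d, of "\<lambda>\<phi>. r *\<^sub>R jet_coord \<phi> 1 (jet A 1 c)"] * jet_coord_tangent[OF c]
    by simp
qed

lemma vector_derivative_chart_change:
  assumes A: "smooth_atlas A" and c: "smooth_near 0 A c"
    and D: "(D, \<phi>) \<in> A" "c 0 \<in> D" and E: "(E, \<psi>) \<in> A" "c 0 \<in> E"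
  shows "vector_derivative (\<lambda>t. \<psi> (c t)) (at 0)
    = frechet_derivative (\<lambda>y. \<psi> (inv_into D \<phi> y)) (at (\<phi> (c 0))) (vector_derivative (\<lambda>t. \<phi> (c t)) (at 0))"
proof -
  note c' = smooth_near_chart[OF A c D]
  have "vector_derivative (\<lambda>t. \<psi> (inv_into D \<phi> (\<phi> (c t)))) (at 0)
    = frechet_derivative (\<lambda>y. \<psi> (inv_into D \<phi> y)) (at (\<phi> (c 0))) (vector_derivative (\<lambda>t. \<phi> (c t)) (at 0))"
    by (intro vector_derivative_at smooth_at_directional[of "\<lambda>t. \<phi> (c t)"] smooth_at_has_vderiv c'
        smooth_atlasD(6)[OF A D(1) E(1) D(2) E(2)])
  moreover have "\<forall>\<^sub>F t in nhds 0. \<psi> (c t) = \<psi> (inv_into D \<phi> (\<phi> (c t)))"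
    using c'(1) by eventually_elim (simp add: smooth_atlasD(4)[OF A D(1)])
  ultimately show ?thesis using vector_derivative_eventually_cong by metis
qed

text \<open>The definite description \<open>tangent_diff\<close> can be evaluated only once the
  difference is known to be the velocity of a curve. From left to right, such a curve
  \<open>e'\<close> is built in the chart and compared with \<open>e\<close>. Chart changes act
  linearly on velocities, which is why one chart decides.\<close>

lemma tangent_diff_iff:
  assumes A: "smooth_atlas A" and c: "smooth_near 0 A c" and d: "smooth_near 0 A d" and e: "smooth_near 0 A e"
    and base: "c 0 = e 0" "d 0 = e 0" and D: "(D, \<phi>) \<in> A" "e 0 \<in> D"
  shows "tangent_diff A (jet A 1 c) (jet A 1 d) = jet A 1 e \<longleftrightarrow>
    vector_derivative (\<lambda>t. \<phi> (c t)) (at 0) - vector_derivative (\<lambda>t. \<phi> (d t)) (at 0)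
      = vector_derivative (\<lambda>t. \<phi> (e t)) (at 0)"
proof -
  let ?v = "\<lambda>\<phi> c. vector_derivative (\<lambda>t. \<phi> (c t)) (at 0)"
  have if_eq: "tangent_diff A (jet A 1 c) (jet A 1 d) = jet A 1 e"
    if e: "smooth_near 0 A e" "c 0 = e 0" "d 0 = e 0" "e 0 \<in> D" "?v \<phi> c - ?v \<phi> d = ?v \<phi> e" for e
  proof -
    have "?v \<psi> e = jet_coord \<psi> 1 (jet A 1 c) - jet_coord \<psi> 1 (jet A 1 d)"
      if E: "(E, \<psi>) \<in> A" "e 0 \<in> E" for E \<psi>
    proof -
      let ?f = "\<lambda>y. \<psi> (inv_into D \<phi> y)"
      have "smooth_at (\<phi> (e 0)) ?f" by (rule smooth_atlasD(6)[OF A D(1) E(1) e(4) E(2)])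
      then have lin: "linear (frechet_derivative ?f (at (\<phi> (e 0))))"
        by (intro has_derivative_linear[OF smooth_at_has_derivative])
      have "?v \<psi> c - ?v \<psi> d = ?v \<psi> e"
        using vector_derivative_chart_change[OF A c D(1) _ E(1)]
          vector_derivative_chart_change[OF A d D(1) _ E(1)]
          vector_derivative_chart_change[OF A e(1) D(1) _ E(1)] e E linear_diff[OF lin] by metis
      then show ?thesis using jet_coord_tangent[OF c E(1)] jet_coord_tangent[OF d E(1)] E e by simp
    qed
    from tangent_the_eq[OF A e(1) this] show ?thesis
      unfolding tangent_diff_def jet_base_jet[OF c] e(2) .
  qed
  note smc = smooth_near_chart[OF A c D(1), unfolded base, OF D(2)]
    and smd = smooth_near_chart[OF A d D(1), unfolded base, OF D(2)]
  \<comment> \<open>Subtracting the displacement of \<open>d\<close> from \<open>c\<close> leaves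
    the starting point at the common base and gives the difference of the velocities.\<close>
  let ?y = "\<lambda>t. \<phi> (c t) - (\<phi> (d t) - \<phi> (d 0))"
  define e' where "e' = (\<lambda>t. inv_into D \<phi> (?y t))"
  have smy: "smooth_at 0 ?y" by (intro smooth_at_diff smc smd smooth_at_const)
  have y0: "?y 0 = \<phi> (e 0)" using base by simp
  then have y0D: "?y 0 \<in> \<phi> ` D" using D(2) by simp
  have e': "smooth_near 0 A e'" unfolding e'_def
    by (rule smooth_near_compose[OF smooth_atlasD(1)[OF A] smooth_near_inv_chart[OF A D(1) y0D] smy])
  have e'0: "e' 0 = e 0" unfolding e'_def y0 by (rule smooth_atlasD(4)[OF A D])
  have "\<forall>\<^sub>F t in nhds 0. ?y t \<in> \<phi> ` D"
    by (rule smooth_at_eventually_comp[OF smy, of "\<lambda>z. z \<in> \<phi> ` D"],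
        rule eventually_nhds_in_open[OF smooth_atlasD(3)[OF A D(1)] y0D])
  then have "\<forall>\<^sub>F t in nhds 0. \<phi> (e' t) = ?y t"
    by eventually_elim (simp add: e'_def f_inv_into_f)
  then have "?v \<phi> e' = vector_derivative ?y (at 0)" by (rule vector_derivative_eventually_cong)
  also have "\<dots> = ?v \<phi> c - (?v \<phi> d - 0)"
    by (intro vector_derivative_at has_vector_derivative_diff smooth_at_has_vderiv smc smd
        has_vector_derivative_const)
  finally have v: "?v \<phi> c - ?v \<phi> d = ?v \<phi> e'" by simp
  show ?thesis
    using if_eq[OF e base D(2)] if_eq[OF e', unfolded e'0, OF base D(2) v]
      tangent_eq_iff[OF A e' e D(1), unfolded e'0, OF D(2) refl] v by auto
qed

section \<open>The lifted discretization map\<close>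

locale jet_lift =
  fixes Q :: "('a, 'e::real_inner) atlas" and k :: nat
    and J :: "('a jet, 'e ^ 'k::{finite, linorder}) atlas"
    and U :: "'a jet set" and R :: "'a jet \<Rightarrow> 'a \<times> 'a"
    and \<Phi> :: "'a jet jet \<Rightarrow> 'a jet jet" and U' :: "'a jet jet set" and R' :: "'a jet jet \<Rightarrow> 'a jet \<times> 'a jet"
  assumes Q: "smooth_atlas Q" and K: "CARD('k) = k + 1" and J_eq: "J = jet_atlas k Q"
    and Phi_eq: "\<Phi> = canon_Phi TYPE('k) k Q"
    and U'_eq: "U' = lift_domain TYPE('k) k Q U"
    and R'_eq: "R' = lift_map TYPE('k) k Q R"
    and R: "discretization_map Q U R"
begin

abbreviation "TQ \<equiv> tangent_atlas Q"
abbreviation "TJ \<equiv> tangent_atlas J"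

lemma J: "smooth_atlas J"
  unfolding J_eq by (rule smooth_atlas_jet_atlas[OF Q K])

lemma TQ: "smooth_atlas TQ"
  by (rule smooth_atlas_tangent_atlas[OF Q])

lemma TJ: "smooth_atlas TJ"
  by (rule smooth_atlas_tangent_atlas[OF J])

lemma U_open: "man_open TQ U"
  and zero_in_U: "q \<in> carrier Q \<Longrightarrow> zero_vector Q q \<in> U"
  and R_zero: "q \<in> carrier Q \<Longrightarrow> R (zero_vector Q q) = (q, q)"
  and R_diff: "v \<in> tangent_space Q q \<Longrightarrow> q \<in> carrier Q \<Longrightarrow>
        tangent_diff Q (jet_map Q 1 (snd \<circ> R) (vertical_lift Q v))
                       (jet_map Q 1 (fst \<circ> R) (vertical_lift Q v)) = v"
  using R unfolding discretization_map_def by auto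

lemma R_smooth: "p \<in> U \<Longrightarrow> smooth_map_at TQ (prod_atlas Q Q) R p"
  using R smooth_map_on_imp_at[OF TQ] unfolding discretization_map_def by blast

section \<open>Families of curves and the formula for the lift\<close>

lemma family: "finite_dim TYPE('x::real_inner) \<Longrightarrow> smooth_near (x :: 'x, 0) Q c \<Longrightarrow>
    smooth_near x J (\<lambda>y. jet Q k (\<lambda>s. c (y, s)))"
  unfolding J_eq by (rule jet_family[OF Q K])

lemma family_TQ: "finite_dim TYPE('x::real_inner) \<Longrightarrow> smooth_near (x :: 'x, 0) Q c \<Longrightarrow>
    smooth_near x TQ (\<lambda>y. jet Q 1 (\<lambda>t. c (y, t)))"
  unfolding tangent_atlas_def by (rule jet_family[OF Q]) simp_all

lemma family_TJ: "finite_dim TYPE('x::real_inner) \<Longrightarrow> smooth_near (x :: 'x, 0) J c \<Longrightarrow>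
    smooth_near x TJ (\<lambda>y. jet J 1 (\<lambda>t. c (y, t)))"
  unfolding tangent_atlas_def by (rule jet_family[OF J]) simp_all

abbreviation jet2 :: "(real \<times> real \<Rightarrow> 'a) \<Rightarrow> 'a jet jet" where
  "jet2 c \<equiv> jet J 1 (\<lambda>t. jet Q k (\<lambda>s. c (t, s)))"

lemma smooth_near_jet_curve:
  "smooth_near (0, 0) Q c \<Longrightarrow> smooth_near (0 :: real) J (\<lambda>t. jet Q k (\<lambda>s. c (t, s)))"
  by (rule family[OF finite_dim_real])

lemma smooth_near_tangent_curve:
  assumes "smooth_near (0, 0) Q (c :: real \<times> real \<Rightarrow> 'a)"
  shows "smooth_near 0 TQ (\<lambda>s. jet Q 1 (\<lambda>t. c (t, s)))"
  using family_TQ[OF finite_dim_real smooth_near_swap[OF finite_dim_real finite_dim_real assms]] by simp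

lemma Phi_jet2: "smooth_near (0, 0) Q c \<Longrightarrow> \<Phi> (jet2 c) = jet TQ k (\<lambda>s. jet Q 1 (\<lambda>t. c (t, s)))"
  unfolding J_eq Phi_eq by (rule canon_Phi_jet[OF Q K])

text \<open>Whether \<open>\<Phi> (jet2 c)\<close> is a jet over \<open>U\<close> depends only on
  its base point, which is the velocity at \<open>s = 0\<close>.\<close>

lemma jet2_in_domain_iff:
  assumes c: "smooth_near (0, 0) Q c"
  shows "jet2 c \<in> U' \<longleftrightarrow> jet Q 1 (\<lambda>t. c (t, 0)) \<in> U"
proof -
  have "jet2 c \<in> carrier TJ"
    unfolding tangent_atlas_def carrier_jet_atlas jet_in_jets_over_iff[OF smooth_near_jet_curve[OF c]]
    using smooth_near_imp_carrier[OF smooth_near_jet_curve[OF c]] .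
  then show ?thesis
    unfolding U'_eq lift_domain_def J_eq[symmetric] Phi_eq[symmetric]
    by (simp add: Phi_jet2[OF c] jet_in_jets_over_iff[OF smooth_near_tangent_curve[OF c]])
qed

text \<open>On families the chosen representatives disappear: both components become jets of a map
  along the curve \<open>w\<close> of velocities.\<close>

lemma lift_map_jet2:
  assumes c: "smooth_near (0, 0) Q c" and U: "jet Q 1 (\<lambda>t. c (t, 0)) \<in> U"
  shows "R' (jet2 c) = (jet Q k (\<lambda>s. fst (R (jet Q 1 (\<lambda>t. c (t, s))))),
                        jet Q k (\<lambda>s. snd (R (jet Q 1 (\<lambda>t. c (t, s))))))"
proof -
  define w where "w = (\<lambda>s. jet Q 1 (\<lambda>t. c (t, s)))"
  have w: "smooth_near 0 TQ w" "w 0 \<in> U"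
    unfolding w_def using smooth_near_tangent_curve[OF c] U by simp_all
  let ?z = "jet TQ k w"
  note r = jet_rep_jet[OF w(1), where k = k]
  \<comment> \<open>Splitting the jet of \<open>R\<close> along the representative uses smoothness
    of this curve in the product; \<open>R_smooth\<close> applies since the representative starts at
    \<open>w 0\<close>, inside \<open>U\<close>.\<close>
  have "smooth_near 0 (prod_atlas Q Q) (\<lambda>s. R (jet_rep ?z s))"
    by (rule smooth_near_map[OF TQ _ r(1)]) (simp add: r w R_smooth)
  note fs = jet_map_fst_snd[OF Q Q this, of k]
  note R0 = smooth_map_at_prodD[OF R_smooth[OF w(2)]]
  have "jet_split Q Q k (jet_map (prod_atlas Q Q) k R ?z) =
      (jet_map Q k (\<lambda>p. fst (R p)) ?z, jet_map Q k (\<lambda>p. snd (R p)) ?z)"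
    unfolding jet_split_def by (simp add: fs jet_map_def[of "prod_atlas Q Q"] o_def)
       (simp add: jet_map_def o_def)
  also have "\<dots> = (jet Q k (\<lambda>s. fst (R (w s))), jet Q k (\<lambda>s. snd (R (w s))))"
    using jet_map_jet[OF TQ Q w(1) R0(1)] jet_map_jet[OF TQ Q w(1) R0(2)] by simp
  finally show ?thesis by (simp add: R'_eq lift_map_def Phi_eq[symmetric] Phi_jet2[OF c] w_def)
qed

text \<open>Lifting twice: the outer tangent jet gives a family in \<open>J\<close> over
  \<open>(y, t)\<close>, and its values give a family in \<open>Q\<close> over
  \<open>((y, t), s)\<close>. The second lift takes place at \<open>(x, 0)\<close>, so for
  \<open>y\<close> near \<open>x\<close> it covers \<open>t\<close> near \<open>0\<close>.\<close>

lemma tangent_plot_lift: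
  fixes X :: "'x::real_inner \<Rightarrow> 'a jet jet"
  assumes fd: "finite_dim TYPE('x)" and X: "smooth_near x TJ X"
  obtains C where "smooth_near ((x, 0), 0) Q C"
    "\<forall>\<^sub>F y in nhds x. smooth_near (0, 0) Q (\<lambda>q. C ((y, fst q), snd q)) \<and>
       X y = jet2 (\<lambda>q. C ((y, fst q), snd q))"
proof -
  have fd2: "finite_dim TYPE('x \<times> real)" by (rule finite_dim_prod[OF fd finite_dim_real])
  obtain c where c: "smooth_near (x, 0) J c" "\<forall>\<^sub>F y in nhds x. X y = jet J 1 (\<lambda>t. c (y, t))"
    using jet_family_lift[OF J _ fd X[unfolded tangent_atlas_def]] by auto
  obtain C where C: "smooth_near ((x, 0), 0) Q C"
     "\<forall>\<^sub>F p in nhds (x, 0). c p = jet Q k (\<lambda>s. C (p, s))"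
    using jet_family_lift[OF Q K fd2 c(1)[unfolded J_eq]] by blast
  show thesis
  proof (rule that[OF C(1)])
    have "\<forall>\<^sub>F y in nhds x. smooth_near ((y, 0), 0) Q C"
      by (rule smooth_at_eventually_comp[where P = "\<lambda>q. smooth_near q Q C"])
         (use smooth_near_eventually[OF C(1)] in \<open>auto intro!: smooth_at_Pair\<close>)
    with c(2) eventually_nhds_PairD(1)[OF C(2)]
    show "\<forall>\<^sub>F y in nhds x. smooth_near (0, 0) Q (\<lambda>q. C ((y, fst q), snd q)) \<and>
       X y = jet2 (\<lambda>q. C ((y, fst q), snd q))"
    proof eventually_elim
      case (elim y)
      have "smooth_near (0, 0) Q (\<lambda>q. C ((y, fst q), snd q))"
        by (rule smooth_near_compose[OF finite_dim_prod[OF fd2 finite_dim_real]])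
           (use elim(3) in \<open>auto intro!: smooth_at_Pair smooth_at_fst smooth_at_snd\<close>)
      moreover have "jet J 1 (\<lambda>t. c (y, t)) = jet2 (\<lambda>q. C ((y, fst q), snd q))"
        by (rule jet_cong) (use elim(2) in eventually_elim, simp)
      ultimately show ?case using elim(1) by simp
    qed
  qed
qed

text \<open>The parameters are regrouped so that \<open>t\<close>, the variable to be
  differentiated, comes last, as \<open>family_TQ\<close> expects.\<close>

lemma family_velocity:
  fixes C :: "('x::real_inner \<times> real) \<times> real \<Rightarrow> 'a"
  assumes fd: "finite_dim TYPE('x)" and C: "smooth_near ((x, 0), 0) Q C"
  shows "smooth_near (x, 0) TQ (\<lambda>p. jet Q 1 (\<lambda>t. C ((fst p, t), snd p)))"
proof -
  have fd2: "finite_dim TYPE('x \<times> real)" by (rule finite_dim_prod[OF fd finite_dim_real])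
  have "smooth_near ((x, 0), 0) Q (\<lambda>q. C ((fst (fst q), snd q), snd (fst q)))"
    by (rule smooth_near_compose[OF finite_dim_prod[OF fd2 finite_dim_real]])
       (use C in \<open>auto intro!: smooth_at_Pair smooth_at_fst smooth_at_snd\<close>)
  from family_TQ[OF fd2 this] show ?thesis by simp
qed

text \<open>Along a lifted family, the values of \<open>\<Phi>\<close> are jets of the smooth
  velocity family. Smoothness of \<open>\<Phi>\<close> serves to make the domain of the lift open,
  as a preimage.\<close>

lemma Phi_smooth:
  assumes "X0 \<in> carrier TJ"
  shows "smooth_map_at TJ (jet_atlas k TQ :: ('a jet jet, ('e ^ 2, 'k) vec) atlas) \<Phi> X0"
proof (rule smooth_map_atI[OF TJ assms])
  fix x :: "('e, 'k) vec ^ 2" and X assume X: "smooth_near x TJ X"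
  have fd: "finite_dim TYPE(('e, 'k) vec ^ 2)" by (rule smooth_atlasD(1)[OF TJ])
  obtain C where C: "smooth_near ((x, 0), 0) Q C"
    "\<forall>\<^sub>F y in nhds x. smooth_near (0, 0) Q (\<lambda>q. C ((y, fst q), snd q)) \<and>
       X y = jet2 (\<lambda>q. C ((y, fst q), snd q))"
    using tangent_plot_lift[OF fd X] by blast
  have "smooth_near x (jet_atlas k TQ :: ('a jet jet, ('e ^ 2, 'k) vec) atlas)
      (\<lambda>y. jet TQ k (\<lambda>s. jet Q 1 (\<lambda>t. C ((y, t), s))))"
    using jet_family[OF TQ K fd family_velocity[OF fd C(1)]] by simp
  then show "smooth_near x (jet_atlas k TQ :: ('a jet jet, ('e ^ 2, 'k) vec) atlas) (\<lambda>y. \<Phi> (X y))"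
  proof (rule smooth_near_cong)
    show "\<forall>\<^sub>F y in nhds x. jet TQ k (\<lambda>s. jet Q 1 (\<lambda>t. C ((y, t), s))) = \<Phi> (X y)"
      using C(2)
    proof eventually_elim
      case (elim y)
      then show ?case using Phi_jet2[of "\<lambda>q. C ((y, fst q), snd q)"] by simp
    qed
  qed
qed

lemma domain_open: "man_open TJ U'"
proof -
  have "man_open TJ {X \<in> carrier TJ. \<Phi> X \<in> jets_over TQ k U}"
    by (rule man_open_preimage[OF TJ smooth_atlas_jet_atlas[OF TQ K] Phi_smooth
          man_open_jets_over[OF TQ K U_open]])
  then show ?thesis by (simp add: U'_eq lift_domain_def Phi_eq J_eq)
qed

text \<open>Each component of \<open>R'\<close> along a lifted family is the jet of a component of
  \<open>R\<close> along the smooth family \<open>?w\<close> of velocities, hence smooth by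
  \<open>family\<close>.\<close>

lemma lift_map_smooth_at:
  assumes "X0 \<in> U'"
  shows "smooth_map_at TJ (prod_atlas J J) R' X0"
proof (rule smooth_map_atI[OF TJ])
  show "X0 \<in> carrier TJ" using assms domain_open by (auto simp: man_open_def)
  fix x :: "('e, 'k) vec ^ 2" and X assume X: "smooth_near x TJ X" and Xx: "X x = X0"
  have fd: "finite_dim TYPE(('e, 'k) vec ^ 2)" by (rule smooth_atlasD(1)[OF TJ])
  obtain C where C: "smooth_near ((x, 0), 0) Q C"
    "\<forall>\<^sub>F y in nhds x. smooth_near (0, 0) Q (\<lambda>q. C ((y, fst q), snd q)) \<and>
       X y = jet2 (\<lambda>q. C ((y, fst q), snd q))"
    using tangent_plot_lift[OF fd X] by blast
  let ?w = "\<lambda>p. jet Q 1 (\<lambda>t. C ((fst p, t), snd p))"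
  have w: "smooth_near (x, 0) TQ ?w" by (rule family_velocity[OF fd C(1)])
  have wU: "?w (x, 0) \<in> U"
    using eventually_nhds_x_imp_x[OF C(2)] jet2_in_domain_iff[of "\<lambda>q. C ((x, fst q), snd q)"] assms Xx
    by auto
  have "smooth_near (x, 0) (prod_atlas Q Q) (\<lambda>p. R (?w p))"
    by (rule smooth_near_map[OF TQ R_smooth[OF wU] w])
  then have "smooth_near (x, 0) Q (\<lambda>p. fst (R (?w p)))" "smooth_near (x, 0) Q (\<lambda>p. snd (R (?w p)))"
    by (simp_all add: smooth_near_prod)
  from family[OF fd this(1)] family[OF fd this(2)]
  have "smooth_near x (prod_atlas J J) (\<lambda>y. (jet Q k (\<lambda>s. fst (R (?w (y, s)))), jet Q k (\<lambda>s. snd (R (?w (y, s))))))"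
    by (simp add: smooth_near_prod)
  then show "smooth_near x (prod_atlas J J) (\<lambda>y. R' (X y))"
  proof (rule smooth_near_cong)
    \<comment> \<open>The formula for \<open>R'\<close> is conditional on
      \<open>?w (y, 0) \<in> U\<close>; openness of \<open>U\<close> provides this for all
      \<open>y\<close> near \<open>x\<close>.\<close>
    have "smooth_near x TQ (\<lambda>y. ?w (y, 0))"
      by (rule smooth_near_slice(2)[OF fd finite_dim_real w])
    then have "\<forall>\<^sub>F y in nhds x. ?w (y, 0) \<in> U"
      by (rule man_open_smooth_near[OF TQ U_open]) (use wU in simp)
    with C(2) show "\<forall>\<^sub>F y in nhds x. (jet Q k (\<lambda>s. fst (R (?w (y, s)))), jet Q k (\<lambda>s. snd (R (?w (y, s))))) = R' (X y)"
    proof eventually_elim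
      case (elim y)
      then show ?case using lift_map_jet2[of "\<lambda>q. C ((y, fst q), snd q)"] by simp
    qed
  qed
qed

text \<open>The zero vector at the jet of \<open>c\<close> is represented by the family that is
  constant in \<open>t\<close>. Its velocities are the zero vectors along \<open>c\<close>, on which
  \<open>R\<close> takes diagonal values for every \<open>s\<close> near \<open>0\<close>, and this
  equality of germs passes to jets.\<close>

lemma zero_lift:
  assumes "z \<in> carrier J"
  shows "zero_vector J z \<in> U'" "R' (zero_vector J z) = (z, z)"
proof -
  obtain c where c: "smooth_near 0 Q c" "z = jet Q k c"
    using assms unfolding J_eq carrier_jet_atlas by (auto elim: jets_overE)
  let ?c = "\<lambda>q :: real \<times> real. c (snd q)"
  have c': "smooth_near (0, 0) Q ?c"
    by (rule smooth_near_compose[OF finite_dim_real]) (use c in \<open>auto intro!: smooth_at_snd\<close>)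
  have z: "zero_vector J z = jet2 ?c" by (simp add: zero_vector_def c)
  have "c 0 \<in> carrier Q" by (rule smooth_near_imp_carrier[OF c(1)])
  then have U: "jet Q 1 (\<lambda>t. ?c (t, 0)) \<in> U" using zero_in_U by (simp add: zero_vector_def)
  then show "zero_vector J z \<in> U'" unfolding z jet2_in_domain_iff[OF c'] .
  have ev: "\<forall>\<^sub>F s in nhds 0. R (jet Q 1 (\<lambda>t. c s)) = (c s, c s)"
    using smooth_near_eventually[OF c(1)]
    by eventually_elim (use R_zero smooth_near_imp_carrier in \<open>auto simp: zero_vector_def\<close>)
  have "jet Q k (\<lambda>s. fst (R (jet Q 1 (\<lambda>t. c s)))) = z" "jet Q k (\<lambda>s. snd (R (jet Q 1 (\<lambda>t. c s)))) = z"
    unfolding c(2) by (rule jet_cong, use ev in eventually_elim, simp)+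
  then show "R' (zero_vector J z) = (z, z)" unfolding z lift_map_jet2[OF c' U] by simp
qed

text \<open>\<open>W (r, s)\<close> is \<open>r\<close> times the velocity of \<open>t \<mapsto> c (t, s)\<close>. Along \<open>r\<close>, both \<open>R'\<close> on the ray through
  \<open>jet2 c\<close> and \<open>R\<close> on the rays through the velocities are expressed by the same family \<open>R (W (r, s))\<close>,
  and the derivatives in \<open>r\<close> and \<open>s\<close> commute.\<close>

lemma lift_diff:
  assumes v: "v \<in> tangent_space J z"
  shows "tangent_diff J (jet_map J 1 (snd \<circ> R') (vertical_lift J v))
                       (jet_map J 1 (fst \<circ> R') (vertical_lift J v)) = v"
proof -
  note fd = finite_dim_real and fd2 = finite_dim_prod[OF finite_dim_real finite_dim_real]
  obtain \<gamma> where \<gamma>: "smooth_near 0 J \<gamma>" "v = jet J 1 \<gamma>" using v by (rule tangent_spaceE)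
  obtain c where c: "smooth_near (0, 0) Q c" "\<forall>\<^sub>F t in nhds 0. \<gamma> t = jet Q k (\<lambda>s. c (t, s))"
    using jet_family_lift[OF Q K fd \<gamma>(1)[unfolded J_eq]] by blast
  have v_eq: "v = jet2 c" unfolding \<gamma>(2) by (rule jet_cong[OF c(2)])
  define W where "W = (\<lambda>p. jet Q 1 (\<lambda>t. c (fst p * t, snd p)))"
  have "smooth_near ((0, 0), 0) Q (\<lambda>q. c (fst (fst q) * snd q, snd (fst q)))"
  proof (rule smooth_near_compose[OF fd2])
    have "smooth_at ((0, 0), 0) (\<lambda>q :: (real \<times> real) \<times> real. fst (fst q) *\<^sub>R snd q)"
      by (intro smooth_at_scaleR smooth_at_fst smooth_at_snd smooth_at_ident)
    then show "smooth_at ((0, 0), 0) (\<lambda>q :: (real \<times> real) \<times> real. (fst (fst q) * snd q, snd (fst q)))"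
      by (auto intro!: smooth_at_Pair smooth_at_fst smooth_at_snd)
  qed (use c in simp)
  from family_TQ[OF fd2 this] have W: "smooth_near (0, 0) TQ W"
    by (simp add: W_def)
  have carr: "\<forall>\<^sub>F s in nhds 0. c (0, s) \<in> carrier Q"
    using smooth_near_eventually[OF smooth_near_slice(1)[OF fd fd c(1)]]
    by eventually_elim (rule smooth_near_imp_carrier)
  have W0: "W (0, s) = zero_vector Q (c (0, s))" for s by (simp add: W_def zero_vector_def)
  have W00: "W (0, 0) \<in> U" using zero_in_U eventually_nhds_x_imp_x[OF carr] by (simp add: W0)
  have "smooth_near (0, 0) (prod_atlas Q Q) (\<lambda>p. R (W p))"
    by (rule smooth_near_map[OF TQ R_smooth[OF W00] W])
  then have h: "smooth_near (0, 0) Q (\<lambda>p. fst (R (W p)))" "smooth_near (0, 0) Q (\<lambda>p. snd (R (W p)))"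
    by (simp_all add: smooth_near_prod)

  have smr: "smooth_near (0, 0) Q (\<lambda>q. c (r * fst q, snd q))" for r
    by (rule smooth_near_compose[OF fd2])
       (use c(1) in \<open>auto intro!: smooth_at_Pair smooth_at_fst smooth_at_snd
          smooth_at_linear_comp[OF bounded_linear_mult_right]\<close>)
  have scale: "tangent_scale J r v = jet2 (\<lambda>q. c (r * fst q, snd q))" for r
    unfolding v_eq using tangent_scale_jet[OF J smooth_near_jet_curve[OF c(1)]] by simp
  \<comment> \<open>\<open>vertical_lift\<close> is the jet of this ray, and
    \<open>jet_map_jet\<close> applies to smooth curves. The ray comes from evaluating a curve with
    velocity \<open>v\<close> at the product of ray parameter and time.\<close>
  have sm_scale: "smooth_near 0 TJ (\<lambda>r. tangent_scale J r v)"
  proof -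
    have "smooth_near (0, 0) J (\<lambda>q. (\<lambda>t. jet Q k (\<lambda>s. c (t, s))) (fst q * snd q))"
    proof (rule smooth_near_compose[OF fd])
      show "smooth_at (0, 0) (\<lambda>q :: real \<times> real. fst q * snd q)"
        using smooth_at_scaleR[OF smooth_at_fst smooth_at_snd, of "(0, 0)" "\<lambda>q. q" "\<lambda>q :: real \<times> real. q"]
        by simp
    qed (use smooth_near_jet_curve[OF c(1)] in simp)
    from family_TJ[OF fd this] show ?thesis by (simp add: scale)
  qed
  have evU: "\<forall>\<^sub>F r in nhds 0. W (r, 0) \<in> U"
    by (rule man_open_smooth_near[OF TQ U_open smooth_near_slice(2)[OF fd fd W] W00])
  have R'_ray: "\<forall>\<^sub>F r in nhds 0. R' (tangent_scale J r v) =
      (jet Q k (\<lambda>s. fst (R (W (r, s)))), jet Q k (\<lambda>s. snd (R (W (r, s)))))"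
    using evU
  proof eventually_elim
    case (elim r)
    then show ?case using lift_map_jet2[OF smr[of r]] by (simp add: scale W_def)
  qed
  \<comment> \<open>At \<open>r = 0\<close> both components start at the jet of
    \<open>s \<mapsto> c (0, s)\<close>, the base point at which the difference of tangent vectors
    is formed.\<close>
  have base: "jet Q k (\<lambda>s. fst (R (W (0, s)))) = jet Q k (\<lambda>s. c (0, s))"
    "jet Q k (\<lambda>s. snd (R (W (0, s)))) = jet Q k (\<lambda>s. c (0, s))"
    by (rule jet_cong, use carr in eventually_elim, simp add: W0 R_zero)+
  have "jet2 (\<lambda>q. c (0 * fst q, snd q)) \<in> U'"
    unfolding jet2_in_domain_iff[OF smr] using W00 by (simp add: W_def)
  then have "tangent_scale J 0 v \<in> U'" by (simp only: scale)
  note R'0 = smooth_map_at_prodD[OF lift_map_smooth_at[OF this]]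
  have X: "jet_map J 1 (fst \<circ> R') (vertical_lift J v) = jet2 (\<lambda>p. fst (R (W p)))"
    unfolding vertical_lift_def o_def jet_map_jet[OF TJ J sm_scale R'0(1)]
    by (rule jet_cong) (use R'_ray in eventually_elim, simp)
  have Y: "jet_map J 1 (snd \<circ> R') (vertical_lift J v) = jet2 (\<lambda>p. snd (R (W p)))"
    unfolding vertical_lift_def o_def jet_map_jet[OF TJ J sm_scale R'0(2)]
    by (rule jet_cong) (use R'_ray in eventually_elim, simp)

  obtain D \<phi> where D: "(D, \<phi>) \<in> Q" "c (0, 0) \<in> D" using c(1) by (rule smooth_near_obtain_chart)
  have hD: "fst (R (W (0, 0))) \<in> D" "snd (R (W (0, 0))) \<in> D"
    using D R_zero eventually_nhds_x_imp_x[OF carr] by (simp_all add: W0)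
  let ?d = "\<lambda>c s. nth_vderiv 1 (\<lambda>r. \<phi> (c (r, s))) 0"
  \<comment> \<open>For each \<open>s\<close> this is the derivative condition of \<open>R\<close>
    at the velocity of \<open>t \<mapsto> c (t, s)\<close>, read in one chart of \<open>Q\<close>.
    It is established for all \<open>s\<close> near \<open>0\<close>, because an equality of germs
    in \<open>s\<close> can be differentiated.\<close>
  have diff: "\<forall>\<^sub>F s in nhds 0. ?d (\<lambda>p. snd (R (W p))) s - ?d (\<lambda>p. fst (R (W p))) s = ?d c s"
    using carr smooth_near_chart(1)[OF Q smooth_near_slice(1)[OF fd fd c(1)] D]
      eventually_smooth_near_slice(2)[OF fd fd c(1)] eventually_smooth_near_slice(2)[OF fd fd W]
      eventually_smooth_near_slice(2)[OF fd fd h(1)] eventually_smooth_near_slice(2)[OF fd fd h(2)]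
  proof eventually_elim
    case (elim s)
    let ?v = "jet Q 1 (\<lambda>t. c (t, s))"
    have "?v \<in> tangent_space Q (c (0, s))" using elim by (simp add: jet_in_tangent_space)
    note dQ = R_diff[OF this elim(1)]
    have lift: "vertical_lift Q ?v = jet TQ 1 (\<lambda>r. W (r, s))"
      unfolding vertical_lift_def tangent_scale_jet[OF Q elim(3)] W_def by simp
    have "W (0, s) \<in> U" using elim(1) zero_in_U by (simp add: W0)
    note R0 = smooth_map_at_prodD[OF R_smooth[OF this]]
    have "tangent_diff Q (jet Q 1 (\<lambda>r. snd (R (W (r, s))))) (jet Q 1 (\<lambda>r. fst (R (W (r, s))))) = ?v"
      using dQ unfolding lift o_def jet_map_jet[OF TQ Q elim(4) R0(1)] jet_map_jet[OF TQ Q elim(4) R0(2)] .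
    moreover have "R (W (0, s)) = (c (0, s), c (0, s))" using R_zero elim(1) by (simp add: W0)
    ultimately show ?case
      using tangent_diff_iff[OF Q elim(6,5,3) _ _ D(1)] elim(2) by (simp add: One_nat_def nth_vderiv_Suc)
  qed

  note sm_c = smooth_near_chart(2)[OF Q c(1) D]
    and sm_h = smooth_near_chart(2)[OF Q h(1) D(1) hD(1)] smooth_near_chart(2)[OF Q h(2) D(1) hD(2)]
  have sm_d: "smooth_at 0 (\<lambda>s. nth_vderiv 1 (\<lambda>r. u (r, s)) 0)" if "smooth_at (0, 0) u" for u :: "real \<times> real \<Rightarrow> 'e"
  proof -
    have "smooth_at (0, 0) (\<lambda>q. u (snd q, fst q))"
      by (rule smooth_at_compose[OF fd2]) (use that in \<open>auto intro!: smooth_at_Pair smooth_at_fst smooth_at_snd\<close>)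
    from smooth_at_param_nth[OF fd this] show ?thesis by simp
  qed
  let ?ch = "\<lambda>c. vector_derivative (\<lambda>t. jet_chart \<phi> (jet Q k (\<lambda>s. c (t, s))) :: ('e, 'k) vec) (at 0)"
  \<comment> \<open>Interchanging derivatives turns each entry of the velocity in the induced chart
    into an \<open>s\<close>-derivative of \<open>?d\<close>, so that \<open>diff\<close> can be
    inserted.\<close>
  have ch: "?ch b $ i = nth_vderiv (jet_order i) (\<lambda>s. ?d b s) 0"
    if "smooth_near (0, 0) Q b" "b (0, 0) \<in> D" for b i
  proof -
    have "nth_vderiv 1 (\<lambda>t. jet_chart \<phi> (jet Q k (\<lambda>s. b (t, s))) :: ('e, 'k) vec) 0 $ i
       = nth_vderiv 1 (\<lambda>t. nth_vderiv (jet_order i) (\<lambda>s. \<phi> (b (t, s))) 0) 0"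
      by (rule nth_vderiv_jet_chart_family[OF Q K that(1) D(1) that(2)])
    also have "\<dots> = nth_vderiv (jet_order i) (\<lambda>s. ?d b s) 0"
      using nth_vderiv_commute[OF smooth_near_chart(2)[OF Q that(1) D(1) that(2)], of 1] by simp
    finally show ?thesis by (simp add: One_nat_def nth_vderiv_Suc)
  qed
  have "?ch (\<lambda>p. snd (R (W p))) - ?ch (\<lambda>p. fst (R (W p))) = ?ch c"
  proof (rule vec_eq_iff[THEN iffD2], rule allI)
    fix i :: 'k
    have "nth_vderiv (jet_order i) (\<lambda>s. ?d (\<lambda>p. snd (R (W p))) s - ?d (\<lambda>p. fst (R (W p))) s) 0
       = nth_vderiv (jet_order i) (\<lambda>s. ?d c s) 0"
      by (rule nth_vderiv_cong[OF diff])
    then show "(?ch (\<lambda>p. snd (R (W p))) - ?ch (\<lambda>p. fst (R (W p)))) $ i = ?ch c $ i"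
      using nth_vderiv_diff[OF sm_d[OF sm_h(2)] sm_d[OF sm_h(1)], of "jet_order i"]
      by (simp add: ch[OF h(1) hD(1)] ch[OF h(2) hD(2)] ch[OF c(1) D(2)])
  qed
  then have "tangent_diff J (jet2 (\<lambda>p. snd (R (W p)))) (jet2 (\<lambda>p. fst (R (W p)))) = jet2 c"
  proof (rule tangent_diff_iff[OF J smooth_near_jet_curve[OF h(2)] smooth_near_jet_curve[OF h(1)]
        smooth_near_jet_curve[OF c(1)], THEN iffD2, rotated -1])
    show "(jets_over Q k D, jet_chart \<phi>) \<in> J" unfolding J_eq by (rule jet_atlas_chart[OF D(1)])
    show "jet Q k (\<lambda>s. c (0, s)) \<in> jets_over Q k D"
      using D(2) by (simp add: jet_in_jets_over_iff[OF smooth_near_slice(1)[OF fd fd c(1)]])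
  qed (simp_all add: base)
  then show ?thesis by (simp only: X Y v_eq[symmetric])
qed

lemma discretization_map_lift: "discretization_map J U' R'"
  unfolding discretization_map_def
  using domain_open smooth_map_onI[OF TJ domain_open lift_map_smooth_at] zero_lift lift_diff by blast

end

theorem theorem1:
  fixes Q :: "('a, 'e::real_inner) atlas"
    and U :: "'a jet set"
    and R :: "'a jet \<Rightarrow> 'a \<times> 'a"
    and k :: nat
  assumes "smooth_manifold Q"
    and "k \<ge> 1"
    and "CARD('k) = k + 1"
    and "discretization_map Q U R"
  shows "discretization_map (jet_atlas k Q :: ('a jet, 'e ^ 'k::{finite, linorder}) atlas)
           (lift_domain TYPE('k) k Q U) (lift_map TYPE('k) k Q R)"
proof -
  interpret jet_lift Q k "jet_atlas k Q :: ('a jet, 'e ^ 'k::{finite, linorder}) atlas" U R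
    "canon_Phi TYPE('k) k Q" "lift_domain TYPE('k) k Q U" "lift_map TYPE('k) k Q R"
    by unfold_locales (use assms smooth_manifold_imp_smooth_atlas in auto)
  show ?thesis by (rule discretization_map_lift)
qed

end
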